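(* If the natural number exo-type $\mathbb N^e$ is cofibrant, then the exo-type $\mathsf{UnLBinTree}^e$ of unlabeled binary exo-trees is both cofibrant and sharp.
   Context: Setting: two-level type theory (2LTT). There is a hierarchy of universes $\mathcal U$ whose terms are called types and which obeys homotopy type theory (with the usual $\prod,\sum,+,\mathbf 1,\mathbf 0,\mathbb N$ and identity type $=$), and a hierarchy of exo-universes $\mathcal U^e$ whose terms are called exo-types, with their own formers $\prod^e,\sum^e,+^e,\mathbf 1^e,\mathbf 0^e,\mathbb N^e$ and exo-equality $=^e$. Every type is also an exo-type. Exo-level inductive exo-types eliminate into arbitrary exo-types, while inductive types eliminate only into types. Axioms: univalence (hence function extensionality) for $=$; function extensionality and uniqueness of identity proofs for $=^e$. An exo-isomorphism $A\cong B$ of exo-types consists of $f:A\to B$, $g:B\to A$ with $f\circ g=^e\mathrm{id}_B$ and $g\circ f=^e\mathrm{id}_A$. An exo-type $A$ is fibrant if there is a type $RA:\mathcal U$ (its fibrant match) with $A\cong RA$. An exo-type $A$ is cofibrant if (1) for any $Y:A\to\mathcal U$ the exo-type $\prod^e_{a:A}Y(a)$ is fibrant, and (2) in that case, if each $Y(a)$ is contractible (with respect to $=$), then so is the fibrant match of $\prod^e_{a:A}Y(a)$. If $A,B$ are fibrant exo-types with exo-isomorphisms $s_A:RA\to A$ and $r_B:B\to RB$ ($RA,RB:\mathcal U$), a map $f:A\to B$ is a fibrant-equivalence if $r_B\circ f\circ s_A:RA\to RB$ is an equivalence of types. An exo-type $A$ is sharp if it is cofibrant and there are a type $RA:\mathcal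 U$ and a map $r:A\to RA$ such that for any $Y:RA\to\mathcal U$ the precomposition map $(-\circ r):\prod_{c:RA}Y(c)\to\prod^e_{a:A}Y(r(a))$ is a fibrant-equivalence. $\mathsf{UnLBinTree}^e:\mathcal U^e$ is the inductive exo-type with constructors $\mathsf{u\text{-}leaf}^e:\mathsf{UnLBinTree}^e$ and $\mathsf{u\text{-}node}^e:\mathsf{UnLBinTree}^e\to\mathsf{UnLBinTree}^e\to\mathsf{UnLBinTree}^e$. *)

theory Defs
  imports Main
begin

text \<open>
  A deep embedding of two-level type theory: raw terms with de Bruijn indices, judgmental
  equality, and the typing judgment.  The rules are those of intensional Martin-Loef type theory
  with Russell-style universes (as in the appendix of the HoTT book), given once for each of two
  layers: \<open>Inner\<close> (types, universes \<open>Uni Inner i\<close>) and \<open>Exo\<close> (exo-types, universes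
  \<open>Uni Exo i\<close>).  Every former is tagged with its layer, so that e.g. \<open>NatT Inner\<close> and
  \<open>NatT Exo\<close> are different, and \<open>IdT Inner\<close>, \<open>IdT Exo\<close> are the identity type and the exo-equality.
\<close>

datatype layer = Inner | Exo

text \<open>
  Binding structure: \<open>PiT\<close>, \<open>SigT\<close>, \<open>Lam\<close> bind one variable in their last argument.
  In an eliminator the first term argument is the motive, which binds the scrutinee
  (for \<open>J\<close>: the endpoint and then the path, i.e. based path induction); the last one is the
  scrutinee; in between are the methods, binding the constructor arguments, followed by the
  induction hypotheses.
\<close>

datatype tm =
    Var nat
  | Uni layer nat
  | PiT layer tm tm | Lam layer tm tm | App layer tm tm
  | SigT layer tm tm | Pr layer tm tm | SigElim layer tm tm tm
  | UnitT layer | Star layer | UnitElim layer tm tm tm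
  | EmptyT layer | EmptyElim layer tm tm
  | PlusT layer tm tm | InL layer tm | InR layer tm | PlusElim layer tm tm tm tm
  | NatT layer | NZero layer | NSuc layer tm | NatElim layer tm tm tm tm
  | IdT layer tm tm tm | Refl layer tm | J layer tm tm tm
  | UnLBinTree | ULeaf | UNode tm tm | TreeElim tm tm tm tm
  | ExoFunext tm tm tm
  | ExoUIP tm tm
  | UA nat tm tm


section \<open>Substitution\<close>

definition up_ren :: "(nat \<Rightarrow> nat) \<Rightarrow> nat \<Rightarrow> nat" where
  "up_ren \<rho> n = (case n of 0 \<Rightarrow> 0 | Suc m \<Rightarrow> Suc (\<rho> m))"

primrec rename :: "(nat \<Rightarrow> nat) \<Rightarrow> tm \<Rightarrow> tm" where
  "rename \<rho> (Var n) = Var (\<rho> n)"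
| "rename \<rho> (Uni s i) = Uni s i"
| "rename \<rho> (PiT s A B) = PiT s (rename \<rho> A) (rename (up_ren \<rho>) B)"
| "rename \<rho> (Lam s A b) = Lam s (rename \<rho> A) (rename (up_ren \<rho>) b)"
| "rename \<rho> (App s f a) = App s (rename \<rho> f) (rename \<rho> a)"
| "rename \<rho> (SigT s A B) = SigT s (rename \<rho> A) (rename (up_ren \<rho>) B)"
| "rename \<rho> (Pr s a b) = Pr s (rename \<rho> a) (rename \<rho> b)"
| "rename \<rho> (SigElim s C d p) =
    SigElim s (rename (up_ren \<rho>) C) (rename ((up_ren ^^ 2) \<rho>) d) (rename \<rho> p)"
| "rename \<rho> (UnitT s) = UnitT s"
| "rename \<rho> (Star s) = Star s"
| "rename \<rho> (UnitElim s C c t) = UnitElim s (rename (up_ren \<rho>) C) (rename \<rho> c) (rename \<rho> t)"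
| "rename \<rho> (EmptyT s) = EmptyT s"
| "rename \<rho> (EmptyElim s C t) = EmptyElim s (rename (up_ren \<rho>) C) (rename \<rho> t)"
| "rename \<rho> (PlusT s A B) = PlusT s (rename \<rho> A) (rename \<rho> B)"
| "rename \<rho> (InL s a) = InL s (rename \<rho> a)"
| "rename \<rho> (InR s b) = InR s (rename \<rho> b)"
| "rename \<rho> (PlusElim s C l r t) =
    PlusElim s (rename (up_ren \<rho>) C) (rename (up_ren \<rho>) l) (rename (up_ren \<rho>) r) (rename \<rho> t)"
| "rename \<rho> (NatT s) = NatT s"
| "rename \<rho> (NZero s) = NZero s"
| "rename \<rho> (NSuc s n) = NSuc s (rename \<rho> n)"
| "rename \<rho> (NatElim s C z st n) =
    NatElim s (rename (up_ren \<rho>) C) (rename \<rho> z) (rename ((up_ren ^^ 2) \<rho>) st) (rename \<rho> n)"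
| "rename \<rho> (IdT s A a b) = IdT s (rename \<rho> A) (rename \<rho> a) (rename \<rho> b)"
| "rename \<rho> (Refl s a) = Refl s (rename \<rho> a)"
| "rename \<rho> (J s C c p) = J s (rename ((up_ren ^^ 2) \<rho>) C) (rename \<rho> c) (rename \<rho> p)"
| "rename \<rho> UnLBinTree = UnLBinTree"
| "rename \<rho> ULeaf = ULeaf"
| "rename \<rho> (UNode t u) = UNode (rename \<rho> t) (rename \<rho> u)"
| "rename \<rho> (TreeElim C lf nd t) =
    TreeElim (rename (up_ren \<rho>) C) (rename \<rho> lf) (rename ((up_ren ^^ 4) \<rho>) nd) (rename \<rho> t)"
| "rename \<rho> (ExoFunext f g h) = ExoFunext (rename \<rho> f) (rename \<rho> g) (rename \<rho> h)"
| "rename \<rho> (ExoUIP p q) = ExoUIP (rename \<rho> p) (rename \<rho> q)"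
| "rename \<rho> (UA i A B) = UA i (rename \<rho> A) (rename \<rho> B)"

definition up :: "(nat \<Rightarrow> tm) \<Rightarrow> nat \<Rightarrow> tm" where
  "up \<sigma> n = (case n of 0 \<Rightarrow> Var 0 | Suc m \<Rightarrow> rename Suc (\<sigma> m))"

primrec subst :: "(nat \<Rightarrow> tm) \<Rightarrow> tm \<Rightarrow> tm" where
  "subst \<sigma> (Var n) = \<sigma> n"
| "subst \<sigma> (Uni s i) = Uni s i"
| "subst \<sigma> (PiT s A B) = PiT s (subst \<sigma> A) (subst (up \<sigma>) B)"
| "subst \<sigma> (Lam s A b) = Lam s (subst \<sigma> A) (subst (up \<sigma>) b)"
| "subst \<sigma> (App s f a) = App s (subst \<sigma> f) (subst \<sigma> a)"
| "subst \<sigma> (SigT s A B) = SigT s (subst \<sigma> A) (subst (up \<sigma>) B)"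
| "subst \<sigma> (Pr s a b) = Pr s (subst \<sigma> a) (subst \<sigma> b)"
| "subst \<sigma> (SigElim s C d p) =
    SigElim s (subst (up \<sigma>) C) (subst ((up ^^ 2) \<sigma>) d) (subst \<sigma> p)"
| "subst \<sigma> (UnitT s) = UnitT s"
| "subst \<sigma> (Star s) = Star s"
| "subst \<sigma> (UnitElim s C c t) = UnitElim s (subst (up \<sigma>) C) (subst \<sigma> c) (subst \<sigma> t)"
| "subst \<sigma> (EmptyT s) = EmptyT s"
| "subst \<sigma> (EmptyElim s C t) = EmptyElim s (subst (up \<sigma>) C) (subst \<sigma> t)"
| "subst \<sigma> (PlusT s A B) = PlusT s (subst \<sigma> A) (subst \<sigma> B)"
| "subst \<sigma> (InL s a) = InL s (subst \<sigma> a)"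
| "subst \<sigma> (InR s b) = InR s (subst \<sigma> b)"
| "subst \<sigma> (PlusElim s C l r t) =
    PlusElim s (subst (up \<sigma>) C) (subst (up \<sigma>) l) (subst (up \<sigma>) r) (subst \<sigma> t)"
| "subst \<sigma> (NatT s) = NatT s"
| "subst \<sigma> (NZero s) = NZero s"
| "subst \<sigma> (NSuc s n) = NSuc s (subst \<sigma> n)"
| "subst \<sigma> (NatElim s C z st n) =
    NatElim s (subst (up \<sigma>) C) (subst \<sigma> z) (subst ((up ^^ 2) \<sigma>) st) (subst \<sigma> n)"
| "subst \<sigma> (IdT s A a b) = IdT s (subst \<sigma> A) (subst \<sigma> a) (subst \<sigma> b)"
| "subst \<sigma> (Refl s a) = Refl s (subst \<sigma> a)"
| "subst \<sigma> (J s C c p) = J s (subst ((up ^^ 2) \<sigma>) C) (subst \<sigma> c) (subst \<sigma> p)"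
| "subst \<sigma> UnLBinTree = UnLBinTree"
| "subst \<sigma> ULeaf = ULeaf"
| "subst \<sigma> (UNode t u) = UNode (subst \<sigma> t) (subst \<sigma> u)"
| "subst \<sigma> (TreeElim C lf nd t) =
    TreeElim (subst (up \<sigma>) C) (subst \<sigma> lf) (subst ((up ^^ 4) \<sigma>) nd) (subst \<sigma> t)"
| "subst \<sigma> (ExoFunext f g h) = ExoFunext (subst \<sigma> f) (subst \<sigma> g) (subst \<sigma> h)"
| "subst \<sigma> (ExoUIP p q) = ExoUIP (subst \<sigma> p) (subst \<sigma> q)"
| "subst \<sigma> (UA i A B) = UA i (subst \<sigma> A) (subst \<sigma> B)"

text \<open>
  \<open>inst k ts t\<close> replaces the innermost variables \<open>0, 1, \<dots>\<close> of \<open>t\<close> by the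
  entries of \<open>ts\<close> (\<open>hd ts\<close> for index \<open>0\<close>), and moves the remaining
  variables into a context with \<open>k\<close> new variables, in whose scope \<open>ts\<close> lives.
\<close>

definition inst :: "nat \<Rightarrow> tm list \<Rightarrow> tm \<Rightarrow> tm" where
  "inst k ts = subst (\<lambda>n. if n < length ts then ts ! n else Var (n - length ts + k))"

abbreviation lift :: "nat \<Rightarrow> tm \<Rightarrow> tm" where
  "lift k \<equiv> inst k []"


section \<open>Judgmental equality\<close>

text \<open>
  As in pure type systems, judgmental equality is conversion of raw terms: the congruence generated
  by the computation rules of all eliminators and by eta for functions.  The typing judgment uses
  it through the rule \<open>convert\<close>.
\<close>

inductive conv :: "tm \<Rightarrow> tm \<Rightarrow> bool" (infix "\<doteq>" 50) where
  conv_refl: "t \<doteq> t"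
| conv_sym: "t \<doteq> u \<Longrightarrow> u \<doteq> t"
| conv_trans: "t \<doteq> u \<Longrightarrow> u \<doteq> v \<Longrightarrow> t \<doteq> v"

| Pi_beta: "App s (Lam s A b) a \<doteq> inst 0 [a] b"
| Pi_eta: "Lam s A (App s (lift 1 f) (Var 0)) \<doteq> f"
| Sig_beta: "SigElim s C d (Pr s a b) \<doteq> inst 0 [b, a] d"
| Unit_beta: "UnitElim s C c (Star s) \<doteq> c"
| Plus_beta_l: "PlusElim s C l r (InL s a) \<doteq> inst 0 [a] l"
| Plus_beta_r: "PlusElim s C l r (InR s b) \<doteq> inst 0 [b] r"
| Nat_beta_0: "NatElim s C z st (NZero s) \<doteq> z"
| Nat_beta_Suc: "NatElim s C z st (NSuc s n) \<doteq> inst 0 [NatElim s C z st n, n] st"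
| Id_beta: "J s C c (Refl s a) \<doteq> c"
| Tree_beta_leaf: "TreeElim C lf nd ULeaf \<doteq> lf"
| Tree_beta_node: "TreeElim C lf nd (UNode t u) \<doteq>
    inst 0 [TreeElim C lf nd u, TreeElim C lf nd t, u, t] nd"

| cong_Pi: "A \<doteq> A' \<Longrightarrow> B \<doteq> B' \<Longrightarrow> PiT s A B \<doteq> PiT s A' B'"
| cong_Lam: "A \<doteq> A' \<Longrightarrow> b \<doteq> b' \<Longrightarrow> Lam s A b \<doteq> Lam s A' b'"
| cong_App: "f \<doteq> f' \<Longrightarrow> a \<doteq> a' \<Longrightarrow> App s f a \<doteq> App s f' a'"
| cong_Sig: "A \<doteq> A' \<Longrightarrow> B \<doteq> B' \<Longrightarrow> SigT s A B \<doteq> SigT s A' B'"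
| cong_Pr: "a \<doteq> a' \<Longrightarrow> b \<doteq> b' \<Longrightarrow> Pr s a b \<doteq> Pr s a' b'"
| cong_SigElim: "C \<doteq> C' \<Longrightarrow> d \<doteq> d' \<Longrightarrow> p \<doteq> p' \<Longrightarrow> SigElim s C d p \<doteq> SigElim s C' d' p'"
| cong_UnitElim: "C \<doteq> C' \<Longrightarrow> c \<doteq> c' \<Longrightarrow> t \<doteq> t' \<Longrightarrow> UnitElim s C c t \<doteq> UnitElim s C' c' t'"
| cong_EmptyElim: "C \<doteq> C' \<Longrightarrow> t \<doteq> t' \<Longrightarrow> EmptyElim s C t \<doteq> EmptyElim s C' t'"
| cong_Plus: "A \<doteq> A' \<Longrightarrow> B \<doteq> B' \<Longrightarrow> PlusT s A B \<doteq> PlusT s A' B'"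
| cong_InL: "a \<doteq> a' \<Longrightarrow> InL s a \<doteq> InL s a'"
| cong_InR: "b \<doteq> b' \<Longrightarrow> InR s b \<doteq> InR s b'"
| cong_PlusElim: "C \<doteq> C' \<Longrightarrow> l \<doteq> l' \<Longrightarrow> r \<doteq> r' \<Longrightarrow> t \<doteq> t' \<Longrightarrow>
    PlusElim s C l r t \<doteq> PlusElim s C' l' r' t'"
| cong_NSuc: "n \<doteq> n' \<Longrightarrow> NSuc s n \<doteq> NSuc s n'"
| cong_NatElim: "C \<doteq> C' \<Longrightarrow> z \<doteq> z' \<Longrightarrow> st \<doteq> st' \<Longrightarrow> n \<doteq> n' \<Longrightarrow>
    NatElim s C z st n \<doteq> NatElim s C' z' st' n'"
| cong_Id: "A \<doteq> A' \<Longrightarrow> a \<doteq> a' \<Longrightarrow> b \<doteq> b' \<Longrightarrow> IdT s A a b \<doteq> IdT s A' a' b'"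
| cong_Refl: "a \<doteq> a' \<Longrightarrow> Refl s a \<doteq> Refl s a'"
| cong_J: "C \<doteq> C' \<Longrightarrow> c \<doteq> c' \<Longrightarrow> p \<doteq> p' \<Longrightarrow> J s C c p \<doteq> J s C' c' p'"
| cong_UNode: "t \<doteq> t' \<Longrightarrow> u \<doteq> u' \<Longrightarrow> UNode t u \<doteq> UNode t' u'"
| cong_TreeElim: "C \<doteq> C' \<Longrightarrow> lf \<doteq> lf' \<Longrightarrow> nd \<doteq> nd' \<Longrightarrow> t \<doteq> t' \<Longrightarrow>
    TreeElim C lf nd t \<doteq> TreeElim C' lf' nd' t'"
| cong_ExoFunext: "f \<doteq> f' \<Longrightarrow> g \<doteq> g' \<Longrightarrow> h \<doteq> h' \<Longrightarrow> ExoFunext f g h \<doteq> ExoFunext f' g' h'"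
| cong_ExoUIP: "p \<doteq> p' \<Longrightarrow> q \<doteq> q' \<Longrightarrow> ExoUIP p q \<doteq> ExoUIP p' q'"
| cong_UA: "A \<doteq> A' \<Longrightarrow> B \<doteq> B' \<Longrightarrow> UA i A B \<doteq> UA i A' B'"


section \<open>Equivalences of types\<close>

definition arr :: "layer \<Rightarrow> tm \<Rightarrow> tm \<Rightarrow> tm" where
  "arr s A B = PiT s A (lift 1 B)"

definition prodT :: "layer \<Rightarrow> tm \<Rightarrow> tm \<Rightarrow> tm" where
  "prodT s A B = SigT s A (lift 1 B)"

definition idfun :: "layer \<Rightarrow> tm \<Rightarrow> tm" where
  "idfun s A = Lam s A (Var 0)"

text \<open>\<open>\<Sum>(a : A). \<Prod>(x : A). a = x\<close>\<close>

definition is_contr :: "tm \<Rightarrow> tm" where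
  "is_contr A = SigT Inner A (PiT Inner (lift 1 A) (IdT Inner (lift 2 A) (Var 1) (Var 0)))"

text \<open>
  \<open>(\<Sum>(g : B \<rightarrow> A). \<Prod>(b : B). f (g b) = b) \<prodT> (\<Sum>(h : B \<rightarrow> A). \<Prod>(a : A). h (f a) = a)\<close>
\<close>

definition is_equiv :: "tm \<Rightarrow> tm \<Rightarrow> tm \<Rightarrow> tm" where
  "is_equiv A B f = prodT Inner
    (SigT Inner (arr Inner B A) (PiT Inner (lift 1 B)
      (IdT Inner (lift 2 B) (App Inner (lift 2 f) (App Inner (Var 1) (Var 0))) (Var 0))))
    (SigT Inner (arr Inner B A) (PiT Inner (lift 1 A)
      (IdT Inner (lift 2 A) (App Inner (Var 1) (App Inner (lift 2 f) (Var 0))) (Var 0))))"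

definition equiv :: "tm \<Rightarrow> tm \<Rightarrow> tm" where
  "equiv A B = SigT Inner (arr Inner A B) (is_equiv (lift 1 A) (lift 1 B) (Var 0))"

definition id_equiv :: "tm \<Rightarrow> tm" where
  "id_equiv A = Pr Inner (idfun Inner A)
    (Pr Inner (Pr Inner (idfun Inner A) (Lam Inner A (Refl Inner (Var 0))))
              (Pr Inner (idfun Inner A) (Lam Inner A (Refl Inner (Var 0)))))"

text \<open>The canonical map \<open>(A = B) \<rightarrow> (A \<simeq> B)\<close> for \<open>A, B\<close> in the universe of level \<open>i\<close>.\<close>

definition id_to_equiv :: "nat \<Rightarrow> tm \<Rightarrow> tm \<Rightarrow> tm" where
  "id_to_equiv i A B = Lam Inner (IdT Inner (Uni Inner i) A B)
    (J Inner (equiv (lift 3 A) (Var 1)) (id_equiv (lift 1 A)) (Var 0))"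


section \<open>Typing\<close>

text \<open>
  Contexts are lists with the most recent variable first.  The motive of an eliminator lives in a
  universe of the same layer as the inductive type: inductive types eliminate only into types,
  inductive exo-types into arbitrary exo-types (hence also into types, by the rule
  \<open>type_is_exotype\<close>).
\<close>

inductive wf :: "tm list \<Rightarrow> bool"
  and has_type :: "tm list \<Rightarrow> tm \<Rightarrow> tm \<Rightarrow> bool" ("(_ \<turnstile> _ \<Colon> _)" [51, 51, 51] 50)
where
  wf_Nil: "wf []"
| wf_Cons: "wf \<Gamma> \<Longrightarrow> \<Gamma> \<turnstile> A \<Colon> Uni Exo i \<Longrightarrow> wf (A # \<Gamma>)"

| variable: "wf \<Gamma> \<Longrightarrow> n < length \<Gamma> \<Longrightarrow> \<Gamma> \<turnstile> Var n \<Colon> lift (Suc n) (\<Gamma> ! n)"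
| convert: "\<Gamma> \<turnstile> t \<Colon> A \<Longrightarrow> A \<doteq> B \<Longrightarrow> \<Gamma> \<turnstile> B \<Colon> Uni Exo i \<Longrightarrow> \<Gamma> \<turnstile> t \<Colon> B"

| Uni_form: "wf \<Gamma> \<Longrightarrow> \<Gamma> \<turnstile> Uni s i \<Colon> Uni s (Suc i)"
| cumulative: "\<Gamma> \<turnstile> A \<Colon> Uni s i \<Longrightarrow> \<Gamma> \<turnstile> A \<Colon> Uni s (Suc i)"
| type_is_exotype: "\<Gamma> \<turnstile> A \<Colon> Uni Inner i \<Longrightarrow> \<Gamma> \<turnstile> A \<Colon> Uni Exo i"

| Pi_form: "\<Gamma> \<turnstile> A \<Colon> Uni s i \<Longrightarrow> A # \<Gamma> \<turnstile> B \<Colon> Uni s i \<Longrightarrow> \<Gamma> \<turnstile> PiT s A B \<Colon> Uni s i"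
| Pi_intro: "\<Gamma> \<turnstile> PiT s A B \<Colon> Uni s i \<Longrightarrow> A # \<Gamma> \<turnstile> b \<Colon> B \<Longrightarrow> \<Gamma> \<turnstile> Lam s A b \<Colon> PiT s A B"
| Pi_elim: "\<Gamma> \<turnstile> f \<Colon> PiT s A B \<Longrightarrow> \<Gamma> \<turnstile> a \<Colon> A \<Longrightarrow> \<Gamma> \<turnstile> App s f a \<Colon> inst 0 [a] B"

| Sig_form: "\<Gamma> \<turnstile> A \<Colon> Uni s i \<Longrightarrow> A # \<Gamma> \<turnstile> B \<Colon> Uni s i \<Longrightarrow> \<Gamma> \<turnstile> SigT s A B \<Colon> Uni s i"
| Sig_intro: "\<Gamma> \<turnstile> SigT s A B \<Colon> Uni s i \<Longrightarrow> \<Gamma> \<turnstile> a \<Colon> A \<Longrightarrow> \<Gamma> \<turnstile> b \<Colon> inst 0 [a] B \<Longrightarrow>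
    \<Gamma> \<turnstile> Pr s a b \<Colon> SigT s A B"
| Sig_elim: "SigT s A B # \<Gamma> \<turnstile> C \<Colon> Uni s i \<Longrightarrow>
    B # A # \<Gamma> \<turnstile> d \<Colon> inst 2 [Pr s (Var 1) (Var 0)] C \<Longrightarrow> \<Gamma> \<turnstile> p \<Colon> SigT s A B \<Longrightarrow>
    \<Gamma> \<turnstile> SigElim s C d p \<Colon> inst 0 [p] C"

| Unit_form: "wf \<Gamma> \<Longrightarrow> \<Gamma> \<turnstile> UnitT s \<Colon> Uni s i"
| Unit_intro: "wf \<Gamma> \<Longrightarrow> \<Gamma> \<turnstile> Star s \<Colon> UnitT s"
| Unit_elim: "UnitT s # \<Gamma> \<turnstile> C \<Colon> Uni s i \<Longrightarrow> \<Gamma> \<turnstile> c \<Colon> inst 0 [Star s] C \<Longrightarrow> \<Gamma> \<turnstile> t \<Colon> UnitT s \<Longrightarrow>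
    \<Gamma> \<turnstile> UnitElim s C c t \<Colon> inst 0 [t] C"

| Empty_form: "wf \<Gamma> \<Longrightarrow> \<Gamma> \<turnstile> EmptyT s \<Colon> Uni s i"
| Empty_elim: "EmptyT s # \<Gamma> \<turnstile> C \<Colon> Uni s i \<Longrightarrow> \<Gamma> \<turnstile> t \<Colon> EmptyT s \<Longrightarrow>
    \<Gamma> \<turnstile> EmptyElim s C t \<Colon> inst 0 [t] C"

| Plus_form: "\<Gamma> \<turnstile> A \<Colon> Uni s i \<Longrightarrow> \<Gamma> \<turnstile> B \<Colon> Uni s i \<Longrightarrow> \<Gamma> \<turnstile> PlusT s A B \<Colon> Uni s i"
| Plus_intro_l: "\<Gamma> \<turnstile> PlusT s A B \<Colon> Uni s i \<Longrightarrow> \<Gamma> \<turnstile> a \<Colon> A \<Longrightarrow> \<Gamma> \<turnstile> InL s a \<Colon> PlusT s A B"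
| Plus_intro_r: "\<Gamma> \<turnstile> PlusT s A B \<Colon> Uni s i \<Longrightarrow> \<Gamma> \<turnstile> b \<Colon> B \<Longrightarrow> \<Gamma> \<turnstile> InR s b \<Colon> PlusT s A B"
| Plus_elim: "PlusT s A B # \<Gamma> \<turnstile> C \<Colon> Uni s i \<Longrightarrow>
    A # \<Gamma> \<turnstile> l \<Colon> inst 1 [InL s (Var 0)] C \<Longrightarrow> B # \<Gamma> \<turnstile> r \<Colon> inst 1 [InR s (Var 0)] C \<Longrightarrow>
    \<Gamma> \<turnstile> t \<Colon> PlusT s A B \<Longrightarrow> \<Gamma> \<turnstile> PlusElim s C l r t \<Colon> inst 0 [t] C"

| Nat_form: "wf \<Gamma> \<Longrightarrow> \<Gamma> \<turnstile> NatT s \<Colon> Uni s i"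
| Nat_intro_0: "wf \<Gamma> \<Longrightarrow> \<Gamma> \<turnstile> NZero s \<Colon> NatT s"
| Nat_intro_Suc: "\<Gamma> \<turnstile> n \<Colon> NatT s \<Longrightarrow> \<Gamma> \<turnstile> NSuc s n \<Colon> NatT s"
| Nat_elim: "NatT s # \<Gamma> \<turnstile> C \<Colon> Uni s i \<Longrightarrow> \<Gamma> \<turnstile> z \<Colon> inst 0 [NZero s] C \<Longrightarrow>
    C # NatT s # \<Gamma> \<turnstile> st \<Colon> inst 2 [NSuc s (Var 1)] C \<Longrightarrow> \<Gamma> \<turnstile> n \<Colon> NatT s \<Longrightarrow>
    \<Gamma> \<turnstile> NatElim s C z st n \<Colon> inst 0 [n] C"

| Id_form: "\<Gamma> \<turnstile> A \<Colon> Uni s i \<Longrightarrow> \<Gamma> \<turnstile> a \<Colon> A \<Longrightarrow> \<Gamma> \<turnstile> b \<Colon> A \<Longrightarrow> \<Gamma> \<turnstile> IdT s A a b \<Colon> Uni s i"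
| Id_intro: "\<Gamma> \<turnstile> A \<Colon> Uni s i \<Longrightarrow> \<Gamma> \<turnstile> a \<Colon> A \<Longrightarrow> \<Gamma> \<turnstile> Refl s a \<Colon> IdT s A a a"
| Id_elim: "IdT s (lift 1 A) (lift 1 a) (Var 0) # A # \<Gamma> \<turnstile> C \<Colon> Uni s i \<Longrightarrow>
    \<Gamma> \<turnstile> c \<Colon> inst 0 [Refl s a, a] C \<Longrightarrow> \<Gamma> \<turnstile> b \<Colon> A \<Longrightarrow> \<Gamma> \<turnstile> p \<Colon> IdT s A a b \<Longrightarrow>
    \<Gamma> \<turnstile> J s C c p \<Colon> inst 0 [p, b] C"

| Tree_form: "wf \<Gamma> \<Longrightarrow> \<Gamma> \<turnstile> UnLBinTree \<Colon> Uni Exo i"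
| Tree_intro_leaf: "wf \<Gamma> \<Longrightarrow> \<Gamma> \<turnstile> ULeaf \<Colon> UnLBinTree"
| Tree_intro_node: "\<Gamma> \<turnstile> t \<Colon> UnLBinTree \<Longrightarrow> \<Gamma> \<turnstile> u \<Colon> UnLBinTree \<Longrightarrow> \<Gamma> \<turnstile> UNode t u \<Colon> UnLBinTree"
| Tree_elim: "UnLBinTree # \<Gamma> \<turnstile> C \<Colon> Uni Exo i \<Longrightarrow> \<Gamma> \<turnstile> lf \<Colon> inst 0 [ULeaf] C \<Longrightarrow>
    inst 3 [Var 1] C # inst 2 [Var 1] C # UnLBinTree # UnLBinTree # \<Gamma>
      \<turnstile> nd \<Colon> inst 4 [UNode (Var 3) (Var 2)] C \<Longrightarrow>
    \<Gamma> \<turnstile> t \<Colon> UnLBinTree \<Longrightarrow> \<Gamma> \<turnstile> TreeElim C lf nd t \<Colon> inst 0 [t] C"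

| exo_funext: "\<Gamma> \<turnstile> f \<Colon> PiT Exo A B \<Longrightarrow> \<Gamma> \<turnstile> g \<Colon> PiT Exo A B \<Longrightarrow>
    \<Gamma> \<turnstile> h \<Colon> PiT Exo A (IdT Exo B (App Exo (lift 1 f) (Var 0)) (App Exo (lift 1 g) (Var 0))) \<Longrightarrow>
    \<Gamma> \<turnstile> ExoFunext f g h \<Colon> IdT Exo (PiT Exo A B) f g"
| exo_uip: "\<Gamma> \<turnstile> p \<Colon> IdT Exo A a b \<Longrightarrow> \<Gamma> \<turnstile> q \<Colon> IdT Exo A a b \<Longrightarrow>
    \<Gamma> \<turnstile> ExoUIP p q \<Colon> IdT Exo (IdT Exo A a b) p q"
| univalence: "\<Gamma> \<turnstile> A \<Colon> Uni Inner i \<Longrightarrow> \<Gamma> \<turnstile> B \<Colon> Uni Inner i \<Longrightarrow>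
    \<Gamma> \<turnstile> UA i A B \<Colon> is_equiv (IdT Inner (Uni Inner i) A B) (equiv A B) (id_to_equiv i A B)"


section \<open>Fibrant, cofibrant and sharp exo-types\<close>

text \<open>
  The parameter \<open>l\<close> is the level of the universe \<open>\<U>\<close> of types over which the
  definitions quantify.
\<close>

definition exo_comp :: "tm \<Rightarrow> tm \<Rightarrow> tm \<Rightarrow> tm" where
  "exo_comp A g f = Lam Exo A (App Exo (lift 1 g) (App Exo (lift 1 f) (Var 0)))"

text \<open>\<open>\<Sum>(f : A \<rightarrow> B). \<Sum>(g : B \<rightarrow> A). (f \<circ> g = id) \<prodT> (g \<circ> f = id)\<close>, all at the exo-level.\<close>

definition exo_iso :: "tm \<Rightarrow> tm \<Rightarrow> tm" where
  "exo_iso A B = SigT Exo (arr Exo A B) (SigT Exo (arr Exo (lift 1 B) (lift 1 A))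
    (prodT Exo
      (IdT Exo (arr Exo (lift 2 B) (lift 2 B))
        (exo_comp (lift 2 B) (Var 1) (Var 0)) (idfun Exo (lift 2 B)))
      (IdT Exo (arr Exo (lift 2 A) (lift 2 A))
        (exo_comp (lift 2 A) (Var 0) (Var 1)) (idfun Exo (lift 2 A)))))"

definition is_fibrant :: "nat \<Rightarrow> tm \<Rightarrow> tm" where
  "is_fibrant l A = SigT Exo (Uni Inner l) (exo_iso (lift 1 A) (Var 0))"

text \<open>
  For \<open>w = (RA, f, g, _)\<close> of type \<open>is_fibrant l A\<close> these are
  \<open>RA\<close>, \<open>f : A \<rightarrow> RA\<close> and \<open>g : RA \<rightarrow> A\<close>.
\<close>

definition fibrant_match :: "nat \<Rightarrow> tm \<Rightarrow> tm" where
  "fibrant_match l w = SigElim Exo (Uni Inner l) (Var 1) w"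

definition to_match :: "nat \<Rightarrow> tm \<Rightarrow> tm \<Rightarrow> tm" where
  "to_match l A w =
    SigElim Exo (arr Exo (lift 1 A) (fibrant_match l (Var 0)))
      (SigElim Exo (arr Exo (lift 3 A) (Var 2)) (Var 1) (Var 0)) w"

definition from_match :: "nat \<Rightarrow> tm \<Rightarrow> tm \<Rightarrow> tm" where
  "from_match l A w =
    SigElim Exo (arr Exo (fibrant_match l (Var 0)) (lift 1 A))
      (SigElim Exo (arr Exo (Var 2) (lift 3 A))
        (SigElim Exo (arr Exo (Var 4) (lift 5 A)) (Var 1) (Var 0)) (Var 0)) w"

text \<open>A type is fibrant, being its own match: the element \<open>(T, id, id, refl, refl)\<close>.\<close>

definition type_fibrant :: "tm \<Rightarrow> tm" where
  "type_fibrant T = Pr Exo T (Pr Exo (idfun Exo T) (Pr Exo (idfun Exo T)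
    (Pr Exo (Refl Exo (idfun Exo T)) (Refl Exo (idfun Exo T)))))"

text \<open>\<open>f : A \<rightarrow> B\<close> between exo-types with fibrancy witnesses \<open>wA\<close> and \<open>wB\<close>.\<close>

definition is_fibrant_equiv :: "nat \<Rightarrow> tm \<Rightarrow> tm \<Rightarrow> tm \<Rightarrow> tm \<Rightarrow> tm \<Rightarrow> tm" where
  "is_fibrant_equiv l A B wA wB f =
    is_equiv (fibrant_match l wA) (fibrant_match l wB)
      (Lam Inner (fibrant_match l wA)
        (App Exo (lift 1 (to_match l B wB))
          (App Exo (lift 1 f) (App Exo (lift 1 (from_match l A wA)) (Var 0)))))"

text \<open>
  \<open>\<Prod>(Y : A \<rightarrow> \<U>). \<Sum>(w : is_fibrant (\<Prod>(a : A). Y a)).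
     (\<Prod>(a : A). is_contr (Y a)) \<rightarrow> is_contr (fibrant_match w)\<close>, where all formers outside
  \<open>is_contr\<close> are exo.
\<close>

definition is_cofibrant :: "nat \<Rightarrow> tm \<Rightarrow> tm" where
  "is_cofibrant l A = PiT Exo (arr Exo A (Uni Inner l))
    (SigT Exo (is_fibrant l (PiT Exo (lift 1 A) (App Exo (Var 1) (Var 0))))
      (arr Exo (PiT Exo (lift 2 A) (is_contr (App Exo (Var 2) (Var 0))))
        (is_contr (fibrant_match l (Var 0)))))"

text \<open>
  For \<open>c : is_cofibrant l A\<close> and \<open>Y : A \<rightarrow> \<U>\<close>, the witness that
  \<open>\<Prod>(a : A). Y a\<close> is fibrant.
\<close>

definition cofibrant_fibrant :: "nat \<Rightarrow> tm \<Rightarrow> tm \<Rightarrow> tm \<Rightarrow> tm" where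
  "cofibrant_fibrant l A c Y =
    SigElim Exo (is_fibrant l (PiT Exo (lift 1 A) (App Exo (lift 2 Y) (Var 0)))) (Var 1)
      (App Exo c Y)"

text \<open>
  \<open>\<Sum>(c : is_cofibrant l A). \<Sum>(RA : \<U>). \<Sum>(r : A \<rightarrow> RA). \<Prod>(Y : RA \<rightarrow> \<U>).\<close> the map
  \<open>\<lambda>u a. u (r a)\<close> from \<open>\<Prod>(c : RA). Y c\<close> to \<open>\<Prod>(a : A). Y (r a)\<close> is
  a fibrant-equivalence; its domain is a type, its codomain is fibrant by \<open>c\<close>.
  In the body the variables \<open>Y, r, RA, c\<close> have the indices \<open>0, 1, 2, 3\<close>.
\<close>

definition is_sharp :: "nat \<Rightarrow> tm \<Rightarrow> tm" where
  "is_sharp l A =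
    SigT Exo (is_cofibrant l A)
      (SigT Exo (Uni Inner l)
        (SigT Exo (arr Exo (lift 2 A) (Var 0))
          (PiT Exo (arr Inner (Var 1) (Uni Inner l))
            (let D = PiT Inner (Var 2) (App Inner (Var 1) (Var 0));
                 Yr = Lam Exo (lift 4 A) (App Inner (Var 1) (App Exo (Var 2) (Var 0)));
                 E = PiT Exo (lift 4 A) (App Inner (Var 1) (App Exo (Var 2) (Var 0)))
             in is_fibrant_equiv l D E (type_fibrant D) (cofibrant_fibrant l (lift 4 A) (Var 3) Yr)
                  (Lam Exo D (Lam Exo (lift 5 A) (App Inner (Var 1) (App Exo (Var 3) (Var 0)))))))))"

text \<open>A proposition of the theory (an exo-type) is proved by exhibiting a closed term of it.\<close>

definition derivable :: "tm \<Rightarrow> bool" where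
  "derivable A \<longleftrightarrow> (\<exists>t. [] \<turnstile> t \<Colon> A)"

end

theory Submission
  imports Defs
begin

text \<open>
  Cantor's pairing of natural numbers turns \<open>UnLBinTree\<^sup>e\<close> into an exo-isomorphic copy of
  \<open>\<nat>\<^sup>e\<close>: enumerate the trees by iterating a successor, where the code of a node is one more than
  the pair of the codes of its subtrees.  Cofibrancy is transported along this isomorphism.

  For sharpness take the inner natural numbers \<open>\<nat>\<close> and the canonical map \<open>r\<close>.  A function on
  \<open>\<nat>\<^sup>e\<close> with values in \<open>Y \<circ> r\<close> extends to \<open>\<nat>\<close> by recursion on the inner number: the type of such
  functions has a fibrant match because \<open>\<nat>\<^sup>e\<close> is cofibrant, so it can occur in the motive, and the
  value at \<open>k\<close> is the first value of the \<open>k\<close>-th tail.  Extending and restricting are pointwise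
  inverse; the second cofibrancy condition yields extensionality for exo-functions up to inner
  equality, and univalence yields it for inner functions.

  The derivation is an explicit proof term, divided into a signature of constants; it is checked by a
  type checker that is proved sound for the typing judgment.
\<close>


section \<open>Substitution\<close>

text \<open>The detour through numbers is due to the two subtrees of a node: pairing packs them into
  one number, so that cofibrancy of trees becomes reindexing along an exo-isomorphism. Its round
  trips are exo-equalities, not computations, so dependent values have to be transported; uniqueness
  of identity proofs makes these transports agree. The obstacle in sharpness is that inner numbers
  eliminate only into types, whereas functions on \<open>\<nat>\<^sup>e\<close> and exo-equalities
  between them do not form types. Values are therefore kept in fibrant matches, results are compared
  by the inner equality, and exo-equalities serve only to transport inner types. Univalence is not a
  former of the language of the checker. The proof term abstracts over it and is applied to
  \<open>UA\<close> at the end. Universe levels are counted from the parameter \<open>l\<close>, so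
  one checked term serves for every \<open>l\<close>.\<close>

lemma funpow_numerals [simp]:
  "(f ^^ 2) x = f (f x)" "(f ^^ 3) x = f (f (f x))" "(f ^^ 4) x = f (f (f (f x)))"
  by (simp_all add: eval_nat_numeral)

lemma up_simps [simp]:
  "up \<sigma> 0 = Var 0" "up \<sigma> (Suc n) = rename Suc (\<sigma> n)"
  "up (up (up (up \<sigma>))) 2 = Var 2" "up (up (up (up \<sigma>))) 3 = Var 3"
  by (simp_all add: up_def numeral_eq_Suc)

lemma up_ren_simps [simp]: "up_ren \<rho> 0 = 0" "up_ren \<rho> (Suc n) = Suc (\<rho> n)"
  by (simp_all add: up_ren_def)

lemma nat_funext: "f 0 = g 0 \<Longrightarrow> (\<And>n. f (Suc n) = g (Suc n)) \<Longrightarrow> f = g" for f g :: "nat \<Rightarrow> 'a"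
  by (rule ext) (metis not0_implies_Suc)

lemma up_Var_comp: "up (\<lambda>n. Var (\<rho> n)) = (\<lambda>n. Var (up_ren \<rho> n))"
  by (rule nat_funext) auto

lemma rename_eq_subst: "rename \<rho> t = subst (\<lambda>n. Var (\<rho> n)) t"
  by (induction t arbitrary: \<rho>) (simp_all add: up_Var_comp)

lemma up_comp_up_ren: "up (\<lambda>n. \<sigma> (\<rho> n)) = (\<lambda>n. up \<sigma> (up_ren \<rho> n))"
  by (rule nat_funext) auto

text \<open>\<open>up\<close> weakens by \<open>rename\<close>, so the composition laws climb from
  renamings to substitutions: each law passes under a binder by means of the previous ones.\<close>

lemma subst_rename: "subst \<sigma> (rename \<rho> t) = subst (\<lambda>n. \<sigma> (\<rho> n)) t"
  by (induction t arbitrary: \<sigma> \<rho>) (simp_all add: up_comp_up_ren)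

lemma rename_rename: "rename \<rho>' (rename \<rho> t) = rename (\<lambda>n. \<rho>' (\<rho> n)) t"
  by (simp add: rename_eq_subst [of \<rho>'] subst_rename) (simp add: rename_eq_subst)

lemma up_rename_comp: "up (\<lambda>n. rename \<rho> (\<sigma> n)) = (\<lambda>n. rename (up_ren \<rho>) (up \<sigma> n))"
  by (rule nat_funext) (auto simp: rename_rename)

lemma rename_subst: "rename \<rho> (subst \<sigma> t) = subst (\<lambda>n. rename \<rho> (\<sigma> n)) t"
  by (induction t arbitrary: \<sigma> \<rho>) (simp_all add: up_rename_comp)

lemma up_subst_comp: "up (\<lambda>n. subst \<tau> (\<sigma> n)) = (\<lambda>n. subst (up \<tau>) (up \<sigma> n))"
  by (rule nat_funext) (auto simp: rename_subst subst_rename)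

lemma subst_subst: "subst \<tau> (subst \<sigma> t) = subst (\<lambda>n. subst \<tau> (\<sigma> n)) t"
  by (induction t arbitrary: \<sigma> \<tau>) (simp_all add: up_subst_comp)

lemma up_Var [simp]: "up Var = Var"
  by (rule nat_funext) auto

lemma subst_Var [simp]: "subst Var t = t"
  by (induction t) simp_all

lemma funpow_up: "(up ^^ m) \<sigma> n = (if n < m then Var n else rename (\<lambda>i. i + m) (\<sigma> (n - m)))"
proof (induction m arbitrary: n)
  case 0
  then show ?case by (simp add: rename_eq_subst)
next
  case (Suc m)
  then show ?case by (cases n) (auto simp: rename_rename)
qed

text \<open>The typing rules instantiate motives in contexts with up to four new variables. One
  commutation law for arbitrary \<open>k\<close> covers them all.\<close>

lemma subst_inst_funpow:
  "subst ((up ^^ k) \<sigma>) (inst k ts t) =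
    inst k (map (subst ((up ^^ k) \<sigma>)) ts) (subst ((up ^^ length ts) \<sigma>) t)"
proof -
  have "(\<lambda>n. subst ((up ^^ k) \<sigma>) (if n < length ts then ts ! n else Var (n - length ts + k))) =
    (\<lambda>n. subst (\<lambda>n. if n < length ts then map (subst ((up ^^ k) \<sigma>)) ts ! n else Var (n - length ts + k))
      ((up ^^ length ts) \<sigma> n))"
  proof (rule ext)
    fix n
    show "subst ((up ^^ k) \<sigma>) (if n < length ts then ts ! n else Var (n - length ts + k)) =
      subst (\<lambda>n. if n < length ts then map (subst ((up ^^ k) \<sigma>)) ts ! n else Var (n - length ts + k))
        ((up ^^ length ts) \<sigma> n)"
    proof (cases "n < length ts")
      case True
      then show ?thesis by (simp add: funpow_up)
    next
      case False
      then obtain m where "n = m + length ts" by (metis add.commute le_Suc_ex not_less)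
      then show ?thesis by (simp add: funpow_up subst_rename) (simp add: rename_eq_subst)
    qed
  qed
  then show ?thesis
    by (simp add: inst_def subst_subst cong: if_cong)
qed

lemmas subst_inst [simp] =
  subst_inst_funpow [where k = 0, simplified]
  subst_inst_funpow [where k = 1, simplified]
  subst_inst_funpow [where k = "Suc 0", simplified]
  subst_inst_funpow [where k = 2, simplified]
  subst_inst_funpow [where k = 3, simplified]
  subst_inst_funpow [where k = 4, simplified]

lemma lift_eq_rename: "lift k t = rename (\<lambda>n. n + k) t"
  by (simp add: inst_def rename_eq_subst)

lemma subst_lift_Suc: "subst (up \<sigma>) (lift (Suc k) t) = rename Suc (subst \<sigma> (lift k t))"
  by (simp add: lift_eq_rename subst_rename rename_subst)

lemma rename_Suc: "rename Suc t = lift 1 t"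
  by (simp add: lift_eq_rename)

lemma lift_lift: "lift k (lift m t) = lift (m + k) t"
  by (simp add: lift_eq_rename rename_rename add.assoc)

lemma inst_lift: "inst k ts (lift (length ts) t) = lift k t"
  unfolding lift_eq_rename
  by (simp add: inst_def subst_rename) (simp add: rename_eq_subst)

lemma subst_type_formers [simp]:
  "subst \<sigma> (arr s A B) = arr s (subst \<sigma> A) (subst \<sigma> B)"
  "subst \<sigma> (prodT s A B) = prodT s (subst \<sigma> A) (subst \<sigma> B)"
  "subst \<sigma> (idfun s A) = idfun s (subst \<sigma> A)"
  "subst \<sigma> (id_equiv A) = id_equiv (subst \<sigma> A)"
  by (simp_all add: arr_def prodT_def idfun_def id_equiv_def)

lemma subst_is_equiv [simp]:
  "subst \<sigma> (is_equiv A B f) = is_equiv (subst \<sigma> A) (subst \<sigma> B) (subst \<sigma> f)"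
  by (simp add: is_equiv_def subst_inst_funpow [where k = 2 and ts = "[]", simplified])

lemma subst_equiv [simp]: "subst \<sigma> (equiv A B) = equiv (subst \<sigma> A) (subst \<sigma> B)"
  by (simp add: equiv_def)

lemma subst_id_to_equiv [simp]:
  "subst \<sigma> (id_to_equiv i A B) = id_to_equiv i (subst \<sigma> A) (subst \<sigma> B)"
  by (simp add: id_to_equiv_def)

lemma conv_subst: "t \<doteq> u \<Longrightarrow> subst \<sigma> t \<doteq> subst \<sigma> u"
proof (induction arbitrary: \<sigma> rule: conv.induct)
  case (conv_sym t u)
  then show ?case by (blast intro: conv.conv_sym)
next
  case (conv_trans t u w)
  then show ?case by (blast intro: conv.conv_trans)
next
  case (Pi_eta s A f)
  then show ?case by (simp add: conv.Pi_eta [simplified])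
next
  case (Pi_beta s A b a)
  then show ?case using conv.Pi_beta by simp
next
  case (Sig_beta s C d a b)
  then show ?case using conv.Sig_beta by simp
next
  case (Plus_beta_l s C l r a)
  then show ?case using conv.Plus_beta_l by simp
next
  case (Plus_beta_r s C l r b)
  then show ?case using conv.Plus_beta_r by simp
next
  case (Nat_beta_Suc s C z st n)
  show ?case using conv.Nat_beta_Suc [of s "subst (up \<sigma>) C" "subst \<sigma> z" "subst (up (up \<sigma>)) st" "subst \<sigma> n"]
    by simp
next
  case (Tree_beta_node C lf nd t u)
  show ?case
    using conv.Tree_beta_node [of "subst (up \<sigma>) C" "subst \<sigma> lf" "subst (up (up (up (up \<sigma>)))) nd" "subst \<sigma> t" "subst \<sigma> u"]
    by simp
qed (simp_all add: conv.intros(1,7,10,12,13) conv.intros(15-))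


section \<open>Typing under substitution\<close>

lemma typed_wf: "\<Gamma> \<turnstile> t \<Colon> A \<Longrightarrow> wf \<Gamma>"
  by (induction rule: wf_has_type.inducts(2) [where ?P1.0 = "\<lambda>_. True"]) auto

lemma wf_tl: "wf (A # \<Gamma>) \<Longrightarrow> wf \<Gamma>"
  by (erule wf.cases) auto

lemma wf_hd: "wf (A # \<Gamma>) \<Longrightarrow> \<exists>i. \<Gamma> \<turnstile> A \<Colon> Uni Exo i"
  by (erule wf.cases) auto

lemma cumulative_exo: "\<Gamma> \<turnstile> A \<Colon> Uni s i \<Longrightarrow> \<Gamma> \<turnstile> A \<Colon> Uni Exo i"
  by (cases s) (auto intro: type_is_exotype)

lemma cumulative_le: "\<Gamma> \<turnstile> A \<Colon> Uni s i \<Longrightarrow> i \<le> j \<Longrightarrow> \<Gamma> \<turnstile> A \<Colon> Uni s j"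
  by (induction j) (auto intro: cumulative simp: le_Suc_eq)

text \<open>Renamings and substitutions of typed terms are two instances of this notion; the second
  uses the first to pass under binders.\<close>

locale typed_substs =
  fixes R :: "tm list \<Rightarrow> (nat \<Rightarrow> tm) \<Rightarrow> tm list \<Rightarrow> bool"
  assumes R_wf: "R \<Delta> \<sigma> \<Gamma> \<Longrightarrow> wf \<Delta>"
    and R_var: "R \<Delta> \<sigma> \<Gamma> \<Longrightarrow> n < length \<Gamma> \<Longrightarrow> \<Delta> \<turnstile> \<sigma> n \<Colon> subst \<sigma> (lift (Suc n) (\<Gamma> ! n))"
    and R_up: "R \<Delta> \<sigma> \<Gamma> \<Longrightarrow> \<Delta> \<turnstile> subst \<sigma> A \<Colon> Uni Exo i \<Longrightarrow> R (subst \<sigma> A # \<Delta>) (up \<sigma>) (A # \<Gamma>)"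
begin

text \<open>To pass under a binder, \<open>R_up\<close> needs the substituted domain to be an
  exo-type, which the premises of a rule do not always state. It is part of the well-formedness of
  the extended context, so the induction carries it as a property of contexts.\<close>

primrec stable_ctx :: "tm list \<Rightarrow> bool" where
  "stable_ctx [] \<longleftrightarrow> True"
| "stable_ctx (A # \<Gamma>) \<longleftrightarrow> stable_ctx \<Gamma> \<and> (\<forall>\<Delta> \<sigma>. R \<Delta> \<sigma> \<Gamma> \<longrightarrow> (\<exists>i. \<Delta> \<turnstile> subst \<sigma> A \<Colon> Uni Exo i))"

lemma R_Cons: "stable_ctx (A # \<Gamma>) \<Longrightarrow> R \<Delta> \<sigma> \<Gamma> \<Longrightarrow> R (subst \<sigma> A # \<Delta>) (up \<sigma>) (A # \<Gamma>)"
  by (simp, metis R_up)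

lemma typed_subst_aux:
  "wf \<Gamma> \<Longrightarrow> stable_ctx \<Gamma>"
  "\<Gamma> \<turnstile> t \<Colon> A \<Longrightarrow> stable_ctx \<Gamma> \<and> (\<forall>\<Delta> \<sigma>. R \<Delta> \<sigma> \<Gamma> \<longrightarrow> \<Delta> \<turnstile> subst \<sigma> t \<Colon> subst \<sigma> A)"
proof (induction rule: wf_has_type.inducts)
  case (wf_Cons \<Gamma> A i)
  then show ?case by auto
next
  case (variable \<Gamma> n)
  then show ?case using R_var by auto
next
  case (convert \<Gamma> t A B i)
  then show ?case by simp (meson conv_subst wf_has_type.convert)
next
  case (cumulative \<Gamma> A s i)
  then show ?case by (simp add: wf_has_type.cumulative)
next
  case (type_is_exotype \<Gamma> A i)
  then show ?case by (simp add: wf_has_type.type_is_exotype)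
next
  case (Pi_form \<Gamma> A s i B)
  show ?case
  proof (intro conjI allI impI)
    fix \<Delta> \<sigma> assume r: "R \<Delta> \<sigma> \<Gamma>"
    have r1: "R (subst \<sigma> A # \<Delta>) (up \<sigma>) (A # \<Gamma>)"
      using Pi_form.IH r by (blast intro: R_Cons)
    show "\<Delta> \<turnstile> subst \<sigma> (PiT s A B) \<Colon> subst \<sigma> (Uni s i)"
      using wf_has_type.Pi_form [of \<Delta> "subst \<sigma> A" s i "subst (up \<sigma>) B"]
        Pi_form.IH(1) [THEN conjunct2, rule_format, OF r] Pi_form.IH(2) [THEN conjunct2, rule_format, OF r1]
      by simp
  qed (use Pi_form in blast)
next
  case (Pi_intro \<Gamma> s A B i b)
  show ?case
  proof (intro conjI allI impI)
    fix \<Delta> \<sigma> assume r: "R \<Delta> \<sigma> \<Gamma>"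
    have r1: "R (subst \<sigma> A # \<Delta>) (up \<sigma>) (A # \<Gamma>)"
      using Pi_intro.IH r by (blast intro: R_Cons)
    show "\<Delta> \<turnstile> subst \<sigma> (Lam s A b) \<Colon> subst \<sigma> (PiT s A B)"
      using wf_has_type.Pi_intro [of \<Delta> s "subst \<sigma> A" "subst (up \<sigma>) B" i "subst (up \<sigma>) b"]
        Pi_intro.IH(1) [THEN conjunct2, rule_format, OF r] Pi_intro.IH(2) [THEN conjunct2, rule_format, OF r1]
      by simp
  qed (use Pi_intro in blast)
next
  case (Pi_elim \<Gamma> f s A B a)
  then show ?case by simp (meson wf_has_type.Pi_elim)
next
  case (Sig_form \<Gamma> A s i B)
  show ?case
  proof (intro conjI allI impI)
    fix \<Delta> \<sigma> assume r: "R \<Delta> \<sigma> \<Gamma>"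
    have r1: "R (subst \<sigma> A # \<Delta>) (up \<sigma>) (A # \<Gamma>)"
      using Sig_form.IH r by (blast intro: R_Cons)
    show "\<Delta> \<turnstile> subst \<sigma> (SigT s A B) \<Colon> subst \<sigma> (Uni s i)"
      using wf_has_type.Sig_form [of \<Delta> "subst \<sigma> A" s i "subst (up \<sigma>) B"]
        Sig_form.IH(1) [THEN conjunct2, rule_format, OF r] Sig_form.IH(2) [THEN conjunct2, rule_format, OF r1]
      by simp
  qed (use Sig_form in blast)
next
  case (Sig_intro \<Gamma> s A B i a b)
  then show ?case by simp (meson wf_has_type.Sig_intro)
next
  case (Sig_elim s A B \<Gamma> C i d p)
  show ?case
  proof (intro conjI allI impI)
    fix \<Delta> \<sigma> assume r: "R \<Delta> \<sigma> \<Gamma>"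
    have r1: "R (subst \<sigma> (SigT s A B) # \<Delta>) (up \<sigma>) (SigT s A B # \<Gamma>)"
      using Sig_elim.IH r by (blast intro: R_Cons)
    \<comment> \<open>The hypothesis for \<open>d\<close> contains the stability of its context,
      which gives the formation of \<open>A\<close> and \<open>B\<close>.\<close>
    have r2: "R (subst (up \<sigma>) B # subst \<sigma> A # \<Delta>) (up (up \<sigma>)) (B # A # \<Gamma>)"
      using Sig_elim.IH(2) r by (intro R_Cons) auto
    show "\<Delta> \<turnstile> subst \<sigma> (SigElim s C d p) \<Colon> subst \<sigma> (inst 0 [p] C)"
      using wf_has_type.Sig_elim [of s "subst \<sigma> A" "subst (up \<sigma>) B" \<Delta> "subst (up \<sigma>) C" i "subst (up (up \<sigma>)) d" "subst \<sigma> p"]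
        Sig_elim.IH(1) [THEN conjunct2, rule_format, OF r1] Sig_elim.IH(2) [THEN conjunct2, rule_format, OF r2]
        Sig_elim.IH(3) [THEN conjunct2, rule_format, OF r]
      by simp
  qed (use Sig_elim in blast)
next
  case (Unit_elim s \<Gamma> C i c t)
  show ?case
  proof (intro conjI allI impI)
    fix \<Delta> \<sigma> assume r: "R \<Delta> \<sigma> \<Gamma>"
    have r1: "R (subst \<sigma> (UnitT s) # \<Delta>) (up \<sigma>) (UnitT s # \<Gamma>)"
      using Unit_elim.IH r by (blast intro: R_Cons)
    show "\<Delta> \<turnstile> subst \<sigma> (UnitElim s C c t) \<Colon> subst \<sigma> (inst 0 [t] C)"
      using wf_has_type.Unit_elim [of s \<Delta> "subst (up \<sigma>) C" i "subst \<sigma> c" "subst \<sigma> t"]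
        Unit_elim.IH(1) [THEN conjunct2, rule_format, OF r1] Unit_elim.IH(2,3) [THEN conjunct2, rule_format, OF r]
      by simp
  qed (use Unit_elim in blast)
next
  case (Empty_elim s \<Gamma> C i t)
  show ?case
  proof (intro conjI allI impI)
    fix \<Delta> \<sigma> assume r: "R \<Delta> \<sigma> \<Gamma>"
    have r1: "R (subst \<sigma> (EmptyT s) # \<Delta>) (up \<sigma>) (EmptyT s # \<Gamma>)"
      using Empty_elim.IH r by (blast intro: R_Cons)
    show "\<Delta> \<turnstile> subst \<sigma> (EmptyElim s C t) \<Colon> subst \<sigma> (inst 0 [t] C)"
      using wf_has_type.Empty_elim [of s \<Delta> "subst (up \<sigma>) C" i "subst \<sigma> t"]
        Empty_elim.IH(1) [THEN conjunct2, rule_format, OF r1] Empty_elim.IH(2) [THEN conjunct2, rule_format, OF r]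
      by simp
  qed (use Empty_elim in blast)
next
  case (Plus_elim s A B \<Gamma> C i l r t)
  show ?case
  proof (intro conjI allI impI)
    fix \<Delta> \<sigma> assume r: "R \<Delta> \<sigma> \<Gamma>"
    have r1: "R (subst \<sigma> (PlusT s A B) # \<Delta>) (up \<sigma>) (PlusT s A B # \<Gamma>)"
      and r2: "R (subst \<sigma> A # \<Delta>) (up \<sigma>) (A # \<Gamma>)"
      and r3: "R (subst \<sigma> B # \<Delta>) (up \<sigma>) (B # \<Gamma>)"
      using Plus_elim.IH r by (blast intro: R_Cons)+
    show "\<Delta> \<turnstile> subst \<sigma> (PlusElim s C l r t) \<Colon> subst \<sigma> (inst 0 [t] C)"
      using wf_has_type.Plus_elim [of s "subst \<sigma> A" "subst \<sigma> B" \<Delta> "subst (up \<sigma>) C" i "subst (up \<sigma>) l" "subst (up \<sigma>) r" "subst \<sigma> t"]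
        Plus_elim.IH(1) [THEN conjunct2, rule_format, OF r1] Plus_elim.IH(2) [THEN conjunct2, rule_format, OF r2]
        Plus_elim.IH(3) [THEN conjunct2, rule_format, OF r3] Plus_elim.IH(4) [THEN conjunct2, rule_format, OF r]
      by simp
  qed (use Plus_elim in blast)
next
  case (Nat_elim s \<Gamma> C i z st n)
  show ?case
  proof (intro conjI allI impI)
    fix \<Delta> \<sigma> assume r: "R \<Delta> \<sigma> \<Gamma>"
    have r1: "R (subst \<sigma> (NatT s) # \<Delta>) (up \<sigma>) (NatT s # \<Gamma>)"
      using Nat_elim.IH r by (blast intro: R_Cons)
    have r2: "R (subst (up \<sigma>) C # subst \<sigma> (NatT s) # \<Delta>) (up (up \<sigma>)) (C # NatT s # \<Gamma>)"
      using Nat_elim.IH(3) by (blast intro: R_Cons [OF _ r1])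
    show "\<Delta> \<turnstile> subst \<sigma> (NatElim s C z st n) \<Colon> subst \<sigma> (inst 0 [n] C)"
      using wf_has_type.Nat_elim [of s \<Delta> "subst (up \<sigma>) C" i "subst \<sigma> z" "subst (up (up \<sigma>)) st" "subst \<sigma> n"]
        Nat_elim.IH(1) [THEN conjunct2, rule_format, OF r1] Nat_elim.IH(2,4) [THEN conjunct2, rule_format, OF r]
        Nat_elim.IH(3) [THEN conjunct2, rule_format, OF r2]
      by simp
  qed (use Nat_elim in blast)
next
  case (Id_form \<Gamma> A s i a b)
  then show ?case by (simp add: wf_has_type.Id_form)
next
  case (Id_intro \<Gamma> A s i a)
  then show ?case by simp (meson wf_has_type.Id_intro)
next
  case (Id_elim s A a \<Gamma> C i c b p)
  show ?case
  proof (intro conjI allI impI)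
    fix \<Delta> \<sigma> assume r: "R \<Delta> \<sigma> \<Gamma>"
    have r1: "R (subst (up \<sigma>) (IdT s (lift 1 A) (lift 1 a) (Var 0)) # subst \<sigma> A # \<Delta>) (up (up \<sigma>))
        (IdT s (lift 1 A) (lift 1 a) (Var 0) # A # \<Gamma>)"
      using Id_elim.IH(1) r by (intro R_Cons) auto
    show "\<Delta> \<turnstile> subst \<sigma> (J s C c p) \<Colon> subst \<sigma> (inst 0 [p, b] C)"
      using wf_has_type.Id_elim [of s "subst \<sigma> A" "subst \<sigma> a" \<Delta> "subst (up (up \<sigma>)) C" i "subst \<sigma> c" "subst \<sigma> b" "subst \<sigma> p"]
        Id_elim.IH(1) [THEN conjunct2, rule_format, OF r1] Id_elim.IH(2,3,4) [THEN conjunct2, rule_format, OF r]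
      by simp
  qed (use Id_elim in blast)
next
  case (Tree_elim \<Gamma> C i lf nd t)
  show ?case
  proof (intro conjI allI impI)
    fix \<Delta> \<sigma> assume r: "R \<Delta> \<sigma> \<Gamma>"
    have r1: "R (subst \<sigma> UnLBinTree # \<Delta>) (up \<sigma>) (UnLBinTree # \<Gamma>)"
      using Tree_elim.IH r by (blast intro: R_Cons)
    have r2: "R (subst (up (up (up \<sigma>))) (inst 3 [Var 1] C) # subst (up (up \<sigma>)) (inst 2 [Var 1] C) #
        subst (up \<sigma>) UnLBinTree # subst \<sigma> UnLBinTree # \<Delta>) (up (up (up (up \<sigma>))))
        (inst 3 [Var 1] C # inst 2 [Var 1] C # UnLBinTree # UnLBinTree # \<Gamma>)"
      using Tree_elim.IH(3) r by (intro R_Cons) (auto simp del: subst_inst)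
    show "\<Delta> \<turnstile> subst \<sigma> (TreeElim C lf nd t) \<Colon> subst \<sigma> (inst 0 [t] C)"
      using wf_has_type.Tree_elim [of \<Delta> "subst (up \<sigma>) C" i "subst \<sigma> lf" "subst (up (up (up (up \<sigma>)))) nd" "subst \<sigma> t"]
        Tree_elim.IH(1) [THEN conjunct2, rule_format, OF r1] Tree_elim.IH(2,4) [THEN conjunct2, rule_format, OF r]
        Tree_elim.IH(3) [THEN conjunct2, rule_format, OF r2]
      by simp
  qed (use Tree_elim in blast)
next
  case (exo_funext \<Gamma> f A B g h)
  then show ?case by simp (meson wf_has_type.exo_funext [simplified])
next
  case (exo_uip \<Gamma> p A a b q)
  then show ?case by simp (meson wf_has_type.exo_uip)
next
  case (univalence \<Gamma> A i B)
  then show ?case by (simp add: wf_has_type.univalence)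
next
  case (Plus_form \<Gamma> A s i B)
  then show ?case by (simp add: wf_has_type.Plus_form)
next
  case (Plus_intro_l \<Gamma> s A B i a)
  then show ?case by simp (meson wf_has_type.Plus_intro_l)
next
  case (Plus_intro_r \<Gamma> s A B i b)
  then show ?case by simp (meson wf_has_type.Plus_intro_r)
qed (auto intro: wf_has_type.intros(5) wf_has_type.Unit_form wf_has_type.Unit_intro
  wf_has_type.Empty_form wf_has_type.Nat_form wf_has_type.Nat_intro_0 wf_has_type.Nat_intro_Suc
  wf_has_type.Tree_form wf_has_type.Tree_intro_leaf wf_has_type.Tree_intro_node R_wf)

lemma typed_subst: "\<Gamma> \<turnstile> t \<Colon> A \<Longrightarrow> R \<Delta> \<sigma> \<Gamma> \<Longrightarrow> \<Delta> \<turnstile> subst \<sigma> t \<Colon> subst \<sigma> A"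
  using typed_subst_aux(2) by blast

end


lemma lift_Suc: "lift (Suc k) t = rename Suc (lift k t)"
  by (simp add: lift_eq_rename rename_rename)

text \<open>The types of variables must agree syntactically. Such a renaming extends under a binder
  by calculation alone, before weakening is available.\<close>

definition typed_ren :: "tm list \<Rightarrow> (nat \<Rightarrow> tm) \<Rightarrow> tm list \<Rightarrow> bool" where
  "typed_ren \<Delta> \<sigma> \<Gamma> \<longleftrightarrow> wf \<Delta> \<and> (\<exists>\<rho>. \<sigma> = (\<lambda>n. Var (\<rho> n)) \<and>
    (\<forall>n < length \<Gamma>. \<rho> n < length \<Delta> \<and> lift (Suc (\<rho> n)) (\<Delta> ! \<rho> n) = rename \<rho> (lift (Suc n) (\<Gamma> ! n))))"

definition typed_sub :: "tm list \<Rightarrow> (nat \<Rightarrow> tm) \<Rightarrow> tm list \<Rightarrow> bool" where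
  "typed_sub \<Delta> \<sigma> \<Gamma> \<longleftrightarrow> wf \<Delta> \<and> (\<forall>n < length \<Gamma>. \<Delta> \<turnstile> \<sigma> n \<Colon> subst \<sigma> (lift (Suc n) (\<Gamma> ! n)))"

interpretation ren: typed_substs typed_ren
proof
  fix \<Delta> \<sigma> \<Gamma> A i
  assume r: "typed_ren \<Delta> \<sigma> \<Gamma>" and A: "\<Delta> \<turnstile> subst \<sigma> A \<Colon> Uni Exo i"
  then obtain \<rho> where \<rho>: "\<sigma> = (\<lambda>n. Var (\<rho> n))" and wf: "wf \<Delta>"
    and v: "\<And>n. n < length \<Gamma> \<Longrightarrow> \<rho> n < length \<Delta> \<and> lift (Suc (\<rho> n)) (\<Delta> ! \<rho> n) = rename \<rho> (lift (Suc n) (\<Gamma> ! n))"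
    by (auto simp: typed_ren_def)
  have "up_ren \<rho> n < length (subst \<sigma> A # \<Delta>) \<and>
      lift (Suc (up_ren \<rho> n)) ((subst \<sigma> A # \<Delta>) ! up_ren \<rho> n) = rename (up_ren \<rho>) (lift (Suc n) ((A # \<Gamma>) ! n))"
    if "n < length (A # \<Gamma>)" for n
  proof (cases n)
    case 0
    then show ?thesis
      by (simp add: \<rho> flip: rename_eq_subst) (simp add: lift_eq_rename rename_rename)
  next
    case (Suc m)
    then have "lift (Suc (Suc (\<rho> m))) (\<Delta> ! \<rho> m) = rename Suc (rename \<rho> (lift (Suc m) (\<Gamma> ! m)))"
      using v [of m] that lift_Suc [of "Suc (\<rho> m)"] by simp
    then show ?thesis
      using Suc v [of m] that by (simp add: lift_Suc [of "Suc m"] rename_rename)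
  qed
  moreover have "up \<sigma> = (\<lambda>n. Var (up_ren \<rho> n))"
    by (simp add: \<rho> up_Var_comp)
  ultimately show "typed_ren (subst \<sigma> A # \<Delta>) (up \<sigma>) (A # \<Gamma>)"
    unfolding typed_ren_def using wf_Cons [OF wf A] by blast
qed (auto simp: typed_ren_def simp flip: rename_eq_subst, metis variable)

lemma weakening:
  assumes "\<Gamma> \<turnstile> t \<Colon> A" and "wf (B # \<Gamma>)"
  shows "B # \<Gamma> \<turnstile> rename Suc t \<Colon> rename Suc A"
proof -
  have "typed_ren (B # \<Gamma>) (\<lambda>n. Var (Suc n)) \<Gamma>"
    unfolding typed_ren_def using assms(2) lift_Suc [of "Suc _"] by auto
  from ren.typed_subst [OF assms(1) this] show ?thesis
    by (simp add: rename_eq_subst)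
qed

interpretation sub: typed_substs typed_sub
proof
  fix \<Delta> \<sigma> \<Gamma> A i
  assume r: "typed_sub \<Delta> \<sigma> \<Gamma>" and A: "\<Delta> \<turnstile> subst \<sigma> A \<Colon> Uni Exo i"
  have wf: "wf (subst \<sigma> A # \<Delta>)"
    using r A by (auto simp: typed_sub_def intro: wf_Cons)
  have "subst \<sigma> A # \<Delta> \<turnstile> up \<sigma> n \<Colon> subst (up \<sigma>) (lift (Suc n) ((A # \<Gamma>) ! n))"
    if "n < length (A # \<Gamma>)" for n
  proof (cases n)
    case 0
    then show ?thesis
      using variable [OF wf, of 0] by simp
  next
    case (Suc m)
    then show ?thesis
      using that r weakening [OF _ wf] by (simp add: typed_sub_def subst_lift_Suc [of _ "Suc m"])
  qed
  then show "typed_sub (subst \<sigma> A # \<Delta>) (up \<sigma>) (A # \<Gamma>)"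
    using wf by (simp add: typed_sub_def)
qed (auto simp: typed_sub_def)

section \<open>Instantiation by typed terms, closed terms and inversion\<close>

lemma lift_0 [simp]: "lift 0 t = t"
  by (simp add: inst_def)

text \<open>\<open>\<Delta>\<close> holds the variables that a premise of an eliminator adds, such
  as constructor arguments and induction hypotheses; the motive is instantiated in their
  scope.\<close>

lemma inst_typing:
  assumes t: "A # \<Gamma> \<turnstile> t \<Colon> T" and a: "\<Delta> @ \<Gamma> \<turnstile> a \<Colon> lift (length \<Delta>) A"
  shows "\<Delta> @ \<Gamma> \<turnstile> inst (length \<Delta>) [a] t \<Colon> inst (length \<Delta>) [a] T"
proof -
  have "\<Delta> @ \<Gamma> \<turnstile> (if n < length [a] then [a] ! n else Var (n - length [a] + length \<Delta>))
      \<Colon> inst (length \<Delta>) [a] (lift (Suc n) ((A # \<Gamma>) ! n))" if "n < length (A # \<Gamma>)" for n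
  proof (cases n)
    case 0
    then show ?thesis
      using a inst_lift [of "length \<Delta>" "[a]" A] by simp
  next
    case (Suc m)
    have "\<Delta> @ \<Gamma> \<turnstile> Var (m + length \<Delta>) \<Colon> lift (Suc (m + length \<Delta>)) (\<Gamma> ! m)"
      using variable [OF typed_wf [OF a], of "m + length \<Delta>"] that Suc
      by (simp add: nth_append)
    moreover have "inst (length \<Delta>) [a] (lift (Suc (Suc m)) (\<Gamma> ! m)) = lift (Suc (m + length \<Delta>)) (\<Gamma> ! m)"
      using inst_lift [of "length \<Delta>" "[a]" "lift (Suc m) (\<Gamma> ! m)"] by (simp add: lift_lift)
    ultimately show ?thesis
      using Suc by simp
  qed
  then have "typed_sub (\<Delta> @ \<Gamma>) (\<lambda>n. if n < length [a] then [a] ! n else Var (n - length [a] + length \<Delta>)) (A # \<Gamma>)"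
    unfolding typed_sub_def inst_def using typed_wf [OF a] by blast
  from sub.typed_subst [OF t this] show ?thesis
    by (simp add: inst_def)
qed

lemma inst0_pair_typing:
  assumes t: "B # A # \<Gamma> \<turnstile> t \<Colon> T" and a: "\<Gamma> \<turnstile> a \<Colon> A" and b: "\<Gamma> \<turnstile> b \<Colon> inst 0 [a] B"
  shows "\<Gamma> \<turnstile> inst 0 [b, a] t \<Colon> inst 0 [b, a] T"
proof -
  let ?\<sigma> = "\<lambda>n. if n < length [b, a] then [b, a] ! n else Var (n - length [b, a] + 0)"
  have "\<Gamma> \<turnstile> ?\<sigma> n \<Colon> inst 0 [b, a] (lift (Suc n) ((B # A # \<Gamma>) ! n))" if n: "n < length (B # A # \<Gamma>)" for n
  proof -
    consider "n = 0" | "n = 1" | m where "n = Suc (Suc m)"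
      by (metis One_nat_def not0_implies_Suc)
    then show ?thesis
    proof cases
      case 1
      have "(\<lambda>n. ?\<sigma> (n + 1)) = (\<lambda>n. if n < length [a] then [a] ! n else Var (n - length [a] + 0))"
        by (rule nat_funext) auto
      then have "inst 0 [b, a] (lift 1 B) = inst 0 [a] B"
        unfolding lift_eq_rename by (simp only: inst_def subst_rename)
      then show ?thesis using b 1 by simp
    next
      case 2
      then show ?thesis using a inst_lift [of 0 "[b, a]" A] by (simp add: numeral_2_eq_2)
    next
      case 3
      have "inst 0 [b, a] (lift (Suc (Suc (Suc m))) (\<Gamma> ! m)) = lift (Suc m) (\<Gamma> ! m)"
        using inst_lift [of 0 "[b, a]" "lift (Suc m) (\<Gamma> ! m)"] by (simp add: lift_lift)
      then show ?thesis
        using 3 n variable [OF typed_wf [OF a], of m] by simp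
    qed
  qed
  then have "typed_sub \<Gamma> ?\<sigma> (B # A # \<Gamma>)"
    unfolding typed_sub_def inst_def using typed_wf [OF a] by blast
  from sub.typed_subst [OF t this] show ?thesis
    by (simp add: inst_def)
qed

lemma closed_typing: "[] \<turnstile> t \<Colon> A \<Longrightarrow> wf \<Gamma> \<Longrightarrow> \<Gamma> \<turnstile> t \<Colon> A"
  using sub.typed_subst [of "[]" t A \<Gamma> Var] by (simp add: typed_sub_def)

definition fixes_below :: "nat \<Rightarrow> (nat \<Rightarrow> tm) \<Rightarrow> bool" where
  "fixes_below k \<sigma> \<longleftrightarrow> (\<forall>n < k. \<sigma> n = Var n)"

lemma fixes_below_up: "fixes_below k \<sigma> \<Longrightarrow> fixes_below (Suc k) (up \<sigma>)"
  by (auto simp: fixes_below_def less_Suc_eq_0_disj)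

text \<open>A derivation bounds the free variables of its term by the length of the context. Closed
  terms are thus fixed by all substitutions, as the values of constants must be.\<close>

lemma typed_subst_id:
  "wf \<Gamma> \<Longrightarrow> True"
  "\<Gamma> \<turnstile> t \<Colon> A \<Longrightarrow> fixes_below (length \<Gamma>) \<sigma> \<Longrightarrow> subst \<sigma> t = t"
proof (induction arbitrary: and \<sigma> rule: wf_has_type.inducts)
  case (variable \<Gamma> n)
  then show ?case by (simp add: fixes_below_def)
qed (simp_all add: fixes_below_up)

lemma closed_subst: "[] \<turnstile> t \<Colon> A \<Longrightarrow> subst \<sigma> t = t"
  using typed_subst_id(2) by (fastforce simp: fixes_below_def)

text \<open>Induction is used because a derivation may end with a conversion, with cumulativity or
  with the inclusion of types into exo-types. The components keep the layer \<open>s\<close> of the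
  former even if \<open>T\<close> is an exo-universe.\<close>

lemma Pi_inversion: "\<Gamma> \<turnstile> PiT s A B \<Colon> T \<Longrightarrow> \<exists>i. \<Gamma> \<turnstile> A \<Colon> Uni s i \<and> A # \<Gamma> \<turnstile> B \<Colon> Uni s i"
  by (induction \<Gamma> "PiT s A B" T rule: wf_has_type.inducts(2) [where ?P1.0 = "\<lambda>_. True"]) auto

lemma Sig_inversion: "\<Gamma> \<turnstile> SigT s A B \<Colon> T \<Longrightarrow> \<exists>i. \<Gamma> \<turnstile> A \<Colon> Uni s i \<and> A # \<Gamma> \<turnstile> B \<Colon> Uni s i"
  by (induction \<Gamma> "SigT s A B" T rule: wf_has_type.inducts(2) [where ?P1.0 = "\<lambda>_. True"]) auto

lemma Id_inversion: "\<Gamma> \<turnstile> IdT s A a b \<Colon> T \<Longrightarrow> \<exists>i. \<Gamma> \<turnstile> A \<Colon> Uni s i \<and> \<Gamma> \<turnstile> a \<Colon> A \<and> \<Gamma> \<turnstile> b \<Colon> A"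
  by (induction \<Gamma> "IdT s A a b" T rule: wf_has_type.inducts(2) [where ?P1.0 = "\<lambda>_. True"]) auto

lemma wf_nth: "wf \<Gamma> \<Longrightarrow> n < length \<Gamma> \<Longrightarrow> \<exists>i. \<Gamma> \<turnstile> lift (Suc n) (\<Gamma> ! n) \<Colon> Uni Exo i"
proof (induction \<Gamma> arbitrary: n)
  case (Cons A \<Gamma>)
  have *: "\<exists>i. A # \<Gamma> \<turnstile> rename Suc B \<Colon> Uni Exo i" if "\<exists>i. \<Gamma> \<turnstile> B \<Colon> Uni Exo i" for B
    using that weakening [OF _ Cons.prems(1)] by fastforce
  show ?case
  proof (cases n)
    case 0
    then show ?thesis
      using * [OF wf_hd [OF Cons.prems(1)]] by (simp add: rename_Suc)
  next
    case (Suc m)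
    then show ?thesis
      using * [OF Cons.IH [of m]] Cons.prems wf_tl lift_Suc [of "Suc m"] by simp
  qed
qed simp


section \<open>A type checker\<close>

text \<open>The fragment of the theory that is needed, extended by constants, and by type annotations that
  the interpretation erases.  \<open>PUni s i\<close> is the universe of level \<open>l + i\<close> for the parameter \<open>l\<close> of
  the theorem.\<close>

datatype ptm =
    PVar nat | PConst nat | PUni layer nat
  | PPi layer ptm ptm | PLam layer ptm ptm | PApp layer ptm ptm
  | PSig layer ptm ptm | PPair layer ptm ptm | PSplit layer ptm ptm ptm
  | PNat layer | PZero layer | PSuc layer ptm | PNatElim layer ptm ptm ptm ptm
  | PId layer ptm ptm ptm | PRefl layer ptm | PJ layer ptm ptm ptm
  | PTree | PLeaf | PNode ptm ptm | PTreeElim ptm ptm ptm ptm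
  | PFunext ptm ptm ptm | PUIP ptm ptm | PAnn ptm ptm

primrec tm_of :: "nat \<Rightarrow> (nat \<Rightarrow> tm) \<Rightarrow> ptm \<Rightarrow> tm" where
  "tm_of l \<rho> (PVar n) = Var n"
| "tm_of l \<rho> (PConst n) = \<rho> n"
| "tm_of l \<rho> (PUni s i) = Uni s (l + i)"
| "tm_of l \<rho> (PPi s A B) = PiT s (tm_of l \<rho> A) (tm_of l \<rho> B)"
| "tm_of l \<rho> (PLam s A b) = Lam s (tm_of l \<rho> A) (tm_of l \<rho> b)"
| "tm_of l \<rho> (PApp s f a) = App s (tm_of l \<rho> f) (tm_of l \<rho> a)"
| "tm_of l \<rho> (PSig s A B) = SigT s (tm_of l \<rho> A) (tm_of l \<rho> B)"
| "tm_of l \<rho> (PPair s a b) = Pr s (tm_of l \<rho> a) (tm_of l \<rho> b)"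
| "tm_of l \<rho> (PSplit s C d p) = SigElim s (tm_of l \<rho> C) (tm_of l \<rho> d) (tm_of l \<rho> p)"
| "tm_of l \<rho> (PNat s) = NatT s"
| "tm_of l \<rho> (PZero s) = NZero s"
| "tm_of l \<rho> (PSuc s n) = NSuc s (tm_of l \<rho> n)"
| "tm_of l \<rho> (PNatElim s C z st n) = NatElim s (tm_of l \<rho> C) (tm_of l \<rho> z) (tm_of l \<rho> st) (tm_of l \<rho> n)"
| "tm_of l \<rho> (PId s A a b) = IdT s (tm_of l \<rho> A) (tm_of l \<rho> a) (tm_of l \<rho> b)"
| "tm_of l \<rho> (PRefl s a) = Refl s (tm_of l \<rho> a)"
| "tm_of l \<rho> (PJ s C c p) = J s (tm_of l \<rho> C) (tm_of l \<rho> c) (tm_of l \<rho> p)"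
| "tm_of l \<rho> PTree = UnLBinTree"
| "tm_of l \<rho> PLeaf = ULeaf"
| "tm_of l \<rho> (PNode t u) = UNode (tm_of l \<rho> t) (tm_of l \<rho> u)"
| "tm_of l \<rho> (PTreeElim C lf nd t) = TreeElim (tm_of l \<rho> C) (tm_of l \<rho> lf) (tm_of l \<rho> nd) (tm_of l \<rho> t)"
| "tm_of l \<rho> (PFunext f g h) = ExoFunext (tm_of l \<rho> f) (tm_of l \<rho> g) (tm_of l \<rho> h)"
| "tm_of l \<rho> (PUIP p q) = ExoUIP (tm_of l \<rho> p) (tm_of l \<rho> q)"
| "tm_of l \<rho> (PAnn A t) = tm_of l \<rho> t"

primrec consts_below :: "nat \<Rightarrow> ptm \<Rightarrow> bool" where
  "consts_below n (PVar i) \<longleftrightarrow> True"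
| "consts_below n (PConst i) \<longleftrightarrow> i < n"
| "consts_below n (PUni s i) \<longleftrightarrow> True"
| "consts_below n (PPi s A B) \<longleftrightarrow> consts_below n A \<and> consts_below n B"
| "consts_below n (PLam s A b) \<longleftrightarrow> consts_below n A \<and> consts_below n b"
| "consts_below n (PApp s f a) \<longleftrightarrow> consts_below n f \<and> consts_below n a"
| "consts_below n (PSig s A B) \<longleftrightarrow> consts_below n A \<and> consts_below n B"
| "consts_below n (PPair s a b) \<longleftrightarrow> consts_below n a \<and> consts_below n b"
| "consts_below n (PSplit s C d p) \<longleftrightarrow> consts_below n C \<and> consts_below n d \<and> consts_below n p"
| "consts_below n (PNat s) \<longleftrightarrow> True"
| "consts_below n (PZero s) \<longleftrightarrow> True"
| "consts_below n (PSuc s t) \<longleftrightarrow> consts_below n t"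
| "consts_below n (PNatElim s C z st t) \<longleftrightarrow> consts_below n C \<and> consts_below n z \<and> consts_below n st \<and> consts_below n t"
| "consts_below n (PId s A a b) \<longleftrightarrow> consts_below n A \<and> consts_below n a \<and> consts_below n b"
| "consts_below n (PRefl s a) \<longleftrightarrow> consts_below n a"
| "consts_below n (PJ s C c p) \<longleftrightarrow> consts_below n C \<and> consts_below n c \<and> consts_below n p"
| "consts_below n PTree \<longleftrightarrow> True"
| "consts_below n PLeaf \<longleftrightarrow> True"
| "consts_below n (PNode t u) \<longleftrightarrow> consts_below n t \<and> consts_below n u"
| "consts_below n (PTreeElim C lf nd t) \<longleftrightarrow> consts_below n C \<and> consts_below n lf \<and> consts_below n nd \<and> consts_below n t"
| "consts_below n (PFunext f g h) \<longleftrightarrow> consts_below n f \<and> consts_below n g \<and> consts_below n h"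
| "consts_below n (PUIP p q) \<longleftrightarrow> consts_below n p \<and> consts_below n q"
| "consts_below n (PAnn A t) \<longleftrightarrow> consts_below n A \<and> consts_below n t"

section \<open>Shifting and simultaneous substitution\<close>

primrec shift :: "nat \<Rightarrow> nat \<Rightarrow> ptm \<Rightarrow> ptm" where
  "shift k d (PVar n) = (if n < d then PVar n else PVar (n + k))"
| "shift k d (PConst n) = PConst n"
| "shift k d (PUni s i) = PUni s i"
| "shift k d (PPi s A B) = PPi s (shift k d A) (shift k (Suc d) B)"
| "shift k d (PLam s A B) = PLam s (shift k d A) (shift k (Suc d) B)"
| "shift k d (PApp s A B) = PApp s (shift k d A) (shift k d B)"
| "shift k d (PSig s A B) = PSig s (shift k d A) (shift k (Suc d) B)"
| "shift k d (PPair s A B) = PPair s (shift k d A) (shift k d B)"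
| "shift k d (PSplit s C e p) = PSplit s (shift k (Suc d) C) (shift k (Suc (Suc d)) e) (shift k d p)"
| "shift k d (PNat s) = PNat s"
| "shift k d (PZero s) = PZero s"
| "shift k d (PSuc s n) = PSuc s (shift k d n)"
| "shift k d (PNatElim s C z st n) = PNatElim s (shift k (Suc d) C) (shift k d z) (shift k (Suc (Suc d)) st) (shift k d n)"
| "shift k d (PId s A a b) = PId s (shift k d A) (shift k d a) (shift k d b)"
| "shift k d (PRefl s a) = PRefl s (shift k d a)"
| "shift k d (PJ s C e p) = PJ s (shift k (Suc (Suc d)) C) (shift k d e) (shift k d p)"
| "shift k d PTree = PTree"
| "shift k d PLeaf = PLeaf"
| "shift k d (PNode t u) = PNode (shift k d t) (shift k d u)"
| "shift k d (PTreeElim C lf nd t) = PTreeElim (shift k (Suc d) C) (shift k d lf) (shift k (Suc (Suc (Suc (Suc d)))) nd) (shift k d t)"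
| "shift k d (PFunext f g h) = PFunext (shift k d f) (shift k d g) (shift k d h)"
| "shift k d (PUIP f g) = PUIP (shift k d f) (shift k d g)"
| "shift k d (PAnn f g) = PAnn (shift k d f) (shift k d g)"

fun pick :: "nat \<Rightarrow> nat \<Rightarrow> ptm list \<Rightarrow> nat \<Rightarrow> ptm" where
  "pick k d [] n = PVar (n + k + d)"
| "pick k d (t # ts) 0 = shift d 0 t"
| "pick k d (t # ts) (Suc n) = pick k d ts n"

primrec msubst :: "nat \<Rightarrow> ptm list \<Rightarrow> nat \<Rightarrow> ptm \<Rightarrow> ptm" where
  "msubst k ts d (PVar n) = (if n < d then PVar n else pick k d ts (n - d))"
| "msubst k ts d (PConst n) = PConst n"
| "msubst k ts d (PUni s i) = PUni s i"
| "msubst k ts d (PPi s A B) = PPi s (msubst k ts d A) (msubst k ts (Suc d) B)"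
| "msubst k ts d (PLam s A B) = PLam s (msubst k ts d A) (msubst k ts (Suc d) B)"
| "msubst k ts d (PApp s A B) = PApp s (msubst k ts d A) (msubst k ts d B)"
| "msubst k ts d (PSig s A B) = PSig s (msubst k ts d A) (msubst k ts (Suc d) B)"
| "msubst k ts d (PPair s A B) = PPair s (msubst k ts d A) (msubst k ts d B)"
| "msubst k ts d (PSplit s C e p) = PSplit s (msubst k ts (Suc d) C) (msubst k ts (Suc (Suc d)) e) (msubst k ts d p)"
| "msubst k ts d (PNat s) = PNat s"
| "msubst k ts d (PZero s) = PZero s"
| "msubst k ts d (PSuc s n) = PSuc s (msubst k ts d n)"
| "msubst k ts d (PNatElim s C z st n) = PNatElim s (msubst k ts (Suc d) C) (msubst k ts d z) (msubst k ts (Suc (Suc d)) st) (msubst k ts d n)"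
| "msubst k ts d (PId s A a b) = PId s (msubst k ts d A) (msubst k ts d a) (msubst k ts d b)"
| "msubst k ts d (PRefl s a) = PRefl s (msubst k ts d a)"
| "msubst k ts d (PJ s C e p) = PJ s (msubst k ts (Suc (Suc d)) C) (msubst k ts d e) (msubst k ts d p)"
| "msubst k ts d PTree = PTree"
| "msubst k ts d PLeaf = PLeaf"
| "msubst k ts d (PNode t u) = PNode (msubst k ts d t) (msubst k ts d u)"
| "msubst k ts d (PTreeElim C lf nd t) = PTreeElim (msubst k ts (Suc d) C) (msubst k ts d lf) (msubst k ts (Suc (Suc (Suc (Suc d)))) nd) (msubst k ts d t)"
| "msubst k ts d (PFunext f g h) = PFunext (msubst k ts d f) (msubst k ts d g) (msubst k ts d h)"
| "msubst k ts d (PUIP f g) = PUIP (msubst k ts d f) (msubst k ts d g)"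
| "msubst k ts d (PAnn f g) = PAnn (msubst k ts d f) (msubst k ts d g)"


text \<open>A signature gives the type of a constant and, if it is transparent, its definiens.\<close>

type_synonym signature = "nat \<Rightarrow> (ptm \<times> ptm option) option"

section \<open>Weak head reduction\<close>

fun un_lam where "un_lam (PLam s A b) = Some (s, A, b)" | "un_lam _ = None"
fun un_pair where "un_pair (PPair s a b) = Some (s, a, b)" | "un_pair _ = None"
fun un_Pi where "un_Pi (PPi s A B) = Some (s, A, B)" | "un_Pi _ = None"
fun un_Sig where "un_Sig (PSig s A B) = Some (s, A, B)" | "un_Sig _ = None"
fun un_Id where "un_Id (PId s A a b) = Some (s, A, a, b)" | "un_Id _ = None"
fun un_Uni where "un_Uni (PUni s i) = Some (s, i)" | "un_Uni _ = None"
fun un_refl where "un_refl (PRefl s a) = Some (s, a)" | "un_refl _ = None"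

fun un_nat where
  "un_nat (PZero s) = Some (s, None)"
| "un_nat (PSuc s n) = Some (s, Some n)"
| "un_nat _ = None"

fun un_tree where
  "un_tree PLeaf = Some None"
| "un_tree (PNode t u) = Some (Some (t, u))"
| "un_tree _ = None"

definition app_red :: "(ptm \<Rightarrow> ptm) \<Rightarrow> layer \<Rightarrow> ptm \<Rightarrow> ptm \<Rightarrow> ptm" where
  "app_red w s a f = (case un_lam f of
      Some (s', A, b) \<Rightarrow> if s = s' then w (msubst 0 [a] 0 b) else PApp s f a
    | None \<Rightarrow> PApp s f a)"

definition split_red :: "(ptm \<Rightarrow> ptm) \<Rightarrow> layer \<Rightarrow> ptm \<Rightarrow> ptm \<Rightarrow> ptm \<Rightarrow> ptm" where
  "split_red w s C d p = (case un_pair p of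
      Some (s', a, b) \<Rightarrow> if s = s' then w (msubst 0 [b, a] 0 d) else PSplit s C d p
    | None \<Rightarrow> PSplit s C d p)"

definition nat_red :: "(ptm \<Rightarrow> ptm) \<Rightarrow> layer \<Rightarrow> ptm \<Rightarrow> ptm \<Rightarrow> ptm \<Rightarrow> ptm \<Rightarrow> ptm" where
  "nat_red w s C z st n = (case un_nat n of
      Some (s', m) \<Rightarrow> if s = s' then
        (case m of None \<Rightarrow> w z | Some k \<Rightarrow> w (msubst 0 [PNatElim s C z st k, k] 0 st))
        else PNatElim s C z st n
    | None \<Rightarrow> PNatElim s C z st n)"

definition J_red :: "(ptm \<Rightarrow> ptm) \<Rightarrow> layer \<Rightarrow> ptm \<Rightarrow> ptm \<Rightarrow> ptm \<Rightarrow> ptm" where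
  "J_red w s C c p = (case un_refl p of
      Some (s', a) \<Rightarrow> if s = s' then w c else PJ s C c p
    | None \<Rightarrow> PJ s C c p)"

definition tree_red :: "(ptm \<Rightarrow> ptm) \<Rightarrow> ptm \<Rightarrow> ptm \<Rightarrow> ptm \<Rightarrow> ptm \<Rightarrow> ptm" where
  "tree_red w C lf nd t = (case un_tree t of
      Some q \<Rightarrow> (case q of None \<Rightarrow> w lf
        | Some (x, y) \<Rightarrow> w (msubst 0 [PTreeElim C lf nd y, PTreeElim C lf nd x, y, x] 0 nd))
    | None \<Rightarrow> PTreeElim C lf nd t)"

definition unfold :: "signature \<Rightarrow> (ptm \<Rightarrow> ptm) \<Rightarrow> nat \<Rightarrow> ptm" where
  "unfold S w i = (case S i of
      None \<Rightarrow> PConst i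
    | Some (A, d) \<Rightarrow> (case d of None \<Rightarrow> PConst i | Some t \<Rightarrow> w t))"

text \<open>The reducer for subterms is the parameter \<open>w\<close>, which \<open>whnf\<close>
  supplies with less fuel. A term on which the fuel runs out is returned unchanged and so remains
  convertible to the input.\<close>

fun whnf_step :: "(ptm \<Rightarrow> ptm) \<Rightarrow> signature \<Rightarrow> ptm \<Rightarrow> ptm" where
  "whnf_step w S (PApp s f a) = app_red w s a (w f)"
| "whnf_step w S (PSplit s C d p) = split_red w s C d (w p)"
| "whnf_step w S (PNatElim s C z st n) = nat_red w s C z st (w n)"
| "whnf_step w S (PJ s C c p) = J_red w s C c (w p)"
| "whnf_step w S (PTreeElim C lf nd t) = tree_red w C lf nd (w t)"
| "whnf_step w S (PConst i) = unfold S w i"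
| "whnf_step w S (PAnn A t) = w t"
| "whnf_step w S t = t"

primrec whnf :: "nat \<Rightarrow> signature \<Rightarrow> ptm \<Rightarrow> ptm" where
  "whnf 0 S t = t"
| "whnf (Suc n) S t = whnf_step (whnf n S) S t"

section \<open>Conversion test\<close>

text \<open>The domain of an abstraction is ignored: abstractions that differ only in it are convertible, by
  beta and eta.\<close>

primrec frame :: "ptm \<Rightarrow> ptm" where
  "frame (PVar n) = PVar n"
| "frame (PConst n) = PConst n"
| "frame (PUni s i) = PUni s i"
| "frame (PPi s A B) = PPi s PTree PTree"
| "frame (PLam s A B) = PLam s PTree PTree"
| "frame (PApp s A B) = PApp s PTree PTree"
| "frame (PSig s A B) = PSig s PTree PTree"
| "frame (PPair s A B) = PPair s PTree PTree"
| "frame (PSplit s C e p) = PSplit s PTree PTree PTree"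
| "frame (PNat s) = PNat s"
| "frame (PZero s) = PZero s"
| "frame (PSuc s n) = PSuc s PTree"
| "frame (PNatElim s C z st n) = PNatElim s PTree PTree PTree PTree"
| "frame (PId s A a b) = PId s PTree PTree PTree"
| "frame (PRefl s a) = PRefl s PTree"
| "frame (PJ s C e p) = PJ s PTree PTree PTree"
| "frame PTree = PTree"
| "frame PLeaf = PLeaf"
| "frame (PNode t u) = PNode PTree PTree"
| "frame (PTreeElim C lf nd t) = PTreeElim PTree PTree PTree PTree"
| "frame (PFunext f g h) = PFunext PTree PTree PTree"
| "frame (PUIP f g) = PUIP PTree PTree"
| "frame (PAnn f g) = PAnn PTree PTree"

primrec subterms :: "ptm \<Rightarrow> ptm list" where
  "subterms (PVar n) = []"
| "subterms (PConst n) = []"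
| "subterms (PUni s i) = []"
| "subterms (PPi s A B) = [A, B]"
| "subterms (PLam s A B) = [B]"
| "subterms (PApp s A B) = [A, B]"
| "subterms (PSig s A B) = [A, B]"
| "subterms (PPair s A B) = [A, B]"
| "subterms (PSplit s C e p) = [C, e, p]"
| "subterms (PNat s) = []"
| "subterms (PZero s) = []"
| "subterms (PSuc s n) = [n]"
| "subterms (PNatElim s C z st n) = [C, z, st, n]"
| "subterms (PId s A a b) = [A, a, b]"
| "subterms (PRefl s a) = [a]"
| "subterms (PJ s C e p) = [C, e, p]"
| "subterms PTree = []"
| "subterms PLeaf = []"
| "subterms (PNode t u) = [t, u]"
| "subterms (PTreeElim C lf nd t) = [C, lf, nd, t]"
| "subterms (PFunext f g h) = [f, g, h]"
| "subterms (PUIP f g) = [f, g]"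
| "subterms (PAnn f g) = [g]"


fun all2 :: "('a \<Rightarrow> 'a \<Rightarrow> bool) \<Rightarrow> 'a list \<Rightarrow> 'a list \<Rightarrow> bool" where
  "all2 r [] [] = True"
| "all2 r (x # xs) (y # ys) = (if r x y then all2 r xs ys else False)"
| "all2 r _ _ = False"

text \<open>Terms with different heads may still be convertible by eta: the side that is not an
  abstraction is applied to the variable \<open>0\<close>, after \<open>shift\<close> has made room
  for it.\<close>

definition conv_step :: "(ptm \<Rightarrow> ptm \<Rightarrow> bool) \<Rightarrow> ptm \<Rightarrow> ptm \<Rightarrow> bool" where
  "conv_step r t u = (if frame t = frame u then all2 r (subterms t) (subterms u)
    else (case un_lam t of
        Some (s, A, b) \<Rightarrow> r b (PApp s (shift 1 0 u) (PVar 0))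
      | None \<Rightarrow> (case un_lam u of
          Some (s, A, b) \<Rightarrow> r (PApp s (shift 1 0 t) (PVar 0)) b
        | None \<Rightarrow> False)))"

primrec conv_test :: "nat \<Rightarrow> signature \<Rightarrow> ptm \<Rightarrow> ptm \<Rightarrow> bool" where
  "conv_test 0 S t u = False"
| "conv_test (Suc n) S t u =
    (if t = u then True else conv_step (conv_test n S) (whnf n S t) (whnf n S u))"

section \<open>Type inference and type checking\<close>

text \<open>\<open>r \<Gamma> t None\<close> is the type inferred for \<open>t\<close>; \<open>r \<Gamma> t (Some A)\<close> is defined if \<open>t\<close> checks
  against the type \<open>A\<close>, and its value is then irrelevant.\<close>

type_synonym checker = "ptm list \<Rightarrow> ptm \<Rightarrow> ptm option \<Rightarrow> ptm option"

fun sublayer :: "layer \<Rightarrow> layer \<Rightarrow> bool" where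
  "sublayer Inner s = True"
| "sublayer Exo Exo = True"
| "sublayer Exo Inner = False"

fun is_some :: "'a option \<Rightarrow> bool" where
  "is_some None = False"
| "is_some (Some x) = True"

definition level_of :: "nat \<Rightarrow> signature \<Rightarrow> checker \<Rightarrow> ptm list \<Rightarrow> layer \<Rightarrow> ptm \<Rightarrow> nat option" where
  "level_of n S r \<Gamma> s A = (case r \<Gamma> A None of
      None \<Rightarrow> None
    | Some T \<Rightarrow> (case un_Uni (whnf n S T) of
        None \<Rightarrow> None
      | Some (s', i) \<Rightarrow> if sublayer s' s then Some i else None))"

text \<open>Reduction need not preserve typing, so a reduct is checked to be a type again.\<close>

definition head_type :: "nat \<Rightarrow> signature \<Rightarrow> checker \<Rightarrow> ptm list \<Rightarrow> ptm \<Rightarrow> ptm \<Rightarrow> ptm option" where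
  "head_type n S r \<Gamma> A B =
    (if A = B then Some B else if is_some (level_of n S r \<Gamma> Exo B) then Some B else None)"

definition infer_head :: "nat \<Rightarrow> signature \<Rightarrow> checker \<Rightarrow> ptm list \<Rightarrow> ptm \<Rightarrow> ptm option" where
  "infer_head n S r \<Gamma> t = (case r \<Gamma> t None of
      None \<Rightarrow> None
    | Some A \<Rightarrow> head_type n S r \<Gamma> A (whnf n S A))"

text \<open>The typing rules raise the level or the layer of a universe itself, not of a universe
  inside a product. Elsewhere the comparison is plain conversion.\<close>

definition subtype_test :: "nat \<Rightarrow> signature \<Rightarrow> ptm \<Rightarrow> ptm \<Rightarrow> ptm option" where
  "subtype_test n S A B = (if A = B then Some A else
    (case (un_Uni (whnf n S A), un_Uni (whnf n S B)) of
        (Some (s, i), Some (s', j)) \<Rightarrow> if sublayer s s' \<and> i \<le> j then Some A else None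
      | _ \<Rightarrow> if conv_test n S A B then Some A else None))"

definition infer_check :: "nat \<Rightarrow> signature \<Rightarrow> checker \<Rightarrow> ptm list \<Rightarrow> ptm \<Rightarrow> ptm \<Rightarrow> ptm option" where
  "infer_check n S r \<Gamma> t A = (case r \<Gamma> t None of
      None \<Rightarrow> None
    | Some B \<Rightarrow> subtype_test n S B A)"

text \<open>An inferred type is always an exo-type, which settles the formation premise of
  exo-abstractions and exo-reflexivity; for the inner layer an inner universe must be found. Pairs
  have no inferred type, since the components do not determine the family of the second one.\<close>

primrec infer_step :: "nat \<Rightarrow> signature \<Rightarrow> checker \<Rightarrow> ptm list \<Rightarrow> ptm \<Rightarrow> ptm option" where
  "infer_step n S r \<Gamma> (PVar i) = (if i < length \<Gamma> then Some (shift (Suc i) 0 (\<Gamma> ! i)) else None)"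
| "infer_step n S r \<Gamma> (PConst i) = (case S i of None \<Rightarrow> None | Some (A, d) \<Rightarrow> Some A)"
| "infer_step n S r \<Gamma> (PUni s i) = Some (PUni s (Suc i))"
| "infer_step n S r \<Gamma> (PPi s A B) = (case level_of n S r \<Gamma> s A of
      None \<Rightarrow> None
    | Some i \<Rightarrow> (case level_of n S r (A # \<Gamma>) s B of None \<Rightarrow> None | Some j \<Rightarrow> Some (PUni s (max i j))))"
| "infer_step n S r \<Gamma> (PSig s A B) = (case level_of n S r \<Gamma> s A of
      None \<Rightarrow> None
    | Some i \<Rightarrow> (case level_of n S r (A # \<Gamma>) s B of None \<Rightarrow> None | Some j \<Rightarrow> Some (PUni s (max i j))))"
| "infer_step n S r \<Gamma> (PLam s A b) = (case level_of n S r \<Gamma> s A of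
      None \<Rightarrow> None
    | Some i \<Rightarrow> (case r (A # \<Gamma>) b None of
        None \<Rightarrow> None
      | Some B \<Rightarrow> if s = Exo then Some (PPi s A B)
          else if is_some (level_of n S r (A # \<Gamma>) s B) then Some (PPi s A B) else None))"
| "infer_step n S r \<Gamma> (PApp s f a) = (case infer_head n S r \<Gamma> f of
      None \<Rightarrow> None
    | Some P \<Rightarrow> (case un_Pi P of
        None \<Rightarrow> None
      | Some (s', A, B) \<Rightarrow> if s = s' \<and> is_some (r \<Gamma> a (Some A)) then Some (msubst 0 [a] 0 B) else None))"
| "infer_step n S r \<Gamma> (PPair s a b) = None"
| "infer_step n S r \<Gamma> (PSplit s C d p) = (case infer_head n S r \<Gamma> p of
      None \<Rightarrow> None
    | Some P \<Rightarrow> (case un_Sig P of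
        None \<Rightarrow> None
      | Some (s', A, B) \<Rightarrow>
          if s = s' \<and> is_some (level_of n S r (P # \<Gamma>) s C) \<and>
            is_some (r (B # A # \<Gamma>) d (Some (msubst 2 [PPair s (PVar 1) (PVar 0)] 0 C)))
          then Some (msubst 0 [p] 0 C) else None))"
| "infer_step n S r \<Gamma> (PNat s) = Some (PUni s 0)"
| "infer_step n S r \<Gamma> (PZero s) = Some (PNat s)"
| "infer_step n S r \<Gamma> (PSuc s t) = (if is_some (r \<Gamma> t (Some (PNat s))) then Some (PNat s) else None)"
| "infer_step n S r \<Gamma> (PNatElim s C z st t) =
    (if is_some (r \<Gamma> t (Some (PNat s))) \<and> is_some (level_of n S r (PNat s # \<Gamma>) s C) \<and>
      is_some (r \<Gamma> z (Some (msubst 0 [PZero s] 0 C))) \<and>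
      is_some (r (C # PNat s # \<Gamma>) st (Some (msubst 2 [PSuc s (PVar 1)] 0 C)))
    then Some (msubst 0 [t] 0 C) else None)"
| "infer_step n S r \<Gamma> (PId s A a b) = (case level_of n S r \<Gamma> s A of
      None \<Rightarrow> None
    | Some i \<Rightarrow> if is_some (r \<Gamma> a (Some A)) \<and> is_some (r \<Gamma> b (Some A)) then Some (PUni s i) else None)"
| "infer_step n S r \<Gamma> (PRefl s a) = (case r \<Gamma> a None of
      None \<Rightarrow> None
    | Some A \<Rightarrow> if s = Exo then Some (PId s A a a)
        else if is_some (level_of n S r \<Gamma> s A) then Some (PId s A a a) else None)"
| "infer_step n S r \<Gamma> (PJ s C c p) = (case infer_head n S r \<Gamma> p of
      None \<Rightarrow> None
    | Some P \<Rightarrow> (case un_Id P of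
        None \<Rightarrow> None
      | Some (s', A, a, b) \<Rightarrow>
          if s = s' \<and>
            is_some (level_of n S r (PId s (shift 1 0 A) (shift 1 0 a) (PVar 0) # A # \<Gamma>) s C) \<and>
            is_some (r \<Gamma> c (Some (msubst 0 [PRefl s a, a] 0 C)))
          then Some (msubst 0 [p, b] 0 C) else None))"
| "infer_step n S r \<Gamma> PTree = Some (PUni Exo 0)"
| "infer_step n S r \<Gamma> PLeaf = Some PTree"
| "infer_step n S r \<Gamma> (PNode t u) =
    (if is_some (r \<Gamma> t (Some PTree)) \<and> is_some (r \<Gamma> u (Some PTree)) then Some PTree else None)"
| "infer_step n S r \<Gamma> (PTreeElim C lf nd t) =
    (if is_some (r \<Gamma> t (Some PTree)) \<and> is_some (level_of n S r (PTree # \<Gamma>) Exo C) \<and>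
      is_some (r \<Gamma> lf (Some (msubst 0 [PLeaf] 0 C))) \<and>
      is_some (r (msubst 3 [PVar 1] 0 C # msubst 2 [PVar 1] 0 C # PTree # PTree # \<Gamma>) nd
        (Some (msubst 4 [PNode (PVar 3) (PVar 2)] 0 C)))
    then Some (msubst 0 [t] 0 C) else None)"
| "infer_step n S r \<Gamma> (PFunext f g h) = (case infer_head n S r \<Gamma> f of
      None \<Rightarrow> None
    | Some P \<Rightarrow> (case un_Pi P of
        None \<Rightarrow> None
      | Some (s, A, B) \<Rightarrow>
          if s = Exo \<and> is_some (r \<Gamma> g (Some P)) \<and>
            is_some (r \<Gamma> h (Some (PPi Exo A
              (PId Exo B (PApp Exo (shift 1 0 f) (PVar 0)) (PApp Exo (shift 1 0 g) (PVar 0))))))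
          then Some (PId Exo P f g) else None))"
| "infer_step n S r \<Gamma> (PUIP p q) = (case infer_head n S r \<Gamma> p of
      None \<Rightarrow> None
    | Some P \<Rightarrow> (case un_Id P of
        None \<Rightarrow> None
      | Some (s, A, a, b) \<Rightarrow> if s = Exo \<and> is_some (r \<Gamma> q (Some P)) then Some (PId Exo P p q) else None))"
| "infer_step n S r \<Gamma> (PAnn A t) =
    (if is_some (level_of n S r \<Gamma> Exo A) \<and> is_some (r \<Gamma> t (Some A)) then Some A else None)"

fun check_step :: "nat \<Rightarrow> signature \<Rightarrow> checker \<Rightarrow> ptm list \<Rightarrow> ptm \<Rightarrow> ptm \<Rightarrow> ptm option" where
  "check_step n S r \<Gamma> A (PLam s D b) = (case head_type n S r \<Gamma> A (whnf n S A) of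
      None \<Rightarrow> None
    | Some P \<Rightarrow> (case un_Pi P of
        None \<Rightarrow> None
      | Some (s', D', B) \<Rightarrow> if s = s' \<and> D = D' then r (D # \<Gamma>) b (Some B)
          else infer_check n S r \<Gamma> (PLam s D b) A))"
| "check_step n S r \<Gamma> A (PPair s a b) = (case head_type n S r \<Gamma> A (whnf n S A) of
      None \<Rightarrow> None
    | Some P \<Rightarrow> (case un_Sig P of
        None \<Rightarrow> None
      | Some (s', D, B) \<Rightarrow> if s = s' \<and> is_some (r \<Gamma> a (Some D)) then r \<Gamma> b (Some (msubst 0 [a] 0 B))
          else None))"
| "check_step n S r \<Gamma> A (PRefl s a) = (case head_type n S r \<Gamma> A (whnf n S A) of
      None \<Rightarrow> None
    | Some P \<Rightarrow> (case un_Id P of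
        None \<Rightarrow> None
      | Some (s', D, x, y) \<Rightarrow>
          if s = s' \<and> is_some (r \<Gamma> a (Some D)) \<and> conv_test n S a x \<and> conv_test n S a y
          then Some A else None))"
| "check_step n S r \<Gamma> A t = infer_check n S r \<Gamma> t A"

primrec typecheck :: "nat \<Rightarrow> signature \<Rightarrow> checker" where
  "typecheck 0 S \<Gamma> t m = None"
| "typecheck (Suc n) S \<Gamma> t m = (case m of
      None \<Rightarrow> infer_step n S (typecheck n S) \<Gamma> t
    | Some A \<Rightarrow> check_step n S (typecheck n S) \<Gamma> A t)"


section \<open>Soundness of the type checker\<close>

text \<open>The second half is the invariant of inference: inversion applied to the formation of an
  inferred type yields the formation of its parts, which the premises of the eliminators ask
  for.\<close>

definition typed :: "tm list \<Rightarrow> tm \<Rightarrow> tm \<Rightarrow> bool" where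
  "typed \<Gamma> t A \<longleftrightarrow> \<Gamma> \<turnstile> t \<Colon> A \<and> (\<exists>i. \<Gamma> \<turnstile> A \<Colon> Uni Exo i)"

lemma inst0_Var_rename: "inst 0 [Var 0] (rename (up_ren Suc) t) = t"
proof -
  have "(\<lambda>n. if up_ren Suc n < length [Var 0] then [Var 0] ! up_ren Suc n
      else Var (up_ren Suc n - length [Var 0] + 0)) = Var"
    by (rule nat_funext) auto
  then show ?thesis by (simp only: inst_def subst_rename subst_Var)
qed

text \<open>Raw eta does not tie the domain to the function: \<open>Lam s A' b\<close> is expanded
  with domain \<open>A\<close>, and beta inside the body leaves \<open>Lam s A b\<close>.\<close>

lemma Lam_domain: "Lam s A b \<doteq> Lam s A' b"
proof -
  have "App s (lift 1 (Lam s A' b)) (Var 0) \<doteq> inst 0 [Var 0] (rename (up_ren Suc) b)"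
    using Pi_beta by (simp add: lift_eq_rename)
  then have "Lam s A (App s (lift 1 (Lam s A' b)) (Var 0)) \<doteq> Lam s A b"
    by (auto intro: cong_Lam conv_refl simp: inst0_Var_rename)
  then show ?thesis
    using Pi_eta conv_sym conv_trans by blast
qed

lemma funpow_up_shift: "(up ^^ d) (\<lambda>n. Var (n + k)) = (\<lambda>n. if n < d then Var n else Var (n + k))"
  by (rule ext) (auto simp: funpow_up)

lemma inst_formers [simp]:
  "inst k ts (Uni s i) = Uni s i"
  "inst k ts (NatT s) = NatT s"
  "inst k ts UnLBinTree = UnLBinTree"
  "inst k ts (IdT s A a b) = IdT s (inst k ts A) (inst k ts a) (inst k ts b)"
  by (simp_all add: inst_def)

lemma inst0_lift1 [simp]: "inst 0 [a] (lift (Suc 0) t) = t"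
  using inst_lift [of 0 "[a]" t] by simp

lemma inst0_Var [simp]: "inst 0 (a # ts) (Var 0) = a"
  by (simp add: inst_def)

lemma typed_conv: "typed \<Gamma> t A \<Longrightarrow> A \<doteq> B \<Longrightarrow> \<exists>i. \<Gamma> \<turnstile> B \<Colon> Uni Exo i \<Longrightarrow> typed \<Gamma> t B"
  unfolding typed_def by (meson convert)

lemma typed_Uni: "\<Gamma> \<turnstile> A \<Colon> Uni s i \<Longrightarrow> typed \<Gamma> A (Uni s i)"
  unfolding typed_def by (meson cumulative_exo Uni_form typed_wf)

lemma wf_Cons_any: "\<Gamma> \<turnstile> A \<Colon> Uni s i \<Longrightarrow> wf (A # \<Gamma>)"
  by (meson cumulative_exo wf_Cons typed_wf)

lemma Pi_form_max:
  assumes "\<Gamma> \<turnstile> A \<Colon> Uni s i" "A # \<Gamma> \<turnstile> B \<Colon> Uni s j"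
  shows "\<Gamma> \<turnstile> PiT s A B \<Colon> Uni s (max i j)"
  using assms by (auto intro!: Pi_form intro: cumulative_le)

lemma Sig_form_max:
  assumes "\<Gamma> \<turnstile> A \<Colon> Uni s i" "A # \<Gamma> \<turnstile> B \<Colon> Uni s j"
  shows "\<Gamma> \<turnstile> SigT s A B \<Colon> Uni s (max i j)"
  using assms by (auto intro!: Sig_form intro: cumulative_le)

lemma inst_type:
  assumes "A # \<Gamma> \<turnstile> C \<Colon> Uni s i" and "\<Delta> @ \<Gamma> \<turnstile> a \<Colon> lift k A" and "length \<Delta> = k"
  shows "\<Delta> @ \<Gamma> \<turnstile> inst k [a] C \<Colon> Uni s i"
  using inst_typing [OF assms(1)] assms(2,3) by auto

lemma Lam_typed:
  assumes A: "\<Gamma> \<turnstile> A \<Colon> Uni s i" and b: "typed (A # \<Gamma>) b B" and B: "A # \<Gamma> \<turnstile> B \<Colon> Uni s j"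
  shows "typed \<Gamma> (Lam s A b) (PiT s A B)"
  using Pi_form_max [OF A B] b unfolding typed_def by (meson Pi_intro cumulative_exo)

lemma App_typed:
  assumes f: "typed \<Gamma> f (PiT s A B)" and a: "\<Gamma> \<turnstile> a \<Colon> A"
  shows "typed \<Gamma> (App s f a) (inst 0 [a] B)"
proof -
  obtain i where "A # \<Gamma> \<turnstile> B \<Colon> Uni s i"
    using f Pi_inversion unfolding typed_def by blast
  then have "\<Gamma> \<turnstile> inst 0 [a] B \<Colon> Uni s i"
    using inst_type [of A \<Gamma> B s i "[]" a 0] a by simp
  then show ?thesis
    using f a unfolding typed_def by (meson Pi_elim cumulative_exo)
qed

lemma generic_app_typed:
  assumes f: "\<Gamma> \<turnstile> f \<Colon> PiT s A B" and wf: "wf (A # \<Gamma>)"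
  shows "A # \<Gamma> \<turnstile> App s (lift 1 f) (Var 0) \<Colon> B"
proof -
  have "A # \<Gamma> \<turnstile> lift 1 f \<Colon> PiT s (lift 1 A) (rename (up_ren Suc) B)"
    using weakening [OF f wf] by (simp add: rename_Suc)
  moreover have "A # \<Gamma> \<turnstile> Var 0 \<Colon> lift 1 A"
    using variable [OF wf, of 0] by simp
  ultimately show ?thesis
    using Pi_elim inst0_Var_rename by metis
qed

lemma generic_pair_typed:
  assumes S: "\<Gamma> \<turnstile> SigT s A B \<Colon> Uni s i" and wf: "wf (B # A # \<Gamma>)"
  shows "B # A # \<Gamma> \<turnstile> Pr s (Var 1) (Var 0) \<Colon> lift 2 (SigT s A B)"
proof -
  have "A # \<Gamma> \<turnstile> rename Suc (SigT s A B) \<Colon> rename Suc (Uni s i)"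
    using weakening [OF S] wf wf_tl by blast
  then have "B # A # \<Gamma> \<turnstile> rename Suc (rename Suc (SigT s A B)) \<Colon> rename Suc (rename Suc (Uni s i))"
    using weakening wf by blast
  moreover have "rename Suc (rename Suc (SigT s A B)) = lift 2 (SigT s A B)"
    by (simp add: lift_eq_rename rename_rename numeral_2_eq_2 flip: rename.simps)
  ultimately have S2: "B # A # \<Gamma> \<turnstile> lift 2 (SigT s A B) \<Colon> Uni s i"
    by simp
  let ?B = "rename (up_ren (\<lambda>n. n + 2)) B"
  have eq: "lift 2 (SigT s A B) = SigT s (lift 2 A) ?B"
    by (simp add: lift_eq_rename)
  have "(\<lambda>n. if up_ren (\<lambda>n. n + 2) n < length [Var 1] then [Var 1] ! up_ren (\<lambda>n. n + 2) n
      else Var (up_ren (\<lambda>n. n + 2) n - length [Var 1] + 0)) = (\<lambda>n. Var (n + 1))"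
    by (rule nat_funext) auto
  then have "inst 0 [Var 1] ?B = subst (\<lambda>n. Var (n + 1)) B"
    by (simp only: inst_def subst_rename)
  then have "inst 0 [Var 1] ?B = lift 1 B"
    by (simp only: lift_eq_rename rename_eq_subst)
  then have "B # A # \<Gamma> \<turnstile> Var 0 \<Colon> inst 0 [Var 1] ?B"
    using variable [OF wf, of 0] by simp
  moreover have "B # A # \<Gamma> \<turnstile> Var 1 \<Colon> lift 2 A"
    using variable [OF wf, of 1] by (simp add: numeral_2_eq_2)
  ultimately show ?thesis
    using Sig_intro S2 unfolding eq by blast
qed

text \<open>The hypothesis on \<open>d\<close> is conditional because \<open>check_sound\<close>
  gives a typing only for an expected type that is known to be well-formed. This formation is
  derived here from that of \<open>C\<close>. The other eliminators follow the same pattern.\<close>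

lemma Sig_elim_typed:
  assumes p: "typed \<Gamma> p (SigT s A B)" and C: "SigT s A B # \<Gamma> \<turnstile> C \<Colon> Uni s i"
    and d: "\<exists>j. B # A # \<Gamma> \<turnstile> inst 2 [Pr s (Var 1) (Var 0)] C \<Colon> Uni Exo j \<Longrightarrow>
      B # A # \<Gamma> \<turnstile> d \<Colon> inst 2 [Pr s (Var 1) (Var 0)] C"
  shows "typed \<Gamma> (SigElim s C d p) (inst 0 [p] C)"
proof -
  obtain j where A: "\<Gamma> \<turnstile> A \<Colon> Uni s j" and B: "A # \<Gamma> \<turnstile> B \<Colon> Uni s j"
    using p Sig_inversion unfolding typed_def by blast
  have "[B, A] @ \<Gamma> \<turnstile> Pr s (Var 1) (Var 0) \<Colon> lift 2 (SigT s A B)"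
    using generic_pair_typed [OF Sig_form [OF A B] wf_Cons_any [OF B]] by simp
  then have "B # A # \<Gamma> \<turnstile> inst 2 [Pr s (Var 1) (Var 0)] C \<Colon> Uni s i"
    using inst_type [OF C, of "[B, A]"] by simp
  then have "B # A # \<Gamma> \<turnstile> d \<Colon> inst 2 [Pr s (Var 1) (Var 0)] C"
    using d cumulative_exo by blast
  moreover have "\<Gamma> \<turnstile> inst 0 [p] C \<Colon> Uni Exo i"
    using inst_type [OF C, of "[]" p 0] p cumulative_exo by (simp add: typed_def)
  ultimately show ?thesis
    using Sig_elim [OF C] p unfolding typed_def by blast
qed

lemma Nat_elim_typed:
  assumes C: "NatT s # \<Gamma> \<turnstile> C \<Colon> Uni s i" and n: "\<Gamma> \<turnstile> n \<Colon> NatT s"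
    and z: "\<exists>j. \<Gamma> \<turnstile> inst 0 [NZero s] C \<Colon> Uni Exo j \<Longrightarrow> \<Gamma> \<turnstile> z \<Colon> inst 0 [NZero s] C"
    and st: "wf (C # NatT s # \<Gamma>) \<Longrightarrow> \<exists>j. C # NatT s # \<Gamma> \<turnstile> inst 2 [NSuc s (Var 1)] C \<Colon> Uni Exo j \<Longrightarrow>
      C # NatT s # \<Gamma> \<turnstile> st \<Colon> inst 2 [NSuc s (Var 1)] C"
  shows "typed \<Gamma> (NatElim s C z st n) (inst 0 [n] C)"
proof -
  have wf: "wf (C # NatT s # \<Gamma>)" using wf_Cons_any [OF C] .
  have "\<Gamma> \<turnstile> inst 0 [NZero s] C \<Colon> Uni s i"
    using inst_type [OF C, of "[]" "NZero s" 0] Nat_intro_0 typed_wf [OF n] by simp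
  then have z': "\<Gamma> \<turnstile> z \<Colon> inst 0 [NZero s] C"
    using z cumulative_exo by blast
  have "[C, NatT s] @ \<Gamma> \<turnstile> NSuc s (Var 1) \<Colon> lift 2 (NatT s)"
    using Nat_intro_Suc variable [OF wf, of 1] by simp
  then have "C # NatT s # \<Gamma> \<turnstile> inst 2 [NSuc s (Var 1)] C \<Colon> Uni s i"
    using inst_type [OF C, of "[C, NatT s]"] by simp
  then have "C # NatT s # \<Gamma> \<turnstile> st \<Colon> inst 2 [NSuc s (Var 1)] C"
    using st wf cumulative_exo by blast
  moreover have "\<Gamma> \<turnstile> inst 0 [n] C \<Colon> Uni Exo i"
    using inst_type [OF C, of "[]" n 0] n cumulative_exo by simp
  ultimately show ?thesis
    using Nat_elim [OF C z' _ n] unfolding typed_def by blast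
qed

lemma Id_elim_typed:
  assumes p: "typed \<Gamma> p (IdT s A a b)"
    and C: "wf (IdT s (lift 1 A) (lift 1 a) (Var 0) # A # \<Gamma>) \<Longrightarrow>
      IdT s (lift 1 A) (lift 1 a) (Var 0) # A # \<Gamma> \<turnstile> C \<Colon> Uni s i"
    and c: "\<exists>j. \<Gamma> \<turnstile> inst 0 [Refl s a, a] C \<Colon> Uni Exo j \<Longrightarrow> \<Gamma> \<turnstile> c \<Colon> inst 0 [Refl s a, a] C"
  shows "typed \<Gamma> (J s C c p) (inst 0 [p, b] C)"
proof -
  obtain j where A: "\<Gamma> \<turnstile> A \<Colon> Uni s j" and a: "\<Gamma> \<turnstile> a \<Colon> A" and b: "\<Gamma> \<turnstile> b \<Colon> A"
    using p Id_inversion unfolding typed_def by blast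
  have wf: "wf (A # \<Gamma>)" using wf_Cons_any [OF A] .
  have "A # \<Gamma> \<turnstile> lift 1 A \<Colon> Uni s j" "A # \<Gamma> \<turnstile> lift 1 a \<Colon> lift 1 A"
    using weakening [OF A wf] weakening [OF a wf] by (simp_all add: rename_Suc)
  then have "A # \<Gamma> \<turnstile> IdT s (lift 1 A) (lift 1 a) (Var 0) \<Colon> Uni s j"
    using Id_form variable [OF wf, of 0] by simp
  then have C': "IdT s (lift 1 A) (lift 1 a) (Var 0) # A # \<Gamma> \<turnstile> C \<Colon> Uni s i"
    using C wf_Cons_any by blast
  have "\<Gamma> \<turnstile> inst 0 [Refl s a, a] C \<Colon> Uni s i"
    using inst0_pair_typing [OF C' a, of "Refl s a"] Id_intro [OF A a] by simp
  then have c': "\<Gamma> \<turnstile> c \<Colon> inst 0 [Refl s a, a] C"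
    using c cumulative_exo by blast
  have "\<Gamma> \<turnstile> inst 0 [p, b] C \<Colon> Uni s i"
    using inst0_pair_typing [OF C' b, of p] p by (simp add: typed_def)
  then show ?thesis
    using Id_elim [OF C' c' b] p cumulative_exo unfolding typed_def by blast
qed

lemma Tree_elim_typed:
  assumes C: "UnLBinTree # \<Gamma> \<turnstile> C \<Colon> Uni Exo i" and t: "\<Gamma> \<turnstile> t \<Colon> UnLBinTree"
    and lf: "\<exists>j. \<Gamma> \<turnstile> inst 0 [ULeaf] C \<Colon> Uni Exo j \<Longrightarrow> \<Gamma> \<turnstile> lf \<Colon> inst 0 [ULeaf] C"
    and nd: "wf (inst 3 [Var 1] C # inst 2 [Var 1] C # UnLBinTree # UnLBinTree # \<Gamma>) \<Longrightarrow>
      \<exists>j. inst 3 [Var 1] C # inst 2 [Var 1] C # UnLBinTree # UnLBinTree # \<Gamma> \<turnstile>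
        inst 4 [UNode (Var 3) (Var 2)] C \<Colon> Uni Exo j \<Longrightarrow>
      inst 3 [Var 1] C # inst 2 [Var 1] C # UnLBinTree # UnLBinTree # \<Gamma> \<turnstile> nd \<Colon>
        inst 4 [UNode (Var 3) (Var 2)] C"
  shows "typed \<Gamma> (TreeElim C lf nd t) (inst 0 [t] C)"
proof -
  let ?T = UnLBinTree
  have wf: "wf \<Gamma>" using typed_wf [OF t] .
  have "wf (?T # \<Gamma>)" using typed_wf [OF C] .
  then have wf2: "wf (?T # ?T # \<Gamma>)"
    using wf_Cons Tree_form by blast
  have "[?T, ?T] @ \<Gamma> \<turnstile> Var 1 \<Colon> lift 2 ?T"
    using variable [OF wf2, of 1] by simp
  then have D1: "?T # ?T # \<Gamma> \<turnstile> inst 2 [Var 1] C \<Colon> Uni Exo i"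
    using inst_type [OF C, of "[?T, ?T]"] by simp
  let ?D1 = "inst 2 [Var 1] C"
  have "[?D1, ?T, ?T] @ \<Gamma> \<turnstile> Var 1 \<Colon> lift 3 ?T"
    using variable [OF wf_Cons_any [OF D1], of 1] by simp
  then have D2: "?D1 # ?T # ?T # \<Gamma> \<turnstile> inst 3 [Var 1] C \<Colon> Uni Exo i"
    using inst_type [OF C, of "[?D1, ?T, ?T]"] by simp
  let ?\<Delta> = "[inst 3 [Var 1] C, ?D1, ?T, ?T]"
  have wf4: "wf (?\<Delta> @ \<Gamma>)"
    using wf_Cons_any [OF D2] by simp
  have "?\<Delta> @ \<Gamma> \<turnstile> UNode (Var 3) (Var 2) \<Colon> lift 4 ?T"
    using variable [OF wf4, of 3] variable [OF wf4, of 2] by (simp add: Tree_intro_node)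
  then have "?\<Delta> @ \<Gamma> \<turnstile> inst 4 [UNode (Var 3) (Var 2)] C \<Colon> Uni Exo i"
    using inst_type [OF C, of ?\<Delta>] by simp
  then have nd': "?\<Delta> @ \<Gamma> \<turnstile> nd \<Colon> inst 4 [UNode (Var 3) (Var 2)] C"
    using nd wf4 by auto
  have "\<Gamma> \<turnstile> inst 0 [ULeaf] C \<Colon> Uni Exo i"
    using inst_type [OF C, of "[]" ULeaf 0] Tree_intro_leaf [OF wf] by simp
  then have "\<Gamma> \<turnstile> lf \<Colon> inst 0 [ULeaf] C"
    using lf by blast
  moreover have "\<Gamma> \<turnstile> inst 0 [t] C \<Colon> Uni Exo i"
    using inst_type [OF C, of "[]" t 0] t by simp
  ultimately show ?thesis
    using Tree_elim [OF C _ _ t] nd' unfolding typed_def by auto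
qed

section \<open>Interpretation of the terms of the checker\<close>

locale closed_interpretation =
  fixes l :: nat and \<rho> :: "nat \<Rightarrow> tm"
  assumes closed [simp]: "subst \<sigma> (\<rho> i) = \<rho> i"
begin

abbreviation interp :: "ptm \<Rightarrow> tm" ("\<lbrakk>_\<rbrakk>") where
  "interp \<equiv> tm_of l \<rho>"

lemma interp_shift_aux: "\<lbrakk>shift k d t\<rbrakk> = subst ((up ^^ d) (\<lambda>n. Var (n + k))) \<lbrakk>t\<rbrakk>"
proof (induction t arbitrary: d)
  case (PVar n)
  then show ?case by (simp add: funpow_up_shift)
qed simp_all

lemma interp_shift [simp]: "\<lbrakk>shift k 0 t\<rbrakk> = lift k \<lbrakk>t\<rbrakk>"
  by (simp add: interp_shift_aux inst_def)

lemma interp_pick: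
  "\<lbrakk>pick k d ts n\<rbrakk> = rename (\<lambda>i. i + d) (if n < length ts then map interp ts ! n else Var (n - length ts + k))"
  by (induction k d ts n rule: pick.induct) (auto simp: lift_eq_rename)

lemma interp_msubst_aux:
  "\<lbrakk>msubst k ts d t\<rbrakk> = subst ((up ^^ d) (\<lambda>n. if n < length ts then map interp ts ! n else Var (n - length ts + k))) \<lbrakk>t\<rbrakk>"
proof (induction t arbitrary: d)
  case (PVar n)
  then show ?case by (simp add: funpow_up interp_pick)
qed simp_all

lemma interp_msubst [simp]: "\<lbrakk>msubst k ts 0 t\<rbrakk> = inst k (map interp ts) \<lbrakk>t\<rbrakk>"
  by (simp add: interp_msubst_aux inst_def cong: if_cong)

end

locale signature_model = closed_interpretation +
  fixes S :: signature
  assumes const_typed: "S i = Some (A, d) \<Longrightarrow> typed [] (\<rho> i) \<lbrakk>A\<rbrakk>"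
    and const_def: "S i = Some (A, Some t) \<Longrightarrow> \<rho> i = \<lbrakk>t\<rbrakk>"
begin

lemma un_simps:
  "un_lam t = Some (s, A, b) \<longleftrightarrow> t = PLam s A b"
  "un_pair t = Some (s, A, b) \<longleftrightarrow> t = PPair s A b"
  "un_Pi t = Some (s, A, b) \<longleftrightarrow> t = PPi s A b"
  "un_Sig t = Some (s, A, b) \<longleftrightarrow> t = PSig s A b"
  "un_Id t = Some (s, A, b, e) \<longleftrightarrow> t = PId s A b e"
  "un_Uni t = Some (s, i) \<longleftrightarrow> t = PUni s i"
  "un_refl t = Some (s, b) \<longleftrightarrow> t = PRefl s b"
  "un_nat t = Some (s, None) \<longleftrightarrow> t = PZero s"
  "un_nat t = Some (s, Some b) \<longleftrightarrow> t = PSuc s b"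
  "un_tree t = Some None \<longleftrightarrow> t = PLeaf"
  "un_tree t = Some (Some (b, e)) \<longleftrightarrow> t = PNode b e"
  by (cases t; auto)+

text \<open>The computation rules of \<open>conv\<close> relate raw terms, so a reduction step is a
  conversion even before the term is known to be typed.\<close>

lemma whnf_step_conv:
  assumes w: "\<And>t. \<lbrakk>t\<rbrakk> \<doteq> \<lbrakk>w t\<rbrakk>"
  shows "\<lbrakk>t\<rbrakk> \<doteq> \<lbrakk>whnf_step w S t\<rbrakk>"
proof (cases t)
  case (PApp s f a)
  have 1: "App s \<lbrakk>f\<rbrakk> \<lbrakk>a\<rbrakk> \<doteq> App s \<lbrakk>w f\<rbrakk> \<lbrakk>a\<rbrakk>"
    using w by (intro cong_App conv_refl)
  have 2: "App s (Lam s \<lbrakk>A\<rbrakk> \<lbrakk>b\<rbrakk>) \<lbrakk>a\<rbrakk> \<doteq> \<lbrakk>w (msubst 0 [a] 0 b)\<rbrakk>" for A b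
    using conv_trans [OF Pi_beta w [of "msubst 0 [a] 0 b", simplified]] .
  show ?thesis
    using 1 conv_trans [OF 1] 2
    by (auto simp: PApp app_red_def un_simps split: option.splits)
next
  case (PSplit s C d p)
  have 1: "SigElim s \<lbrakk>C\<rbrakk> \<lbrakk>d\<rbrakk> \<lbrakk>p\<rbrakk> \<doteq> SigElim s \<lbrakk>C\<rbrakk> \<lbrakk>d\<rbrakk> \<lbrakk>w p\<rbrakk>"
    using w by (intro cong_SigElim conv_refl)
  have 2: "SigElim s \<lbrakk>C\<rbrakk> \<lbrakk>d\<rbrakk> (Pr s \<lbrakk>a\<rbrakk> \<lbrakk>b\<rbrakk>) \<doteq> \<lbrakk>w (msubst 0 [b, a] 0 d)\<rbrakk>" for a b
    using conv_trans [OF Sig_beta w [of "msubst 0 [b, a] 0 d", simplified]] .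
  show ?thesis
    using 1 conv_trans [OF 1] 2
    by (auto simp: PSplit split_red_def un_simps split: option.splits)
next
  case (PNatElim s C z st n)
  have 1: "NatElim s \<lbrakk>C\<rbrakk> \<lbrakk>z\<rbrakk> \<lbrakk>st\<rbrakk> \<lbrakk>n\<rbrakk> \<doteq> NatElim s \<lbrakk>C\<rbrakk> \<lbrakk>z\<rbrakk> \<lbrakk>st\<rbrakk> \<lbrakk>w n\<rbrakk>"
    using w by (intro cong_NatElim conv_refl)
  have 2: "NatElim s \<lbrakk>C\<rbrakk> \<lbrakk>z\<rbrakk> \<lbrakk>st\<rbrakk> (NSuc s \<lbrakk>m\<rbrakk>) \<doteq> \<lbrakk>w (msubst 0 [PNatElim s C z st m, m] 0 st)\<rbrakk>" for m
    using conv_trans [OF Nat_beta_Suc w [of "msubst 0 [PNatElim s C z st m, m] 0 st", simplified]] .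
  have 3: "NatElim s \<lbrakk>C\<rbrakk> \<lbrakk>z\<rbrakk> \<lbrakk>st\<rbrakk> (NZero s) \<doteq> \<lbrakk>w z\<rbrakk>"
    using conv_trans [OF Nat_beta_0 w] .
  show ?thesis
    using 1 conv_trans [OF 1] 2 3
    by (auto simp: PNatElim nat_red_def un_simps split: option.splits)
next
  case (PJ s C c p)
  have 1: "J s \<lbrakk>C\<rbrakk> \<lbrakk>c\<rbrakk> \<lbrakk>p\<rbrakk> \<doteq> J s \<lbrakk>C\<rbrakk> \<lbrakk>c\<rbrakk> \<lbrakk>w p\<rbrakk>"
    using w by (intro cong_J conv_refl)
  have 2: "J s \<lbrakk>C\<rbrakk> \<lbrakk>c\<rbrakk> (Refl s \<lbrakk>a\<rbrakk>) \<doteq> \<lbrakk>w c\<rbrakk>" for a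
    using conv_trans [OF Id_beta w] .
  show ?thesis
    using 1 conv_trans [OF 1] 2
    by (auto simp: PJ J_red_def un_simps split: option.splits)
next
  case (PTreeElim C lf nd p)
  have 1: "TreeElim \<lbrakk>C\<rbrakk> \<lbrakk>lf\<rbrakk> \<lbrakk>nd\<rbrakk> \<lbrakk>p\<rbrakk> \<doteq> TreeElim \<lbrakk>C\<rbrakk> \<lbrakk>lf\<rbrakk> \<lbrakk>nd\<rbrakk> \<lbrakk>w p\<rbrakk>"
    using w by (intro cong_TreeElim conv_refl)
  have 2: "TreeElim \<lbrakk>C\<rbrakk> \<lbrakk>lf\<rbrakk> \<lbrakk>nd\<rbrakk> (UNode \<lbrakk>x\<rbrakk> \<lbrakk>y\<rbrakk>) \<doteq>
      \<lbrakk>w (msubst 0 [PTreeElim C lf nd y, PTreeElim C lf nd x, y, x] 0 nd)\<rbrakk>" for x y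
    using conv_trans [OF Tree_beta_node w [of "msubst 0 [PTreeElim C lf nd y, PTreeElim C lf nd x, y, x] 0 nd", simplified]] .
  have 3: "TreeElim \<lbrakk>C\<rbrakk> \<lbrakk>lf\<rbrakk> \<lbrakk>nd\<rbrakk> ULeaf \<doteq> \<lbrakk>w lf\<rbrakk>"
    using conv_trans [OF Tree_beta_leaf w] .
  show ?thesis
    using 1 conv_trans [OF 1] 2 3
    by (auto simp: PTreeElim tree_red_def un_simps split: option.splits)
next
  case (PConst i)
  then show ?thesis
    using w const_def by (auto simp: unfold_def conv_refl split: option.splits)
next
  case (PAnn A u)
  then show ?thesis using w by simp
qed (simp_all add: conv_refl)

lemma whnf_conv: "\<lbrakk>t\<rbrakk> \<doteq> \<lbrakk>whnf n S t\<rbrakk>"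
  by (induction n arbitrary: t) (simp_all add: conv_refl whnf_step_conv)

lemma is_some_iff: "is_some x \<longleftrightarrow> (\<exists>y. x = Some y)"
  by (cases x) auto

lemma all2_iff: "all2 r xs ys \<longleftrightarrow> list_all2 r xs ys"
  by (induction r xs ys rule: all2.induct) auto

lemma frame_cong:
  assumes "frame t = frame u" and "list_all2 (\<lambda>x y. \<lbrakk>x\<rbrakk> \<doteq> \<lbrakk>y\<rbrakk>) (subterms t) (subterms u)"
  shows "\<lbrakk>t\<rbrakk> \<doteq> \<lbrakk>u\<rbrakk>"
proof (cases t)
  case (PLam s A b)
  then obtain A' b' where "u = PLam s A' b'"
    using assms(1) by (cases u) auto
  then show ?thesis
    using assms(2) PLam by (auto intro: conv_trans [OF Lam_domain cong_Lam] conv_refl)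
qed (use assms in \<open>(cases u; auto intro: conv.intros(1) conv.intros(15-))+\<close>)

lemma conv_step_sound:
  assumes r: "\<And>t u. r t u \<Longrightarrow> \<lbrakk>t\<rbrakk> \<doteq> \<lbrakk>u\<rbrakk>" and c: "conv_step r t u"
  shows "\<lbrakk>t\<rbrakk> \<doteq> \<lbrakk>u\<rbrakk>"
proof -
  have eta: "Lam s \<lbrakk>A\<rbrakk> \<lbrakk>b\<rbrakk> \<doteq> \<lbrakk>u\<rbrakk>" if "\<lbrakk>b\<rbrakk> \<doteq> App s (lift 1 \<lbrakk>u\<rbrakk>) (Var 0)" for s A b u
    using that conv_trans [OF cong_Lam [OF conv_refl] Pi_eta] by blast
  show ?thesis
  proof (cases "frame t = frame u")
    case True
    with c have "list_all2 r (subterms t) (subterms u)"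
      by (simp add: conv_step_def all2_iff)
    with True show ?thesis
      by (auto intro: frame_cong list_all2_mono r)
  next
    case False
    with c consider s A b where "t = PLam s A b" "r b (PApp s (shift 1 0 u) (PVar 0))"
      | s A b where "u = PLam s A b" "r (PApp s (shift 1 0 t) (PVar 0)) b"
      by (auto simp: conv_step_def un_simps split: option.splits)
    then show ?thesis
    proof cases
      case 1
      then show ?thesis using r [OF 1(2)] eta by simp
    next
      case 2
      then show ?thesis using conv_sym [OF r [OF 2(2)]] conv_sym [OF eta] by simp
    qed
  qed
qed

lemma conv_test_sound: "conv_test n S t u \<Longrightarrow> \<lbrakk>t\<rbrakk> \<doteq> \<lbrakk>u\<rbrakk>"
proof (induction n arbitrary: t u)
  case (Suc n)
  show ?case
  proof (cases "t = u")
    case False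
    then have "\<lbrakk>whnf n S t\<rbrakk> \<doteq> \<lbrakk>whnf n S u\<rbrakk>"
      using Suc by (auto intro: conv_step_sound split: if_splits)
    then show ?thesis
      by (meson conv_sym conv_trans whnf_conv)
  qed (simp add: conv_refl)
qed simp

text \<open>A successful check means something only if the expected type is already well-formed. The
  step functions therefore have to secure the formation of each type that they pass on.\<close>

definition sound :: "checker \<Rightarrow> bool" where
  "sound r \<longleftrightarrow> (\<forall>\<Gamma> t. wf (map interp \<Gamma>) \<longrightarrow>
    (\<forall>A. r \<Gamma> t None = Some A \<longrightarrow> typed (map interp \<Gamma>) \<lbrakk>t\<rbrakk> \<lbrakk>A\<rbrakk>) \<and>
    (\<forall>A. is_some (r \<Gamma> t (Some A)) \<longrightarrow> (\<exists>i. map interp \<Gamma> \<turnstile> \<lbrakk>A\<rbrakk> \<Colon> Uni Exo i) \<longrightarrow> map interp \<Gamma> \<turnstile> \<lbrakk>t\<rbrakk> \<Colon> \<lbrakk>A\<rbrakk>))"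

context
  fixes r :: checker and n :: nat
  assumes sound: "sound r"
begin

lemma infer_sound: "r \<Gamma> t None = Some A \<Longrightarrow> wf (map interp \<Gamma>) \<Longrightarrow> typed (map interp \<Gamma>) \<lbrakk>t\<rbrakk> \<lbrakk>A\<rbrakk>"
  using sound by (auto simp: sound_def)

lemma check_sound:
  "is_some (r \<Gamma> t (Some A)) \<Longrightarrow> \<exists>i. map interp \<Gamma> \<turnstile> \<lbrakk>A\<rbrakk> \<Colon> Uni Exo i \<Longrightarrow> map interp \<Gamma> \<turnstile> \<lbrakk>t\<rbrakk> \<Colon> \<lbrakk>A\<rbrakk>"
  using sound typed_wf unfolding sound_def by blast

lemma sublayer_Uni: "\<Gamma> \<turnstile> A \<Colon> Uni s i \<Longrightarrow> sublayer s s' \<Longrightarrow> \<Gamma> \<turnstile> A \<Colon> Uni s' i"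
  by (cases s; cases s') (auto intro: type_is_exotype)

lemma level_of_sound:
  assumes "level_of n S r \<Gamma> s A = Some i" and wf: "wf (map interp \<Gamma>)"
  shows "map interp \<Gamma> \<turnstile> \<lbrakk>A\<rbrakk> \<Colon> Uni s (l + i)"
proof -
  obtain T s' where T: "r \<Gamma> A None = Some T" "whnf n S T = PUni s' i" and s: "sublayer s' s"
    using assms(1) by (auto simp: level_of_def un_simps split: option.splits if_splits)
  have "map interp \<Gamma> \<turnstile> \<lbrakk>A\<rbrakk> \<Colon> \<lbrakk>T\<rbrakk>"
    using infer_sound [OF T(1) wf] by (simp add: typed_def)
  moreover have "\<lbrakk>T\<rbrakk> \<doteq> Uni s' (l + i)"
    using whnf_conv [of T n] by (simp add: T(2))
  ultimately have "map interp \<Gamma> \<turnstile> \<lbrakk>A\<rbrakk> \<Colon> Uni s' (l + i)"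
    using convert cumulative_exo Uni_form wf by blast
  then show ?thesis using s by (rule sublayer_Uni)
qed

lemma is_level_sound:
  "is_some (level_of n S r \<Gamma> s A) \<Longrightarrow> wf (map interp \<Gamma>) \<Longrightarrow> \<exists>i. map interp \<Gamma> \<turnstile> \<lbrakk>A\<rbrakk> \<Colon> Uni s i"
  unfolding is_some_iff using level_of_sound by blast

lemma head_type_sound:
  assumes "head_type n S r \<Gamma> A B = Some P" and "\<exists>i. map interp \<Gamma> \<turnstile> \<lbrakk>A\<rbrakk> \<Colon> Uni Exo i"
  shows "P = B" and "\<exists>i. map interp \<Gamma> \<turnstile> \<lbrakk>P\<rbrakk> \<Colon> Uni Exo i"
  using assms is_level_sound typed_wf unfolding head_type_def by (metis option.distinct(1) option.inject)+

lemma infer_head_sound: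
  assumes "infer_head n S r \<Gamma> t = Some P" and wf: "wf (map interp \<Gamma>)"
  shows "typed (map interp \<Gamma>) \<lbrakk>t\<rbrakk> \<lbrakk>P\<rbrakk>"
proof -
  obtain A where A: "r \<Gamma> t None = Some A" and h: "head_type n S r \<Gamma> A (whnf n S A) = Some P"
    using assms(1) by (auto simp: infer_head_def split: option.splits)
  have t: "typed (map interp \<Gamma>) \<lbrakk>t\<rbrakk> \<lbrakk>A\<rbrakk>"
    using infer_sound [OF A wf] .
  then have "P = whnf n S A \<and> (\<exists>i. map interp \<Gamma> \<turnstile> \<lbrakk>P\<rbrakk> \<Colon> Uni Exo i)"
    using head_type_sound [OF h] by (simp add: typed_def)
  then show ?thesis
    using typed_conv [OF t] whnf_conv by blast
qed

lemma subtype_test_sound: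
  assumes t: "typed \<Gamma> t \<lbrakk>B\<rbrakk>" and A: "\<exists>i. \<Gamma> \<turnstile> \<lbrakk>A\<rbrakk> \<Colon> Uni Exo i" and s: "is_some (subtype_test n S B A)"
  shows "\<Gamma> \<turnstile> t \<Colon> \<lbrakk>A\<rbrakk>"
proof -
  have wf: "wf \<Gamma>" using t typed_wf unfolding typed_def by blast
  consider "A = B" | "conv_test n S B A"
    | s i s' j where "whnf n S B = PUni s i" "whnf n S A = PUni s' j" "sublayer s s'" "i \<le> j"
    using s by (auto simp: subtype_test_def un_simps split: option.splits if_splits)
  then show ?thesis
  proof cases
    case 1
    then show ?thesis using t by (simp add: typed_def)
  next
    case 2
    then show ?thesis
      using t A conv_test_sound convert unfolding typed_def by blast
  next
    case 3
    have "\<lbrakk>B\<rbrakk> \<doteq> Uni s (l + i)" "\<lbrakk>A\<rbrakk> \<doteq> Uni s' (l + j)"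
      using whnf_conv [of B n] whnf_conv [of A n] by (simp_all add: 3)
    then have "\<Gamma> \<turnstile> t \<Colon> Uni s (l + i)"
      using t convert cumulative_exo Uni_form wf unfolding typed_def by blast
    then have "\<Gamma> \<turnstile> t \<Colon> Uni s' (l + j)"
      using sublayer_Uni 3 cumulative_le by (meson add_le_cancel_left)
    then show ?thesis
      using A convert conv_sym \<open>\<lbrakk>A\<rbrakk> \<doteq> Uni s' (l + j)\<close> by blast
  qed
qed

lemma infer_check_sound:
  assumes "is_some (infer_check n S r \<Gamma> t A)" and A: "\<exists>i. map interp \<Gamma> \<turnstile> \<lbrakk>A\<rbrakk> \<Colon> Uni Exo i"
  shows "map interp \<Gamma> \<turnstile> \<lbrakk>t\<rbrakk> \<Colon> \<lbrakk>A\<rbrakk>"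
proof -
  obtain B where "r \<Gamma> t None = Some B" and s: "is_some (subtype_test n S B A)"
    using assms(1) by (auto simp: infer_check_def split: option.splits)
  then have "typed (map interp \<Gamma>) \<lbrakk>t\<rbrakk> \<lbrakk>B\<rbrakk>"
    using infer_sound A typed_wf by blast
  then show ?thesis using subtype_test_sound A s by blast
qed

lemma infer_step_sound:
  assumes i: "infer_step n S r \<Gamma> t = Some A" and wf: "wf (map interp \<Gamma>)"
  shows "typed (map interp \<Gamma>) \<lbrakk>t\<rbrakk> \<lbrakk>A\<rbrakk>"
proof (cases t)
  case (PVar k)
  then show ?thesis
    using i wf variable [OF wf, of k] wf_nth [OF wf, of k] by (auto simp: typed_def split: if_splits)
next
  case (PConst k)
  then have "typed [] \<lbrakk>t\<rbrakk> \<lbrakk>A\<rbrakk>"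
    using i const_typed by (auto split: option.splits)
  then show ?thesis
    using closed_typing [OF _ wf] unfolding typed_def by blast
next
  case (PUni s k)
  then show ?thesis
    using i typed_Uni [OF Uni_form [OF wf]] by auto
next
  case (PPi s B C)
  then obtain j k where A: "A = PUni s (max j k)" and B: "level_of n S r \<Gamma> s B = Some j"
    and C: "level_of n S r (B # \<Gamma>) s C = Some k"
    using i by (auto split: option.splits)
  note B' = level_of_sound [OF B wf]
  show ?thesis
    using typed_Uni [OF Pi_form_max [OF B' level_of_sound [OF C, simplified, OF wf_Cons_any [OF B']]]]
    by (simp add: PPi A max_add_distrib_right)
next
  case (PSig s B C)
  then obtain j k where A: "A = PUni s (max j k)" and B: "level_of n S r \<Gamma> s B = Some j"
    and C: "level_of n S r (B # \<Gamma>) s C = Some k"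
    using i by (auto split: option.splits)
  note B' = level_of_sound [OF B wf]
  show ?thesis
    using typed_Uni [OF Sig_form_max [OF B' level_of_sound [OF C, simplified, OF wf_Cons_any [OF B']]]]
    by (simp add: PSig A max_add_distrib_right)
next
  case (PLam s B b)
  then obtain j C where A: "A = PPi s B C" and B: "level_of n S r \<Gamma> s B = Some j"
    and b: "r (B # \<Gamma>) b None = Some C" and C: "s = Exo \<or> is_some (level_of n S r (B # \<Gamma>) s C)"
    using i by (auto split: option.splits if_splits)
  note B' = level_of_sound [OF B wf]
  have wfB: "wf (map interp (B # \<Gamma>))"
    using wf_Cons_any [OF B'] by simp
  have b': "typed (\<lbrakk>B\<rbrakk> # map interp \<Gamma>) \<lbrakk>b\<rbrakk> \<lbrakk>C\<rbrakk>"
    using infer_sound [OF b wfB] by simp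
  have "\<exists>k. \<lbrakk>B\<rbrakk> # map interp \<Gamma> \<turnstile> \<lbrakk>C\<rbrakk> \<Colon> Uni s k"
    using C b' is_level_sound [OF _ wfB] by (auto simp: typed_def)
  then show ?thesis
    using Lam_typed [OF B' b'] by (auto simp: PLam A)
next
  case (PApp s f a)
  then obtain B C where A: "A = msubst 0 [a] 0 C" and f: "infer_head n S r \<Gamma> f = Some (PPi s B C)"
    and a: "is_some (r \<Gamma> a (Some B))"
    using i by (auto simp: un_simps split: option.splits if_splits)
  have f': "typed (map interp \<Gamma>) \<lbrakk>f\<rbrakk> (PiT s \<lbrakk>B\<rbrakk> \<lbrakk>C\<rbrakk>)"
    using infer_head_sound [OF f wf] by simp
  then have "\<exists>j. map interp \<Gamma> \<turnstile> \<lbrakk>B\<rbrakk> \<Colon> Uni Exo j"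
    using Pi_inversion cumulative_exo unfolding typed_def by blast
  then show ?thesis
    using App_typed [OF f'] check_sound [OF a] by (simp add: PApp A)
next
  case (PPair s a b)
  then show ?thesis using i by simp
next
  case (PSplit s C d p)
  then obtain D E where A: "A = msubst 0 [p] 0 C" and p: "infer_head n S r \<Gamma> p = Some (PSig s D E)"
    and C: "is_some (level_of n S r (PSig s D E # \<Gamma>) s C)"
    and d: "is_some (r (E # D # \<Gamma>) d (Some (msubst 2 [PPair s (PVar 1) (PVar 0)] 0 C)))"
    using i by (auto simp: un_simps split: option.splits if_splits)
  have p': "typed (map interp \<Gamma>) \<lbrakk>p\<rbrakk> (SigT s \<lbrakk>D\<rbrakk> \<lbrakk>E\<rbrakk>)"
    using infer_head_sound [OF p wf] by simp
  then have "wf (map interp (PSig s D E # \<Gamma>))"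
    using wf_Cons_any by (auto simp: typed_def)
  then obtain k where "SigT s \<lbrakk>D\<rbrakk> \<lbrakk>E\<rbrakk> # map interp \<Gamma> \<turnstile> \<lbrakk>C\<rbrakk> \<Colon> Uni s k"
    using is_level_sound [OF C] by auto
  then show ?thesis
    using Sig_elim_typed [OF p'] check_sound [OF d] by (simp add: PSplit A)
next
  case (PNat s)
  then show ?thesis using i typed_Uni [OF Nat_form [OF wf]] by auto
next
  case (PZero s)
  have "\<exists>j. map interp \<Gamma> \<turnstile> NatT s \<Colon> Uni Exo j"
    using Nat_form [OF wf] cumulative_exo by blast
  then show ?thesis using i Nat_intro_0 [OF wf] PZero by (auto simp: typed_def)
next
  case (PSuc s u)
  then have "is_some (r \<Gamma> u (Some (PNat s)))" "A = PNat s"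
    using i by (auto split: if_splits)
  moreover have "\<exists>j. map interp \<Gamma> \<turnstile> NatT s \<Colon> Uni Exo j"
    using Nat_form [OF wf] cumulative_exo by blast
  ultimately show ?thesis
    using check_sound [of \<Gamma> u "PNat s"] by (auto simp: PSuc typed_def intro: Nat_intro_Suc)
next
  case (PNatElim s C z st u)
  then have A: "A = msubst 0 [u] 0 C" and u: "is_some (r \<Gamma> u (Some (PNat s)))"
    and C: "is_some (level_of n S r (PNat s # \<Gamma>) s C)" and z: "is_some (r \<Gamma> z (Some (msubst 0 [PZero s] 0 C)))"
    and st: "is_some (r (C # PNat s # \<Gamma>) st (Some (msubst 2 [PSuc s (PVar 1)] 0 C)))"
    using i by (auto split: if_splits)
  have N: "map interp \<Gamma> \<turnstile> NatT s \<Colon> Uni Exo 0"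
    using Nat_form [OF wf] cumulative_exo by blast
  then obtain k where C': "NatT s # map interp \<Gamma> \<turnstile> \<lbrakk>C\<rbrakk> \<Colon> Uni s k"
    using is_level_sound [OF C] wf_Cons_any by auto
  have "map interp \<Gamma> \<turnstile> \<lbrakk>u\<rbrakk> \<Colon> NatT s"
    using check_sound [OF u] N by auto
  from Nat_elim_typed [OF C' this] show ?thesis
    using check_sound [OF z] check_sound [OF st] by (simp add: PNatElim A)
next
  case (PId s B a b)
  then obtain k where A: "A = PUni s k" and B: "level_of n S r \<Gamma> s B = Some k"
    and ab: "is_some (r \<Gamma> a (Some B))" "is_some (r \<Gamma> b (Some B))"
    using i by (auto split: option.splits if_splits)
  note B' = level_of_sound [OF B wf]
  have "map interp \<Gamma> \<turnstile> \<lbrakk>a\<rbrakk> \<Colon> \<lbrakk>B\<rbrakk>" "map interp \<Gamma> \<turnstile> \<lbrakk>b\<rbrakk> \<Colon> \<lbrakk>B\<rbrakk>"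
    using check_sound ab B' cumulative_exo by blast+
  then show ?thesis
    using typed_Uni [OF Id_form [OF B']] by (simp add: PId A)
next
  case (PRefl s a)
  then obtain B where A: "A = PId s B a a" and a: "r \<Gamma> a None = Some B"
    and B: "s = Exo \<or> is_some (level_of n S r \<Gamma> s B)"
    using i by (auto split: option.splits if_splits)
  have a': "typed (map interp \<Gamma>) \<lbrakk>a\<rbrakk> \<lbrakk>B\<rbrakk>"
    using infer_sound [OF a wf] .
  then obtain k where "map interp \<Gamma> \<turnstile> \<lbrakk>B\<rbrakk> \<Colon> Uni s k"
    using B is_level_sound [OF _ wf] by (auto simp: typed_def)
  then show ?thesis
    using a' cumulative_exo Id_form Id_intro by (simp add: PRefl A typed_def) blast
next
  case (PJ s C c p)
  then obtain D a b where A: "A = msubst 0 [p, b] 0 C" and p: "infer_head n S r \<Gamma> p = Some (PId s D a b)"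
    and C: "is_some (level_of n S r (PId s (shift 1 0 D) (shift 1 0 a) (PVar 0) # D # \<Gamma>) s C)"
    and c: "is_some (r \<Gamma> c (Some (msubst 0 [PRefl s a, a] 0 C)))"
    using i by (auto simp: un_simps split: option.splits if_splits)
  have p': "typed (map interp \<Gamma>) \<lbrakk>p\<rbrakk> (IdT s \<lbrakk>D\<rbrakk> \<lbrakk>a\<rbrakk> \<lbrakk>b\<rbrakk>)"
    using infer_head_sound [OF p wf] by simp
  obtain k where C': "wf (IdT s (lift 1 \<lbrakk>D\<rbrakk>) (lift 1 \<lbrakk>a\<rbrakk>) (Var 0) # \<lbrakk>D\<rbrakk> # map interp \<Gamma>) \<Longrightarrow>
      IdT s (lift 1 \<lbrakk>D\<rbrakk>) (lift 1 \<lbrakk>a\<rbrakk>) (Var 0) # \<lbrakk>D\<rbrakk> # map interp \<Gamma> \<turnstile> \<lbrakk>C\<rbrakk> \<Colon> Uni s k"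
    using is_level_sound [OF C] by auto
  then show ?thesis
    using Id_elim_typed [OF p' C', of "\<lbrakk>c\<rbrakk>"] check_sound [OF c] by (simp add: PJ A)
next
  case PTree
  then show ?thesis using i typed_Uni [OF Tree_form [OF wf]] by auto
next
  case PLeaf
  then show ?thesis using i wf by (auto simp: typed_def intro: Tree_intro_leaf Tree_form)
next
  case (PNode u w)
  then have "is_some (r \<Gamma> u (Some PTree))" "is_some (r \<Gamma> w (Some PTree))" "A = PTree"
    using i by (auto split: if_splits)
  moreover have "\<exists>j. map interp \<Gamma> \<turnstile> UnLBinTree \<Colon> Uni Exo j"
    using Tree_form [OF wf] by blast
  ultimately show ?thesis
    using check_sound [of \<Gamma> u PTree] check_sound [of \<Gamma> w PTree]
    by (auto simp: PNode typed_def intro: Tree_intro_node)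
next
  case (PTreeElim C lf nd u)
  then have A: "A = msubst 0 [u] 0 C" and u: "is_some (r \<Gamma> u (Some PTree))"
    and C: "is_some (level_of n S r (PTree # \<Gamma>) Exo C)" and lf: "is_some (r \<Gamma> lf (Some (msubst 0 [PLeaf] 0 C)))"
    and nd: "is_some (r (msubst 3 [PVar 1] 0 C # msubst 2 [PVar 1] 0 C # PTree # PTree # \<Gamma>) nd
        (Some (msubst 4 [PNode (PVar 3) (PVar 2)] 0 C)))"
    using i by (auto split: if_splits)
  have T: "map interp \<Gamma> \<turnstile> UnLBinTree \<Colon> Uni Exo 0"
    using Tree_form [OF wf] .
  then obtain k where C': "UnLBinTree # map interp \<Gamma> \<turnstile> \<lbrakk>C\<rbrakk> \<Colon> Uni Exo k"
    using is_level_sound [OF C] wf_Cons_any by auto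
  have "map interp \<Gamma> \<turnstile> \<lbrakk>u\<rbrakk> \<Colon> UnLBinTree"
    using check_sound [OF u] T by auto
  from Tree_elim_typed [OF C' this] show ?thesis
    using check_sound [OF lf] check_sound [OF nd] by (simp add: PTreeElim A)
next
  case (PFunext f g h)
  then obtain B C where A: "A = PId Exo (PPi Exo B C) f g"
    and f: "infer_head n S r \<Gamma> f = Some (PPi Exo B C)" and g: "is_some (r \<Gamma> g (Some (PPi Exo B C)))"
    and h: "is_some (r \<Gamma> h (Some (PPi Exo B
      (PId Exo C (PApp Exo (shift 1 0 f) (PVar 0)) (PApp Exo (shift 1 0 g) (PVar 0))))))"
    using i by (auto simp: un_simps split: option.splits if_splits)
  let ?P = "PiT Exo \<lbrakk>B\<rbrakk> \<lbrakk>C\<rbrakk>"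
  have f': "typed (map interp \<Gamma>) \<lbrakk>f\<rbrakk> ?P"
    using infer_head_sound [OF f wf] by simp
  then obtain j where P: "map interp \<Gamma> \<turnstile> ?P \<Colon> Uni Exo j" and f'': "map interp \<Gamma> \<turnstile> \<lbrakk>f\<rbrakk> \<Colon> ?P"
    by (auto simp: typed_def)
  have g': "map interp \<Gamma> \<turnstile> \<lbrakk>g\<rbrakk> \<Colon> ?P"
    using check_sound [OF g] P by auto
  obtain k where B: "map interp \<Gamma> \<turnstile> \<lbrakk>B\<rbrakk> \<Colon> Uni Exo k" and C: "\<lbrakk>B\<rbrakk> # map interp \<Gamma> \<turnstile> \<lbrakk>C\<rbrakk> \<Colon> Uni Exo k"
    using Pi_inversion [OF P] by blast
  have app: "\<lbrakk>B\<rbrakk> # map interp \<Gamma> \<turnstile> App Exo (lift 1 e) (Var 0) \<Colon> \<lbrakk>C\<rbrakk>" if e: "map interp \<Gamma> \<turnstile> e \<Colon> ?P" for e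
    using generic_app_typed [OF e wf_Cons_any [OF B]] .
  have "\<exists>i. map interp \<Gamma> \<turnstile> PiT Exo \<lbrakk>B\<rbrakk> (IdT Exo \<lbrakk>C\<rbrakk> (App Exo (lift 1 \<lbrakk>f\<rbrakk>) (Var 0)) (App Exo (lift 1 \<lbrakk>g\<rbrakk>) (Var 0))) \<Colon> Uni Exo i"
    using Pi_form [OF B Id_form [OF C app [OF f''] app [OF g']]] by blast
  then have "map interp \<Gamma> \<turnstile> \<lbrakk>h\<rbrakk> \<Colon> PiT Exo \<lbrakk>B\<rbrakk> (IdT Exo \<lbrakk>C\<rbrakk> (App Exo (lift 1 \<lbrakk>f\<rbrakk>) (Var 0)) (App Exo (lift 1 \<lbrakk>g\<rbrakk>) (Var 0)))"
    using check_sound [OF h] by simp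
  from exo_funext [OF f'' g' this] Id_form [OF P f'' g'] show ?thesis
    by (auto simp: PFunext A typed_def)
next
  case (PUIP p q)
  then obtain B a b where A: "A = PId Exo (PId Exo B a b) p q"
    and p: "infer_head n S r \<Gamma> p = Some (PId Exo B a b)" and q: "is_some (r \<Gamma> q (Some (PId Exo B a b)))"
    using i by (auto simp: un_simps split: option.splits if_splits)
  let ?P = "IdT Exo \<lbrakk>B\<rbrakk> \<lbrakk>a\<rbrakk> \<lbrakk>b\<rbrakk>"
  obtain j where P: "map interp \<Gamma> \<turnstile> ?P \<Colon> Uni Exo j" and p': "map interp \<Gamma> \<turnstile> \<lbrakk>p\<rbrakk> \<Colon> ?P"
    using infer_head_sound [OF p wf] by (auto simp: typed_def)
  have q': "map interp \<Gamma> \<turnstile> \<lbrakk>q\<rbrakk> \<Colon> ?P"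
    using check_sound [OF q] P by auto
  from exo_uip [OF p' q'] Id_form [OF P p' q'] show ?thesis
    by (auto simp: PUIP A typed_def)
next
  case (PAnn B u)
  then show ?thesis
    using i is_level_sound [of \<Gamma> Exo B] wf check_sound [of \<Gamma> u B] by (auto simp: typed_def split: if_splits)
qed

lemma check_step_sound:
  assumes c: "is_some (check_step n S r \<Gamma> A t)" and A: "\<exists>i. map interp \<Gamma> \<turnstile> \<lbrakk>A\<rbrakk> \<Colon> Uni Exo i"
  shows "map interp \<Gamma> \<turnstile> \<lbrakk>t\<rbrakk> \<Colon> \<lbrakk>A\<rbrakk>"
proof -
  have wf: "wf (map interp \<Gamma>)" using A typed_wf by blast
  \<comment> \<open>Introduction rules match the head normal form of the expected type; conversion
    leads back to that type.\<close>
  have convert_back: "map interp \<Gamma> \<turnstile> \<lbrakk>t\<rbrakk> \<Colon> \<lbrakk>A\<rbrakk>" if "map interp \<Gamma> \<turnstile> \<lbrakk>t\<rbrakk> \<Colon> \<lbrakk>P\<rbrakk>" "P = whnf n S A" for P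
    using that A convert conv_sym whnf_conv by blast
  consider "is_some (infer_check n S r \<Gamma> t A)"
    | s D b B where "t = PLam s D b" "head_type n S r \<Gamma> A (whnf n S A) = Some (PPi s D B)"
        "is_some (r (D # \<Gamma>) b (Some B))"
    | s a b D B where "t = PPair s a b" "head_type n S r \<Gamma> A (whnf n S A) = Some (PSig s D B)"
        "is_some (r \<Gamma> a (Some D))" "is_some (r \<Gamma> b (Some (msubst 0 [a] 0 B)))"
    | s a D x y where "t = PRefl s a" "head_type n S r \<Gamma> A (whnf n S A) = Some (PId s D x y)"
        "is_some (r \<Gamma> a (Some D))" "conv_test n S a x" "conv_test n S a y"
    using c by (cases t) (auto simp: un_simps split: option.splits if_splits)
  then show ?thesis
  proof cases
    case 1
    then show ?thesis using infer_check_sound A by blast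
  next
    case (2 s D b B)
    obtain i where P: "map interp \<Gamma> \<turnstile> PiT s \<lbrakk>D\<rbrakk> \<lbrakk>B\<rbrakk> \<Colon> Uni Exo i"
      using head_type_sound(2) [OF 2(2) A] by auto
    have w: "PPi s D B = whnf n S A"
      using head_type_sound(1) [OF 2(2) A] .
    obtain j where D: "map interp \<Gamma> \<turnstile> \<lbrakk>D\<rbrakk> \<Colon> Uni s j" and B: "\<lbrakk>D\<rbrakk> # map interp \<Gamma> \<turnstile> \<lbrakk>B\<rbrakk> \<Colon> Uni s j"
      using Pi_inversion [OF P] by blast
    have "\<lbrakk>D\<rbrakk> # map interp \<Gamma> \<turnstile> \<lbrakk>b\<rbrakk> \<Colon> \<lbrakk>B\<rbrakk>"
      using check_sound [OF 2(3)] cumulative_exo [OF B] by auto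
    then show ?thesis
      using convert_back [OF _ w] Pi_intro [OF Pi_form [OF D B]] by (simp add: 2(1))
  next
    case (3 s a b D B)
    obtain i where P: "map interp \<Gamma> \<turnstile> SigT s \<lbrakk>D\<rbrakk> \<lbrakk>B\<rbrakk> \<Colon> Uni Exo i"
      using head_type_sound(2) [OF 3(2) A] by auto
    have w: "PSig s D B = whnf n S A"
      using head_type_sound(1) [OF 3(2) A] .
    obtain j where D: "map interp \<Gamma> \<turnstile> \<lbrakk>D\<rbrakk> \<Colon> Uni s j" and B: "\<lbrakk>D\<rbrakk> # map interp \<Gamma> \<turnstile> \<lbrakk>B\<rbrakk> \<Colon> Uni s j"
      using Sig_inversion [OF P] by blast
    have a: "map interp \<Gamma> \<turnstile> \<lbrakk>a\<rbrakk> \<Colon> \<lbrakk>D\<rbrakk>"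
      using check_sound [OF 3(3)] D cumulative_exo by blast
    then have "map interp \<Gamma> \<turnstile> inst 0 [\<lbrakk>a\<rbrakk>] \<lbrakk>B\<rbrakk> \<Colon> Uni Exo j"
      using inst_type [OF B, of "[]" "\<lbrakk>a\<rbrakk>" 0] cumulative_exo by simp
    then have "map interp \<Gamma> \<turnstile> \<lbrakk>b\<rbrakk> \<Colon> inst 0 [\<lbrakk>a\<rbrakk>] \<lbrakk>B\<rbrakk>"
      using check_sound [OF 3(4)] by auto
    then show ?thesis
      using convert_back [OF _ w] Sig_intro [OF Sig_form [OF D B] a] by (simp add: 3(1))
  next
    case (4 s a D x y)
    obtain i where P: "map interp \<Gamma> \<turnstile> IdT s \<lbrakk>D\<rbrakk> \<lbrakk>x\<rbrakk> \<lbrakk>y\<rbrakk> \<Colon> Uni Exo i"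
      using head_type_sound(2) [OF 4(2) A] by auto
    have w: "PId s D x y = whnf n S A"
      using head_type_sound(1) [OF 4(2) A] .
    obtain j where D: "map interp \<Gamma> \<turnstile> \<lbrakk>D\<rbrakk> \<Colon> Uni s j"
      using Id_inversion [OF P] by blast
    have "map interp \<Gamma> \<turnstile> \<lbrakk>a\<rbrakk> \<Colon> \<lbrakk>D\<rbrakk>"
      using check_sound [OF 4(3)] D cumulative_exo by blast
    then have "map interp \<Gamma> \<turnstile> Refl s \<lbrakk>a\<rbrakk> \<Colon> IdT s \<lbrakk>D\<rbrakk> \<lbrakk>a\<rbrakk> \<lbrakk>a\<rbrakk>"
      using Id_intro D by blast
    moreover have "IdT s \<lbrakk>D\<rbrakk> \<lbrakk>a\<rbrakk> \<lbrakk>a\<rbrakk> \<doteq> IdT s \<lbrakk>D\<rbrakk> \<lbrakk>x\<rbrakk> \<lbrakk>y\<rbrakk>"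
      using conv_test_sound 4(4,5) by (intro cong_Id conv_refl)
    ultimately show ?thesis
      using convert_back [OF _ w] convert P by (simp add: 4(1))
  qed
qed

end

lemma typecheck_sound: "sound (typecheck n S)"
proof (induction n)
  case 0
  then show ?case by (simp add: sound_def)
next
  case (Suc n)
  then show ?case
    using infer_step_sound check_step_sound unfolding sound_def [of "typecheck (Suc n) S"] by simp
qed

end


section \<open>Proof terms with named variables\<close>

text \<open>A term is represented by its de Bruijn forms in all contexts: an \<open>hterm\<close> maps the length
  of the context to the form, and a bound variable is identified by the length \<open>d\<close> of the context
  in which it was bound.  Binders of the object theory thus become binders of HOL.
  Inner formers are marked by an \<open>i\<close>, exo-formers are unmarked or marked by an \<open>x\<close>.\<close>

type_synonym hterm = "nat \<Rightarrow> ptm"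

definition bvar :: "nat \<Rightarrow> hterm" where "bvar d e = PVar (e - Suc d)"

definition "lam A b d = PLam Exo (A d) (b (bvar d) (Suc d))"
definition "ilam A b d = PLam Inner (A d) (b (bvar d) (Suc d))"
definition "pi A B d = PPi Exo (A d) (B (bvar d) (Suc d))"
definition "ipi A B d = PPi Inner (A d) (B (bvar d) (Suc d))"
definition "sig A B d = PSig Exo (A d) (B (bvar d) (Suc d))"
definition "isig A B d = PSig Inner (A d) (B (bvar d) (Suc d))"
definition app (infixl "\<cdot>" 100) where "app f a d = PApp Exo (f d) (a d)"
definition iapp (infixl "\<bullet>" 100) where "iapp f a d = PApp Inner (f d) (a d)"
definition "pair a b d = PPair Exo (a d) (b d)"
definition "ipair a b d = PPair Inner (a d) (b d)"
definition "eq A a b d = PId Exo (A d) (a d) (b d)"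
definition "ieq A a b d = PId Inner (A d) (a d) (b d)"
definition "rfl a d = PRefl Exo (a d)"
definition "irfl a d = PRefl Inner (a d)"
definition "sig_rec C e p d =
  PSplit Exo (C (bvar d) (Suc d)) (e (bvar d) (bvar (Suc d)) (Suc (Suc d))) (p d)"
definition "isig_rec C e p d =
  PSplit Inner (C (bvar d) (Suc d)) (e (bvar d) (bvar (Suc d)) (Suc (Suc d))) (p d)"
definition "path_rec C c p d = PJ Exo (C (bvar d) (bvar (Suc d)) (Suc (Suc d))) (c d) (p d)"
definition "ipath_rec C c p d = PJ Inner (C (bvar d) (bvar (Suc d)) (Suc (Suc d))) (c d) (p d)"
definition "nat_rec C z st n d =
  PNatElim Exo (C (bvar d) (Suc d)) (z d) (st (bvar d) (bvar (Suc d)) (Suc (Suc d))) (n d)"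
definition "inat_rec C z st n d =
  PNatElim Inner (C (bvar d) (Suc d)) (z d) (st (bvar d) (bvar (Suc d)) (Suc (Suc d))) (n d)"
definition "tree_rec C lf nd t d = PTreeElim (C (bvar d) (Suc d)) (lf d)
  (nd (bvar d) (bvar (Suc d)) (bvar (Suc (Suc d))) (bvar (Suc (Suc (Suc d)))) (Suc (Suc (Suc (Suc d))))) (t d)"
definition "exo_funext f g h d = PFunext (f d) (g d) (h d)"
definition "uip p q d = PUIP (p d) (q d)"
definition "ann A t d = PAnn (A d) (t d)"

definition Nx :: hterm where "Nx d = PNat Exo"
definition Ni :: hterm where "Ni d = PNat Inner"
definition Tx :: hterm where "Tx d = PTree"
definition Ui :: hterm where "Ui d = PUni Inner 0"
definition Ux :: hterm where "Ux d = PUni Exo 0"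
definition zx :: hterm where "zx d = PZero Exo"
definition zi :: hterm where "zi d = PZero Inner"
definition sx :: "hterm \<Rightarrow> hterm" where "sx n d = PSuc Exo (n d)"
definition si :: "hterm \<Rightarrow> hterm" where "si n d = PSuc Inner (n d)"
definition leaf :: hterm where "leaf d = PLeaf"
definition node :: "hterm \<Rightarrow> hterm \<Rightarrow> hterm" where "node t u d = PNode (t d) (u d)"

section \<open>Derived type formers and operations on equalities\<close>

definition "fun_type A B = pi A (\<lambda>_. B)"
definition "ifun_type A B = ipi A (\<lambda>_. B)"
definition "exo_prod A B = sig A (\<lambda>_. B)"
definition "inner_prod A B = isig A (\<lambda>_. B)"
definition "proj1 A p = sig_rec (\<lambda>_. A) (\<lambda>x y. x) p"
definition "proj2 A B p = sig_rec (\<lambda>q. B (proj1 A q)) (\<lambda>x y. y) p"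
definition "iproj1 A p = isig_rec (\<lambda>_. A) (\<lambda>x y. x) p"
definition "iproj2 A B p = isig_rec (\<lambda>q. B (iproj1 A q)) (\<lambda>x y. y) p"

text \<open>In the following operations on equalities \<open>p : a = b\<close> only the data that occur in the motive
  of the elimination are arguments.\<close>

definition "transport P p u = path_rec (\<lambda>y _. P y) u p"
definition "symm A a p = path_rec (\<lambda>y _. eq A y a) (rfl a) p"
definition "cong B f a p = path_rec (\<lambda>y _. eq B (f a) (f y)) (rfl (f a)) p"
definition "itransp P p u = ipath_rec (\<lambda>y _. P y) u p"
definition "isym A a p = ipath_rec (\<lambda>y _. ieq A y a) (irfl a) p"
definition "icong B f a p = ipath_rec (\<lambda>y _. ieq B (f a) (f y)) (irfl (f a)) p"
definition "itrans A a p q = ipath_rec (\<lambda>y _. ieq A a y) p q"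

text \<open>An entry of the signature is a type together with a term: the first argument selects the
  type.\<close>

type_synonym entry = "bool \<Rightarrow> hterm"

definition claim :: "hterm \<Rightarrow> hterm \<Rightarrow> entry" where
  "claim A t s d = (if s then A d else t d)"

definition given :: "hterm \<Rightarrow> (hterm \<Rightarrow> entry) \<Rightarrow> entry" where
  "given A b s d = (if s then PPi Exo (A d) (b (bvar d) s (Suc d)) else PLam Exo (A d) (b (bvar d) s (Suc d)))"

text \<open>The constant number \<open>i\<close> stands for the \<open>i\<close>-th element of the list \<open>entries\<close> below.\<close>

definition add :: hterm where "add d = PConst 0"
definition tri :: hterm where "tri d = PConst 1"
definition next_prev :: hterm where "next_prev d = PConst 2"
definition next_tree :: hterm where "next_tree d = PConst 3"
definition prev_tree :: hterm where "prev_tree d = PConst 4"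
definition nonleaf :: hterm where "nonleaf d = PConst 5"
definition encode :: hterm where "encode d = PConst 6"
definition decode :: hterm where "decode d = PConst 7"
definition add_zero :: hterm where "add_zero d = PConst 8"
definition add_suc :: hterm where "add_suc d = PConst 9"
definition next_node :: hterm where "next_node d = PConst 10"
definition prev_node_leaf :: hterm where "prev_node_leaf d = PConst 11"
definition prev_node :: hterm where "prev_node d = PConst 12"
definition prev_next :: hterm where "prev_next d = PConst 13"
definition cantor_suc :: hterm where "cantor_suc d = PConst 14"
definition cantor_zero :: hterm where "cantor_zero d = PConst 15"
definition encode_next :: hterm where "encode_next d = PConst 16"
definition encode_decode :: hterm where "encode_decode d = PConst 17"
definition decode_cantor :: hterm where "decode_cantor d = PConst 18"
definition decode_diagonal :: hterm where "decode_diagonal d = PConst 19"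
definition decode_encode :: hterm where "decode_encode d = PConst 20"
definition transp_coherence :: hterm where "transp_coherence d = PConst 21"
definition transp_apply :: hterm where "transp_apply d = PConst 22"
definition into_out :: hterm where "into_out d = PConst 23"
definition out_into :: hterm where "out_into d = PConst 24"
definition singleton_contr :: hterm where "singleton_contr d = PConst 25"
definition contr_path :: hterm where "contr_path d = PConst 26"
definition match_ext :: hterm where "match_ext d = PConst 27"
definition tree_cofibrant :: hterm where "tree_cofibrant d = PConst 28"
definition singleton_path :: hterm where "singleton_path d = PConst 29"
definition sections_id :: hterm where "sections_id d = PConst 30"
definition sections_equiv :: hterm where "sections_equiv d = PConst 31"
definition inner_funext :: hterm where "inner_funext d = PConst 32"
definition nat_to_inner :: hterm where "nat_to_inner d = PConst 33"
definition tree_to_inner :: hterm where "tree_to_inner d = PConst 34"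
definition extend :: hterm where "extend d = PConst 35"
definition extend_restrict :: hterm where "extend_restrict d = PConst 36"
definition restrict_extend :: hterm where "restrict_extend d = PConst 37"
definition tree_extend :: hterm where "tree_extend d = PConst 38"
definition tree_restrict_extend :: hterm where "tree_restrict_extend d = PConst 39"
definition tree_extend_restrict :: hterm where "tree_extend_restrict d = PConst 40"
definition tree_restrict_equiv :: hterm where "tree_restrict_equiv d = PConst 41"
definition main :: hterm where "main d = PConst 42"

section \<open>Binary exo-trees are exo-isomorphic to the exo-natural numbers\<close>

definition add_entry :: entry where "add_entry s =
  (claim (fun_type Nx (fun_type Nx Nx)) (lam Nx (\<lambda>b. lam Nx (\<lambda>a. nat_rec (\<lambda>_. Nx) a (\<lambda>_ i. sx i) b)))) s"

definition tri_entry :: entry where "tri_entry s =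
  (claim (fun_type Nx Nx) (lam Nx (nat_rec (\<lambda>_. Nx) zx (\<lambda>b i. sx (add \<cdot> b \<cdot> i))))) s"

text \<open>The successor on trees that corresponds to Cantor's enumeration of pairs, in which
  \<open>(a + 1, b)\<close> is followed by \<open>(a, b + 1)\<close> and \<open>(0, b)\<close> by \<open>(b + 1, 0)\<close>, refers to the
  predecessor of subtrees, so the two are defined together.\<close>

definition "fst_tree p = proj1 Tx p"
definition "snd_tree p = proj2 Tx (\<lambda>_. Tx) p"

text \<open>In the node case \<open>i\<close> and \<open>k\<close> hold the successor and the
  predecessor of the two subtrees. The predecessor inverts the two rules: \<open>(a, b + 1)\<close>
  goes to \<open>(a + 1, b)\<close> and \<open>(b + 1, 0)\<close> to \<open>(0, b)\<close>. The
  predecessor of \<open>leaf\<close> is set to \<open>leaf\<close>.\<close>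

definition next_prev_entry :: entry where "next_prev_entry s =
  (claim (fun_type Tx (exo_prod Tx Tx))
    (lam Tx (tree_rec (\<lambda>_. exo_prod Tx Tx) (pair (node leaf leaf) leaf) (\<lambda>t u i k. pair
      (tree_rec (\<lambda>_. Tx) (node (fst_tree k) leaf) (\<lambda>_ _ _ _. node (snd_tree i) (fst_tree k)) t)
      (tree_rec (\<lambda>_. Tx) (tree_rec (\<lambda>_. Tx) leaf (\<lambda>_ _ _ _. node leaf (snd_tree i)) t)
        (\<lambda>_ _ _ _. node (fst_tree i) (snd_tree k)) u))))) s"

definition next_tree_entry :: entry where "next_tree_entry s =
  (claim (fun_type Tx Tx) (lam Tx (\<lambda>t. fst_tree (next_prev \<cdot> t)))) s"

definition prev_tree_entry :: entry where "prev_tree_entry s =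
  (claim (fun_type Tx Tx) (lam Tx (\<lambda>t. snd_tree (next_prev \<cdot> t)))) s"

text \<open>The identity on nodes; it expresses that an equation holds for nodes only.\<close>

definition nonleaf_entry :: entry where "nonleaf_entry s =
  (claim (fun_type Tx Tx) (lam Tx (tree_rec (\<lambda>_. Tx) (node leaf leaf) (\<lambda>t u _ _. node t u)))) s"

text \<open>The number of the pair \<open>(a, b)\<close>: the diagonal \<open>a + b = w\<close>
  starts at the triangular number of \<open>w\<close>, and \<open>b\<close> is the position on
  it.\<close>

definition "cantor b a = add \<cdot> b \<cdot> (tri \<cdot> (add \<cdot> b \<cdot> a))"

definition encode_entry :: entry where "encode_entry s =
  (claim (fun_type Tx Nx) (lam Tx (tree_rec (\<lambda>_. Nx) zx (\<lambda>_ _ i k. sx (cantor k i))))) s"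

definition decode_entry :: entry where "decode_entry s =
  (claim (fun_type Nx Tx) (lam Nx (nat_rec (\<lambda>_. Tx) leaf (\<lambda>_ i. next_tree \<cdot> i)))) s"

definition add_zero_entry :: entry where "add_zero_entry s =
  (given Nx (\<lambda>n. claim (eq Nx (add \<cdot> n \<cdot> zx) n)
    (nat_rec (\<lambda>n. eq Nx (add \<cdot> n \<cdot> zx) n) (rfl zx) (\<lambda>n i. cong Nx sx (add \<cdot> n \<cdot> zx) i) n))) s"

definition add_suc_entry :: entry where "add_suc_entry s =
  (given Nx (\<lambda>b. given Nx (\<lambda>a. claim (eq Nx (add \<cdot> b \<cdot> sx a) (sx (add \<cdot> b \<cdot> a)))
    (nat_rec (\<lambda>b. eq Nx (add \<cdot> b \<cdot> sx a) (sx (add \<cdot> b \<cdot> a))) (rfl (sx a))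
      (\<lambda>b i. cong Nx sx (add \<cdot> b \<cdot> sx a) i) b)))) s"

definition "tree_case P f g t = tree_rec P f (\<lambda>a b _ _. g a b) t"

text \<open>The head normal form of \<open>next_tree \<cdot> y\<close> is a node in each of these cases.\<close>

definition "next_cases P R y = tree_case P (R leaf)
  (\<lambda>a b. tree_case (\<lambda>a. P (node a b)) (R (node leaf b)) (\<lambda>c d. R (node (node c d) b)) a) y"

text \<open>A successor is never \<open>leaf\<close>, so the rule for a node whose first subtree is
  a node applies. \<open>next_cases\<close> uncovers this node, after which both sides agree by
  computation.\<close>

definition next_node_entry :: entry where "next_node_entry s =
  (given Tx (\<lambda>y. given Tx (\<lambda>u. let
      r = (\<lambda>y. node (prev_tree \<cdot> (next_tree \<cdot> y)) (next_tree \<cdot> u));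
      P = (\<lambda>y. eq Tx (next_tree \<cdot> node (next_tree \<cdot> y) u) (r y))
    in claim (P y) (next_cases P (\<lambda>y. rfl (r y)) y)))) s"

definition prev_node_leaf_entry :: entry where "prev_node_leaf_entry s =
  (given Tx (\<lambda>y. let
      r = (\<lambda>y. node leaf (prev_tree \<cdot> (next_tree \<cdot> y)));
      P = (\<lambda>y. eq Tx (prev_tree \<cdot> node (next_tree \<cdot> y) leaf) (r y))
    in claim (P y) (next_cases P (\<lambda>y. rfl (r y)) y))) s"

definition prev_node_entry :: entry where "prev_node_entry s =
  (given Tx (\<lambda>x. given Tx (\<lambda>y. let
      r = (\<lambda>y. node (next_tree \<cdot> x) (prev_tree \<cdot> (next_tree \<cdot> y)));
      P = (\<lambda>y. eq Tx (prev_tree \<cdot> node x (next_tree \<cdot> y)) (r y))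
    in claim (P y) (next_cases P (\<lambda>y. rfl (r y)) y)))) s"

section \<open>Successor and predecessor of trees, and their codes\<close>

definition "PrevNext t = eq Tx (prev_tree \<cdot> (next_tree \<cdot> t)) t"
definition "NextPrev t = eq Tx (next_tree \<cdot> (prev_tree \<cdot> t)) (nonleaf \<cdot> t)"
definition "Inverse t = exo_prod (PrevNext t) (NextPrev t)"
definition "prev_next_of t p = proj1 (PrevNext t) p"
definition "next_prev_of t p = proj2 (PrevNext t) (\<lambda>_. NextPrev t) p"

text \<open>The two equations need each other on the subtrees. The hypothesis for a subtree is an
  argument of the function type in the motive of \<open>tree_case\<close>, so that splitting the
  subtree refines its hypothesis as well.\<close>

definition prev_next_entry :: entry where "prev_next_entry s =
  (given Tx (\<lambda>t. claim (Inverse t)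
    (tree_rec Inverse (pair (rfl leaf) (rfl (node leaf leaf))) (\<lambda>t u i k. pair
      (tree_case (\<lambda>t. fun_type (Inverse t) (PrevNext (node t u)))
        (lam (Inverse leaf) (\<lambda>_.
          transport (\<lambda>z. eq Tx (prev_tree \<cdot> node (next_tree \<cdot> u) leaf) (node leaf z)) (prev_next_of u k)
            (prev_node_leaf \<cdot> u)))
        (\<lambda>a b. let t = node a b; l = prev_tree \<cdot> node (prev_tree \<cdot> t) (next_tree \<cdot> u) in lam (Inverse t) (\<lambda>i.
          transport (\<lambda>z. eq Tx l (node t z)) (prev_next_of u k)
            (transport (\<lambda>z. eq Tx l (node z (prev_tree \<cdot> (next_tree \<cdot> u)))) (next_prev_of t i)
              (prev_node \<cdot> (prev_tree \<cdot> t) \<cdot> u)))) t \<cdot> i)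
      (tree_case (\<lambda>u. fun_type (Inverse u) (NextPrev (node t u)))
        (lam (Inverse leaf) (\<lambda>_. tree_case (\<lambda>t. fun_type (Inverse t) (NextPrev (node t leaf)))
          (lam (Inverse leaf) (\<lambda>_. rfl (node leaf leaf)))
          (\<lambda>a b. let t = node a b in lam (Inverse t) (\<lambda>i.
            cong Tx (\<lambda>z. node z leaf) (next_tree \<cdot> (prev_tree \<cdot> t)) (next_prev_of t i))) t \<cdot> i))
        (\<lambda>a b. let u = node a b; l = next_tree \<cdot> node (next_tree \<cdot> t) (prev_tree \<cdot> u) in lam (Inverse u) (\<lambda>k.
          transport (\<lambda>z. eq Tx l (node t z)) (next_prev_of u k)
            (transport (\<lambda>z. eq Tx l (node z (next_tree \<cdot> (prev_tree \<cdot> u)))) (prev_next_of t i)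
              (next_node \<cdot> t \<cdot> (prev_tree \<cdot> u))))) u \<cdot> k)) t))) s"

definition cantor_suc_entry :: entry where "cantor_suc_entry s =
  (given Nx (\<lambda>b. given Nx (\<lambda>a. let l = sx (cantor (sx b) a) in
    claim (eq Nx l (sx (sx (cantor b (sx a)))))
      (transport (\<lambda>w. eq Nx l (sx (sx (add \<cdot> b \<cdot> (tri \<cdot> w))))) (symm Nx (add \<cdot> b \<cdot> sx a) (add_suc \<cdot> b \<cdot> a)) (rfl l))))) s"

definition cantor_zero_entry :: entry where "cantor_zero_entry s =
  (given Nx (\<lambda>b. let l = sx (tri \<cdot> sx b) in
    claim (eq Nx l (sx (sx (cantor b zx))))
      (transport (\<lambda>w. eq Nx l (sx (sx (add \<cdot> b \<cdot> (tri \<cdot> w))))) (symm Nx (add \<cdot> b \<cdot> zx) (add_zero \<cdot> b)) (rfl l)))) s"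

definition "EncodeNext t = eq Nx (encode \<cdot> (next_tree \<cdot> t)) (sx (encode \<cdot> t))"
definition "EncodePrev t = eq Nx (encode \<cdot> (nonleaf \<cdot> t)) (sx (encode \<cdot> (prev_tree \<cdot> t)))"
definition "EncodeStep t = exo_prod (EncodeNext t) (EncodePrev t)"
definition "encode_next_sym t p = symm Nx (encode \<cdot> (next_tree \<cdot> t)) (proj1 (EncodeNext t) p)"
definition "encode_prev_sym t p = symm Nx (encode \<cdot> t) (proj2 (EncodeNext t) (\<lambda>_. EncodePrev t) p)"

text \<open>The successor of a node involves the predecessor of a subtree, hence the second
  component. A move along a diagonal is \<open>cantor_suc\<close>, a change of diagonal is
  \<open>cantor_zero\<close>.\<close>

definition encode_next_entry :: entry where "encode_next_entry s =
  (given Tx (\<lambda>t. claim (EncodeStep t)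
    (tree_rec EncodeStep (pair (rfl (sx zx)) (rfl (sx zx))) (\<lambda>t u i k. pair
      (tree_case (\<lambda>t. fun_type (EncodeStep t) (EncodeNext (node t u)))
        (lam (EncodeStep leaf) (\<lambda>_.
          transport (\<lambda>z. eq Nx (sx (tri \<cdot> z)) (sx (sx (cantor (encode \<cdot> u) zx)))) (encode_next_sym u k)
            (cantor_zero \<cdot> (encode \<cdot> u))))
        (\<lambda>a b. let t = node a b; e = encode \<cdot> (prev_tree \<cdot> t) in lam (EncodeStep t) (\<lambda>i.
          transport (\<lambda>z. eq Nx (sx (cantor z e)) (sx (sx (cantor (encode \<cdot> u) (encode \<cdot> t))))) (encode_next_sym u k)
            (transport (\<lambda>z. eq Nx (sx (cantor (sx (encode \<cdot> u)) e)) (sx (sx (cantor (encode \<cdot> u) z))))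
              (encode_prev_sym t i) (cantor_suc \<cdot> (encode \<cdot> u) \<cdot> e)))) t \<cdot> i)
      (tree_case (\<lambda>u. fun_type (EncodeStep u) (EncodePrev (node t u)))
        (lam (EncodeStep leaf) (\<lambda>_. tree_case (\<lambda>t. fun_type (EncodeStep t) (EncodePrev (node t leaf)))
          (lam (EncodeStep leaf) (\<lambda>_. rfl (sx zx)))
          (\<lambda>a b. let t = node a b; e = encode \<cdot> (prev_tree \<cdot> t) in lam (EncodeStep t) (\<lambda>i.
            transport (\<lambda>z. eq Nx (sx (tri \<cdot> z)) (sx (sx (cantor e zx)))) (encode_prev_sym t i)
              (cantor_zero \<cdot> e))) t \<cdot> i))
        (\<lambda>a b. let u = node a b; e = encode \<cdot> (prev_tree \<cdot> u) in lam (EncodeStep u) (\<lambda>k.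
          transport (\<lambda>z. eq Nx (sx (cantor (encode \<cdot> u) (encode \<cdot> t))) (sx (sx (cantor e z)))) (encode_next_sym t i)
            (transport (\<lambda>z. eq Nx (sx (cantor z (encode \<cdot> t))) (sx (sx (cantor e (sx (encode \<cdot> t))))))
              (encode_prev_sym u k) (cantor_suc \<cdot> e \<cdot> (encode \<cdot> t))))) u \<cdot> k)) t))) s"

section \<open>Encoding and decoding are inverse\<close>

definition encode_decode_entry :: entry where "encode_decode_entry s =
  (given Nx (\<lambda>n. claim (eq Nx (encode \<cdot> (decode \<cdot> n)) n)
    (nat_rec (\<lambda>n. eq Nx (encode \<cdot> (decode \<cdot> n)) n) (rfl zx)
      (\<lambda>n i. transport (\<lambda>z. eq Nx (encode \<cdot> (next_tree \<cdot> (decode \<cdot> n))) (sx z)) i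
        (proj1 (EncodeNext (decode \<cdot> n)) (encode_next \<cdot> (decode \<cdot> n)))) n))) s"

definition "Diagonal w = eq Tx (decode \<cdot> sx (tri \<cdot> w)) (node (decode \<cdot> w) leaf)"

text \<open>From the start of a diagonal, \<open>b\<close> steps lead to its \<open>b\<close>-th element; the last element of
  a diagonal is followed by the start of the next one.\<close>

definition decode_cantor_entry :: entry where "decode_cantor_entry s =
  (given Nx (\<lambda>b. let
      P = (\<lambda>b. pi Nx (\<lambda>a. fun_type (Diagonal (add \<cdot> b \<cdot> a))
        (eq Tx (decode \<cdot> sx (cantor b a)) (node (decode \<cdot> a) (decode \<cdot> b)))))
    in claim (P b) (nat_rec P
      (lam Nx (\<lambda>a. lam (Diagonal (add \<cdot> zx \<cdot> a)) (\<lambda>h. h)))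
      (\<lambda>b i. lam Nx (\<lambda>a. lam (Diagonal (add \<cdot> sx b \<cdot> a)) (\<lambda>h. let
          x = transport (\<lambda>w. eq Tx (decode \<cdot> sx (add \<cdot> b \<cdot> (tri \<cdot> w))) (node (decode \<cdot> sx a) (decode \<cdot> b)))
            (add_suc \<cdot> b \<cdot> a)
            (i \<cdot> sx a \<cdot> transport Diagonal (symm Nx (add \<cdot> b \<cdot> sx a) (add_suc \<cdot> b \<cdot> a)) h);
          l = decode \<cdot> sx (add \<cdot> b \<cdot> (tri \<cdot> sx (add \<cdot> b \<cdot> a)));
          x' = decode \<cdot> a;
          y' = decode \<cdot> b
        in transport (\<lambda>z. eq Tx (next_tree \<cdot> z) (node x' (next_tree \<cdot> y'))) (symm Tx l x)
          (transport (\<lambda>z. eq Tx (next_tree \<cdot> node (next_tree \<cdot> x') y') (node z (next_tree \<cdot> y')))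
            (prev_next_of x' (prev_next \<cdot> x')) (next_node \<cdot> x' \<cdot> y'))))) b))) s"

text \<open>\<open>decode_cantor\<close> has the start of its diagonal as a hypothesis for the sake
  of this induction: it leads from the start of diagonal \<open>s\<close> to its last pair
  \<open>(0, s)\<close>, whose successor starts the next diagonal.\<close>

definition decode_diagonal_entry :: entry where "decode_diagonal_entry s =
  (given Nx (\<lambda>s. claim (Diagonal s) (nat_rec Diagonal (rfl (node leaf leaf)) (\<lambda>s i. let
      x = decode_cantor \<cdot> s \<cdot> zx \<cdot> transport Diagonal (symm Nx (add \<cdot> s \<cdot> zx) (add_zero \<cdot> s)) i;
      y = transport (\<lambda>w. eq Tx (decode \<cdot> sx (add \<cdot> s \<cdot> (tri \<cdot> w))) (node leaf (decode \<cdot> s))) (add_zero \<cdot> s) x;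
      r = node (next_tree \<cdot> (decode \<cdot> s)) leaf
    in transport (\<lambda>z. eq Tx (next_tree \<cdot> z) r) (symm Tx (decode \<cdot> sx (add \<cdot> s \<cdot> (tri \<cdot> s))) y) (rfl r)) s))) s"

definition decode_encode_entry :: entry where "decode_encode_entry s =
  (given Tx (\<lambda>t. claim (eq Tx (decode \<cdot> (encode \<cdot> t)) t)
    (tree_rec (\<lambda>t. eq Tx (decode \<cdot> (encode \<cdot> t)) t) (rfl leaf) (\<lambda>t u i k. let
        m = encode \<cdot> t; n = encode \<cdot> u; l = decode \<cdot> sx (cantor n m)
      in transport (\<lambda>z. eq Tx l (node t z)) k (transport (\<lambda>z. eq Tx l (node z (decode \<cdot> n))) i
        (decode_cantor \<cdot> n \<cdot> m \<cdot> (decode_diagonal \<cdot> (add \<cdot> n \<cdot> m))))) t))) s"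


section \<open>Cofibrancy\<close>

definition "idx A = lam A (\<lambda>x. x)"
definition "idi A = ilam A (\<lambda>x. x)"
definition "compose A g f = lam A (\<lambda>x. g \<cdot> (f \<cdot> x))"

definition "contractible A = isig A (\<lambda>x. ipi A (\<lambda>y. ieq A x y))"

definition "exo_isos A B = sig (fun_type A B) (\<lambda>f. sig (fun_type B A) (\<lambda>g.
  exo_prod (eq (fun_type B B) (compose B f g) (idx B)) (eq (fun_type A A) (compose A g f) (idx A))))"

definition "fibrant A = sig Ui (\<lambda>R. exo_isos A R)"

definition "match_of w = sig_rec (\<lambda>_. Ui) (\<lambda>R _. R) w"

definition "into_match A w = sig_rec (\<lambda>w. fun_type A (match_of w))
  (\<lambda>R p. sig_rec (\<lambda>_. fun_type A R) (\<lambda>f _. f) p) w"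

definition "out_of_match A w = sig_rec (\<lambda>w. fun_type (match_of w) A)
  (\<lambda>R p. sig_rec (\<lambda>_. fun_type R A) (\<lambda>_ q. sig_rec (\<lambda>_. fun_type R A) (\<lambda>g _. g) q) p) w"

definition "family_pi A Y = pi A (\<lambda>a. Y \<cdot> a)"

definition "contractible_pi A Y w =
  fun_type (pi A (\<lambda>a. contractible (Y \<cdot> a))) (contractible (match_of w))"

definition "cofibrant A = pi (fun_type A Ui) (\<lambda>Y. sig (fibrant (family_pi A Y)) (contractible_pi A Y))"

definition "pi_fibrant A c Y = sig_rec (\<lambda>_. fibrant (family_pi A Y)) (\<lambda>w _. w) (c \<cdot> Y)"
definition "pi_contractible A c Y = proj2 (fibrant (family_pi A Y)) (contractible_pi A Y) (c \<cdot> Y)"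

section \<open>Transports and the round trips through a fibrant match\<close>

text \<open>By uniqueness of identity proofs it does not matter along which equality one transports.\<close>

definition transp_coherence_entry :: entry where "transp_coherence_entry s =
  (given Ux (\<lambda>A. given Ux (\<lambda>B. given (fun_type A B) (\<lambda>k. given (fun_type B Ui) (\<lambda>Y.
    given (pi A (\<lambda>a. Y \<cdot> (k \<cdot> a))) (\<lambda>v. given A (\<lambda>a. given A (\<lambda>b. given (eq A a b) (\<lambda>q.
    given (eq B (k \<cdot> a) (k \<cdot> b)) (\<lambda>p. let
      G = (\<lambda>b p. eq (Y \<cdot> (k \<cdot> b)) (transport (\<lambda>y. Y \<cdot> y) p (v \<cdot> a)) (v \<cdot> b))
    in claim (G b p)
      (path_rec (\<lambda>b q. pi (eq B (k \<cdot> a) (k \<cdot> b)) (\<lambda>p. G b p))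
        (lam (eq B (k \<cdot> a) (k \<cdot> a)) (\<lambda>p. path_rec (\<lambda>p _. G a p) (rfl (v \<cdot> a)) (uip (rfl (k \<cdot> a)) p))) q \<cdot> p))))))))))) s"

definition transp_apply_entry :: entry where "transp_apply_entry s =
  (given Ux (\<lambda>B. given (fun_type B Ui) (\<lambda>Y. given (family_pi B Y) (\<lambda>u.
    given B (\<lambda>a. given B (\<lambda>b. given (eq B a b) (\<lambda>q. let
      G = (\<lambda>b q. eq (Y \<cdot> b) (transport (\<lambda>y. Y \<cdot> y) q (u \<cdot> a)) (u \<cdot> b))
    in claim (G b q) (path_rec G (rfl (u \<cdot> a)) q)))))))) s"

text \<open>\<open>into_match\<close> and \<open>out_of_match\<close> compute only on tuples. So
  \<open>w\<close> is split one component at a time, and the local maps spell out what the two have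
  become after each split.\<close>

definition into_out_entry :: entry where "into_out_entry s =
  (given Ux (\<lambda>X. given (fibrant X) (\<lambda>w. let
      P = (\<lambda>w. pi (match_of w) (\<lambda>x. eq (match_of w) (into_match X w \<cdot> (out_of_match X w \<cdot> x)) x))
    in claim (P w)
      (sig_rec P (\<lambda>R p. let
        fst_map = (\<lambda>p. sig_rec (\<lambda>_. fun_type X R) (\<lambda>f _. f) p);
        snd_map = (\<lambda>q. sig_rec (\<lambda>_. fun_type R X) (\<lambda>g _. g) q);
        snd_map' = (\<lambda>p. sig_rec (\<lambda>_. fun_type R X) (\<lambda>_ q. snd_map q) p)
      in sig_rec (\<lambda>p. pi R (\<lambda>x. eq R (fst_map p \<cdot> (snd_map' p \<cdot> x)) x))
        (\<lambda>f q. sig_rec (\<lambda>q. pi R (\<lambda>x. eq R (f \<cdot> (snd_map q \<cdot> x)) x))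
          (\<lambda>g e. sig_rec (\<lambda>_. pi R (\<lambda>x. eq R (f \<cdot> (g \<cdot> x)) x))
            (\<lambda>e1 e2. lam R (\<lambda>x. cong R (\<lambda>h. h \<cdot> x) (compose R f g) e1)) e) q) p) w)))) s"

definition out_into_entry :: entry where "out_into_entry s =
  (given Ux (\<lambda>X. given (fibrant X) (\<lambda>w. let
      P = (\<lambda>w. pi X (\<lambda>x. eq X (out_of_match X w \<cdot> (into_match X w \<cdot> x)) x))
    in claim (P w)
      (sig_rec P (\<lambda>R p. let
        fst_map = (\<lambda>p. sig_rec (\<lambda>_. fun_type X R) (\<lambda>f _. f) p);
        snd_map = (\<lambda>q. sig_rec (\<lambda>_. fun_type R X) (\<lambda>g _. g) q);
        snd_map' = (\<lambda>p. sig_rec (\<lambda>_. fun_type R X) (\<lambda>_ q. snd_map q) p)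
      in sig_rec (\<lambda>p. pi X (\<lambda>x. eq X (snd_map' p \<cdot> (fst_map p \<cdot> x)) x))
        (\<lambda>f q. sig_rec (\<lambda>q. pi X (\<lambda>x. eq X (snd_map q \<cdot> (f \<cdot> x)) x))
          (\<lambda>g e. sig_rec (\<lambda>_. pi X (\<lambda>x. eq X (g \<cdot> (f \<cdot> x)) x))
            (\<lambda>e1 e2. lam X (\<lambda>x. cong X (\<lambda>h. h \<cdot> x) (compose X g f) e2)) e) q) p) w)))) s"

definition singleton_contr_entry :: entry where "singleton_contr_entry s =
  (given Ui (\<lambda>A. given A (\<lambda>a. let S = isig A (\<lambda>y. ieq A a y); z = ipair a (irfl a) in
    claim (contractible S)
      (ipair z (ilam S (isig_rec (\<lambda>q. ieq S z q) (\<lambda>y p. ipath_rec (\<lambda>y p. ieq S z (ipair y p)) (irfl z) p))))))) s"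

definition contr_path_entry :: entry where "contr_path_entry s =
  (given Ui (\<lambda>A. given (contractible A) (\<lambda>c. given A (\<lambda>x. given A (\<lambda>y. claim (ieq A x y) (let
      h = iproj2 A (\<lambda>x. ipi A (\<lambda>y. ieq A x y)) c
    in itrans A x (isym A (iproj1 A c) (h \<bullet> x)) (h \<bullet> y))))))) s"

text \<open>Function extensionality for exo-functions on a cofibrant exo-type with respect to the inner
  equality: the family of singletons \<open>\<Sum>(y : Y a). u a = y\<close> has a contractible product, in which
  \<open>u\<close> and \<open>v\<close> give two elements.\<close>

definition match_ext_entry :: entry where "match_ext_entry s =
  (given Ux (\<lambda>A. given (cofibrant A) (\<lambda>c. given (fun_type A Ui) (\<lambda>Y. given (family_pi A Y) (\<lambda>u.
    given (family_pi A Y) (\<lambda>v. given (pi A (\<lambda>a. ieq (Y \<cdot> a) (u \<cdot> a) (v \<cdot> a))) (\<lambda>h. let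
      w = pi_fibrant A c Y; into_Y = into_match (family_pi A Y) w;
      Z = lam A (\<lambda>a. isig (Y \<cdot> a) (\<lambda>y. ieq (Y \<cdot> a) (u \<cdot> a) y)); z = pi_fibrant A c Z;
      into_Z = into_match (family_pi A Z) z; out_Z = out_of_match (family_pi A Z) z;
      ctr = pi_contractible A c Z \<cdot> lam A (\<lambda>a. singleton_contr \<cdot> (Y \<cdot> a) \<cdot> (u \<cdot> a));
      zu = lam A (\<lambda>a. ipair (u \<cdot> a) (irfl (u \<cdot> a))); zv = lam A (\<lambda>a. ipair (v \<cdot> a) (h \<cdot> a));
      m = (\<lambda>k. into_Y \<cdot> lam A (\<lambda>a. iproj1 (Y \<cdot> a) (k \<cdot> a)));
      p = icong (match_of w) (\<lambda>z. m (out_Z \<cdot> z)) (into_Z \<cdot> zu)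
        (contr_path \<cdot> match_of z \<cdot> ctr \<cdot> (into_Z \<cdot> zu) \<cdot> (into_Z \<cdot> zv));
      g = out_into \<cdot> family_pi A Z \<cdot> z
    in claim (ieq (match_of w) (into_Y \<cdot> u) (into_Y \<cdot> v))
      (transport (\<lambda>k. ieq (match_of w) (into_Y \<cdot> u) (m k)) (g \<cdot> zv)
        (transport (\<lambda>k. ieq (match_of w) (m k) (m (out_Z \<cdot> (into_Z \<cdot> zv)))) (g \<cdot> zu) p))))))))) s"

text \<open>The product over trees receives the match \<open>M\<close> of the family reindexed by
  \<open>decode\<close>, so its contractibility is that given by \<open>c\<close>. Going back
  reindexes by \<open>encode\<close> and transports along \<open>decode_encode\<close>. At
  \<open>decode \<cdot> n\<close> this transport must agree with the path
  \<open>encode_decode \<cdot> n\<close>, which is \<open>transp_coherence\<close>.\<close>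

definition tree_cofibrant_entry :: entry where "tree_cofibrant_entry s =
  (given (cofibrant Nx) (\<lambda>c. claim (cofibrant Tx) (lam (fun_type Tx Ui) (\<lambda>Y. let
      Z = lam Nx (\<lambda>n. Y \<cdot> (decode \<cdot> n)); w = pi_fibrant Nx c Z; X = family_pi Nx Z;
      M = match_of w; F = into_match X w; G = out_of_match X w;
      tr = (\<lambda>t x. transport (\<lambda>s. Y \<cdot> s) (decode_encode \<cdot> t) x);
      f = lam (family_pi Tx Y) (\<lambda>u. F \<cdot> lam Nx (\<lambda>n. u \<cdot> (decode \<cdot> n)));
      g = lam M (\<lambda>x. lam Tx (\<lambda>t. tr t (G \<cdot> x \<cdot> (encode \<cdot> t))));
      fg = exo_funext (compose M f g) (idx M) (lam M (\<lambda>x. let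
          l = lam Nx (\<lambda>n. tr (decode \<cdot> n) (G \<cdot> x \<cdot> (encode \<cdot> (decode \<cdot> n))))
        in transport (\<lambda>k. eq M (F \<cdot> l) k) (into_out \<cdot> X \<cdot> w \<cdot> x)
          (cong M (\<lambda>k. F \<cdot> k) l (exo_funext l (G \<cdot> x) (lam Nx (\<lambda>n.
            transp_coherence \<cdot> Nx \<cdot> Tx \<cdot> decode \<cdot> Y \<cdot> (G \<cdot> x) \<cdot> (encode \<cdot> (decode \<cdot> n)) \<cdot> n \<cdot> (encode_decode \<cdot> n) \<cdot>
              (decode_encode \<cdot> (decode \<cdot> n))))))));
      gf = compose (family_pi Tx Y) g f;
      gf_id = exo_funext gf (idx (family_pi Tx Y)) (lam (family_pi Tx Y) (\<lambda>u.
        exo_funext (gf \<cdot> u) u (lam Tx (\<lambda>t. let l = lam Nx (\<lambda>n. u \<cdot> (decode \<cdot> n)) in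
          transport (\<lambda>k. eq (Y \<cdot> t) (tr t (k \<cdot> (encode \<cdot> t))) (u \<cdot> t))
            (symm X (G \<cdot> (F \<cdot> l)) (out_into \<cdot> X \<cdot> w \<cdot> l))
            (transp_apply \<cdot> Tx \<cdot> Y \<cdot> u \<cdot> (decode \<cdot> (encode \<cdot> t)) \<cdot> t \<cdot> (decode_encode \<cdot> t))))))
    in pair (pair M (pair f (pair g (pair fg gf_id))))
      (lam (pi Tx (\<lambda>t. contractible (Y \<cdot> t))) (\<lambda>h.
        pi_contractible Nx c Z \<cdot> lam Nx (\<lambda>n. h \<cdot> (decode \<cdot> n)))))))) s"


section \<open>Inner function extensionality from univalence\<close>

definition "equivalence A B f = inner_prod
  (isig (ifun_type B A) (\<lambda>g. ipi B (\<lambda>b. ieq B (f \<bullet> (g \<bullet> b)) b)))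
  (isig (ifun_type B A) (\<lambda>g. ipi A (\<lambda>a. ieq A (g \<bullet> (f \<bullet> a)) a)))"

definition "equivalences A B = isig (ifun_type A B) (\<lambda>f. equivalence A B f)"

definition "id_equivalence A = ipair (idi A)
  (ipair (ipair (idi A) (ilam A (\<lambda>x. irfl x))) (ipair (idi A) (ilam A (\<lambda>x. irfl x))))"

definition "path_to_equivalence A B =
  ilam (ieq Ui A B) (\<lambda>p. ipath_rec (\<lambda>X _. equivalences A X) (id_equivalence A) p)"

text \<open>Univalence is a hypothesis of the terms below; it is discharged at the end.\<close>

definition "ua_type = pi Ui (\<lambda>A. pi Ui (\<lambda>B.
  equivalence (ieq Ui A B) (equivalences A B) (path_to_equivalence A B)))"

text \<open>The paths end at the fixed point, while in \<open>singleton_contr\<close> they start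
  there. Path induction therefore varies the end \<open>z\<close>, and with it the centre of
  \<open>S z\<close>.\<close>

definition singleton_path_entry :: entry where "singleton_path_entry s =
  (given Ui (\<lambda>B. given B (\<lambda>b. let
      S = (\<lambda>z. isig B (\<lambda>k. ieq B k z));
      hub = (\<lambda>x. isig_rec (\<lambda>x. ieq (S b) (ipair b (irfl b)) x)
        (\<lambda>k p. ipath_rec (\<lambda>z p. ieq (S z) (ipair z (irfl z)) (ipair k p)) (irfl (ipair k (irfl k))) p) x)
    in given (S b) (\<lambda>x. given (S b) (\<lambda>y. claim (ieq (S b) x y)
      (itrans (S b) x (isym (S b) (ann (S b) (ipair b (irfl b))) (hub x)) (hub y))))))) s"

text \<open>The type \<open>\<Sum>(k : X \<rightarrow> A). e \<circ> k = id\<close> of sections of \<open>e : A \<simeq> X\<close> has at most one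
  element, since this is true if \<open>e\<close> is the identity.\<close>

definition "sections A X e = isig (ifun_type X A) (\<lambda>k.
  ieq (ifun_type X X) (ilam X (\<lambda>x. iproj1 (ifun_type A X) e \<bullet> (k \<bullet> x))) (idi X))"

definition "paths S = ipi S (\<lambda>x. ipi S (\<lambda>y. ieq S x y))"

text \<open>On reflexivity the equivalence computes to the identity, and the composite with
  \<open>k\<close> is \<open>k\<close> by beta and eta. A section is then a map with a path to
  \<open>idi A\<close>, an element of a singleton.\<close>

definition sections_id_entry :: entry where "sections_id_entry s =
  (given Ui (\<lambda>A. given Ui (\<lambda>X. given (ieq Ui A X) (\<lambda>p. let
      S = (\<lambda>X p. sections A X (path_to_equivalence A X \<bullet> p))
    in claim (paths (S X p))
      (ipath_rec (\<lambda>X p. paths (S X p)) (ilam (S A (irfl A)) (\<lambda>x. ilam (S A (irfl A)) (\<lambda>y.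
        singleton_path \<cdot> ifun_type A A \<cdot> idi A \<cdot> x \<cdot> y))) p))))) s"

text \<open>By univalence \<open>e\<close> equals the equivalence induced by the path
  \<open>g \<bullet> e\<close>, and uniqueness of sections is transported along this
  equality.\<close>

definition sections_equiv_entry :: entry where "sections_equiv_entry s =
  (given ua_type (\<lambda>ua. given Ui (\<lambda>A. given Ui (\<lambda>X. given (equivalences A X) (\<lambda>e.
    claim (paths (sections A X e)) (let
      f = path_to_equivalence A X; P = ieq Ui A X; Q = equivalences A X;
      I = (\<lambda>g. ipi Q (\<lambda>b. ieq Q (f \<bullet> (g \<bullet> b)) b));
      r = iproj1 (isig (ifun_type Q P) I) (ua \<cdot> A \<cdot> X);
      g = iproj1 (ifun_type Q P) r; h = iproj2 (ifun_type Q P) I r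
    in itransp (\<lambda>e. paths (sections A X e)) (h \<bullet> e) (sections_id \<cdot> A \<cdot> X \<cdot> (g \<bullet> e)))))))) s"

text \<open>A homotopy \<open>h\<close> from \<open>f\<close> to \<open>g\<close> and the constant homotopy at \<open>f\<close> are sections of the
  equivalence \<open>(\<Sum>(x : A). \<Sum>(y : Y x). f x = y) \<simeq> A\<close>, hence equal.\<close>

definition inner_funext_entry :: entry where "inner_funext_entry s =
  (given ua_type (\<lambda>ua. given Ui (\<lambda>A. given (ifun_type A Ui) (\<lambda>Y. let D = ipi A (\<lambda>x. Y \<bullet> x) in
    given D (\<lambda>f. given D (\<lambda>g. given (ipi A (\<lambda>x. ieq (Y \<bullet> x) (f \<bullet> x) (g \<bullet> x))) (\<lambda>h. claim (ieq D f g) (let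
      P = (\<lambda>x. isig (Y \<bullet> x) (\<lambda>y. ieq (Y \<bullet> x) (f \<bullet> x) y)); X = isig A P;
      c = (\<lambda>x. ipair x (ipair (f \<bullet> x) (irfl (f \<bullet> x)))); i = ilam A c;
      e = ann (equivalences X A) (ipair (ilam X (\<lambda>z. iproj1 A z))
        (ipair (ipair i (ilam A (\<lambda>a. irfl a)))
          (ipair i (ilam X (\<lambda>z. isig_rec (\<lambda>z. ieq X (c (iproj1 A z)) z)
            (\<lambda>a w. isig_rec (\<lambda>w. ieq X (c a) (ipair a w))
              (\<lambda>y q. ipath_rec (\<lambda>y q. ieq X (c a) (ipair a (ipair y q))) (irfl (c a)) q) w) z)))));
      q = sections_equiv \<cdot> ua \<cdot> X \<cdot> A \<cdot> e \<bullet> ipair i (irfl (idi A)) \<bullet>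
        ipair (ilam A (\<lambda>x. ipair x (ipair (g \<bullet> x) (h \<bullet> x)))) (irfl (idi A));
      comp = (\<lambda>k. ilam A (\<lambda>x. iproj1 (ifun_type X A) e \<bullet> (k \<bullet> x)));
      eval = (\<lambda>s. ilam A (\<lambda>x. let
          k = iproj1 (ifun_type A X) s;
          p = iproj2 (ifun_type A X) (\<lambda>k. ieq (ifun_type A A) (comp k) (idi A)) s
        in itransp (\<lambda>a. Y \<bullet> a) (icong A (\<lambda>m. m \<bullet> x) (comp k) p)
          (iproj1 (Y \<bullet> (iproj1 A (k \<bullet> x))) (iproj2 A P (k \<bullet> x)))))
    in ipath_rec (\<lambda>y _. ieq D f (eval y)) (irfl f) q)))))))) s"


section \<open>Sharpness\<close>

definition nat_to_inner_entry :: entry where "nat_to_inner_entry s =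
  (claim (fun_type Nx Ni) (lam Nx (nat_rec (\<lambda>_. Ni) zi (\<lambda>_ i. si i)))) s"

definition tree_to_inner_entry :: entry where "tree_to_inner_entry s =
  (claim (fun_type Tx Ni) (lam Tx (\<lambda>t. nat_to_inner \<cdot> (encode \<cdot> t)))) s"

definition "nat_family Z = lam Nx (\<lambda>n. Z \<bullet> (nat_to_inner \<cdot> n))"
definition "nat_fibrant c Z = pi_fibrant Nx c (nat_family Z)"
definition "nat_match c Z = match_of (nat_fibrant c Z)"
definition "nat_pi Z = family_pi Nx (nat_family Z)"
definition "nat_into c Z = into_match (nat_pi Z) (nat_fibrant c Z)"
definition "nat_out c Z = out_of_match (nat_pi Z) (nat_fibrant c Z)"
definition "nat_out_into c Z k = out_into \<cdot> nat_pi Z \<cdot> nat_fibrant c Z \<cdot> k"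
definition "inner_pi Z = ipi Ni (\<lambda>k. Z \<bullet> k)"
definition "restrict u = lam Nx (\<lambda>n. u \<bullet> (nat_to_inner \<cdot> n))"
definition "shift_family Z = ilam Ni (\<lambda>m. Z \<bullet> si m)"
definition "tail c Z w = nat_into c (shift_family Z) \<cdot> lam Nx (\<lambda>n. nat_out c Z \<cdot> w \<cdot> sx n)"
definition "Fam = ifun_type Ni Ui"

text \<open>The \<open>k\<close>-th value of the inner function extending \<open>w : \<Prod>(n : \<nat>\<^sup>e). Z n\<close> is the head of the
  \<open>k\<close>-th tail of \<open>w\<close>.  The recursion on the inner number \<open>k\<close> is possible because the tails live in
  the fibrant matches, and it is uniform in \<open>Z\<close> because taking a tail shifts \<open>Z\<close>.\<close>

definition extend_entry :: entry where "extend_entry s =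
  (given (cofibrant Nx) (\<lambda>c. let
      P = (\<lambda>k. ipi Fam (\<lambda>Z. ifun_type (nat_match c Z) (Z \<bullet> k)))
    in claim (ipi Ni P) (ilam Ni (inat_rec P
      (ilam Fam (\<lambda>Z. ilam (nat_match c Z) (\<lambda>w. nat_out c Z \<cdot> w \<cdot> zx)))
      (\<lambda>k i. ilam Fam (\<lambda>Z. ilam (nat_match c Z) (\<lambda>w. i \<bullet> shift_family Z \<bullet> tail c Z w))))))) s"

text \<open>The motive must be a type, so its products are inner, and the exo-equality
  \<open>undo\<close> only transports between inner equations. The step uses the claim for the
  shifted family: the tail of a restriction is the restriction of the shifted function by
  computation.\<close>

definition extend_restrict_entry :: entry where "extend_restrict_entry s =
  (given (cofibrant Nx) (\<lambda>c. given Ni (\<lambda>k. let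
      P = (\<lambda>k. ipi Fam (\<lambda>Z. ipi (inner_pi Z) (\<lambda>u.
        ieq (Z \<bullet> k) (extend \<cdot> c \<bullet> k \<bullet> Z \<bullet> (nat_into c Z \<cdot> restrict u)) (u \<bullet> k))));
      undo = (\<lambda>Z u. symm (nat_pi Z) (nat_out c Z \<cdot> (nat_into c Z \<cdot> restrict u)) (nat_out_into c Z (restrict u)))
    in claim (P k) (inat_rec P
      (ilam Fam (\<lambda>Z. ilam (inner_pi Z) (\<lambda>u.
        transport (\<lambda>q. ieq (Z \<bullet> zi) (q \<cdot> zx) (u \<bullet> zi)) (undo Z u) (irfl (u \<bullet> zi)))))
      (\<lambda>k i. ilam Fam (\<lambda>Z. ilam (inner_pi Z) (\<lambda>u. let Z' = shift_family Z in
        transport (\<lambda>q. ieq (Z \<bullet> si k) (extend \<cdot> c \<bullet> k \<bullet> Z' \<bullet> (nat_into c Z' \<cdot> lam Nx (\<lambda>n. q \<cdot> sx n))) (u \<bullet> si k))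
          (undo Z u) (i \<bullet> Z' \<bullet> ilam Ni (\<lambda>m. u \<bullet> si m))))) k)))) s"

text \<open>On the image of an exo-number the recursion of \<open>extend\<close> unfolds along that
  exo-number. The induction thus takes place at the exo-level, where exo-products are allowed in the
  motive.\<close>

definition restrict_extend_entry :: entry where "restrict_extend_entry s =
  (given (cofibrant Nx) (\<lambda>c. given Nx (\<lambda>n. let
      r = (\<lambda>n. nat_to_inner \<cdot> n);
      P = (\<lambda>n. pi Fam (\<lambda>Z. pi (nat_match c Z) (\<lambda>w.
        ieq (Z \<bullet> r n) (extend \<cdot> c \<bullet> r n \<bullet> Z \<bullet> w) (nat_out c Z \<cdot> w \<cdot> n))))
    in claim (P n) (nat_rec P
      (lam Fam (\<lambda>Z. lam (nat_match c Z) (\<lambda>w. irfl (nat_out c Z \<cdot> w \<cdot> zx))))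
      (\<lambda>n i. lam Fam (\<lambda>Z. lam (nat_match c Z) (\<lambda>w. let Z' = shift_family Z; w' = tail c Z w in
        transport (\<lambda>q. ieq (Z \<bullet> si (r n)) (extend \<cdot> c \<bullet> r n \<bullet> Z' \<bullet> w') (q \<cdot> n))
          (nat_out_into c Z' (lam Nx (\<lambda>n. nat_out c Z \<cdot> w \<cdot> sx n))) (i \<cdot> Z' \<cdot> w')))) n)))) s"

section \<open>From numbers to trees\<close>

definition "tree_family Y = lam Tx (\<lambda>t. Y \<bullet> (tree_to_inner \<cdot> t))"
definition "tree_fibrant b Y = pi_fibrant Tx b (tree_family Y)"
definition "tree_match b Y = match_of (tree_fibrant b Y)"
definition "tree_pi Y = family_pi Tx (tree_family Y)"
definition "tree_into b Y = into_match (tree_pi Y) (tree_fibrant b Y)"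
definition "tree_out b Y = out_of_match (tree_pi Y) (tree_fibrant b Y)"

text \<open>The value of \<open>q\<close> at \<open>decode \<cdot> n\<close> lies over the inner
  image of \<open>encode \<cdot> (decode \<cdot> n)\<close>, hence the transport.\<close>

definition "along_decode Y q = lam Nx (\<lambda>n.
  transport (\<lambda>m. Y \<bullet> (nat_to_inner \<cdot> m)) (encode_decode \<cdot> n) (q \<cdot> (decode \<cdot> n)))"

definition "given_family f = given (cofibrant Nx) (\<lambda>c. given (cofibrant Tx) (\<lambda>b. given Fam (\<lambda>Y. f c b Y)))"

definition tree_extend_entry :: entry where "tree_extend_entry s =
  (given_family (\<lambda>c b Y. claim (ifun_type (tree_match b Y) (inner_pi Y))
    (ilam (tree_match b Y) (\<lambda>x. ilam Ni (\<lambda>k.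
      extend \<cdot> c \<bullet> k \<bullet> Y \<bullet> (nat_into c Y \<cdot> along_decode Y (tree_out b Y \<cdot> x))))))) s"

text \<open>At \<open>t\<close> the extension yields the value of \<open>y\<close> at
  \<open>decode \<cdot> (encode \<cdot> t)\<close>, transported along \<open>encode_decode\<close>;
  by \<open>transp_coherence\<close> this is the value at \<open>t\<close>. \<open>match_ext\<close>
  turns these pointwise inner equalities into one in the match.\<close>

definition tree_restrict_extend_entry :: entry where "tree_restrict_extend_entry s =
  (given_family (\<lambda>c b Y. given (tree_match b Y) (\<lambda>x. let
      u = lam Tx (\<lambda>t. tree_extend \<cdot> c \<cdot> b \<cdot> Y \<bullet> x \<bullet> (tree_to_inner \<cdot> t)); y = tree_out b Y \<cdot> x
    in claim (ieq (tree_match b Y) (tree_into b Y \<cdot> u) x)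
      (transport (\<lambda>q. ieq (tree_match b Y) (tree_into b Y \<cdot> u) q) (into_out \<cdot> tree_pi Y \<cdot> tree_fibrant b Y \<cdot> x)
        (match_ext \<cdot> Tx \<cdot> b \<cdot> tree_family Y \<cdot> u \<cdot> y \<cdot> lam Tx (\<lambda>t. let
            K = along_decode Y y; n = encode \<cdot> t; m = nat_to_inner \<cdot> n; w = nat_into c Y \<cdot> K;
            G = (\<lambda>z. ieq (Y \<bullet> m) (extend \<cdot> c \<bullet> m \<bullet> Y \<bullet> w) z)
          in transport G (transp_coherence \<cdot> Tx \<cdot> Nx \<cdot> encode \<cdot> nat_family Y \<cdot> y \<cdot> (decode \<cdot> n) \<cdot> t \<cdot>
              (decode_encode \<cdot> t) \<cdot> (encode_decode \<cdot> n))
            (transport (\<lambda>q. G (q \<cdot> n)) (nat_out_into c Y K) (restrict_extend \<cdot> c \<cdot> n \<cdot> Y \<cdot> w)))))))) s"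

text \<open>Two exo-equalities of exo-functions reduce the claim at \<open>k\<close> to
  \<open>extend_restrict\<close>: the match is undone, and the transports in \<open>K\<close> are
  absorbed because \<open>restrict u\<close> is defined on all numbers. Univalence enters through
  \<open>inner_funext\<close>, since the conclusion equates inner functions.\<close>

definition tree_extend_restrict_entry :: entry where "tree_extend_restrict_entry s =
  (given ua_type (\<lambda>ua. given_family (\<lambda>c b Y. given (inner_pi Y) (\<lambda>u. let
      L = lam Tx (\<lambda>t. u \<bullet> (tree_to_inner \<cdot> t)); x = tree_into b Y \<cdot> L; y = tree_extend \<cdot> c \<cdot> b \<cdot> Y \<bullet> x;
      K = along_decode Y L
    in claim (ieq (inner_pi Y) y u)
      (inner_funext \<cdot> ua \<cdot> Ni \<cdot> Y \<cdot> y \<cdot> u \<cdot> ilam Ni (\<lambda>k. let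
          G = (\<lambda>q. ieq (Y \<bullet> k) (extend \<cdot> c \<bullet> k \<bullet> Y \<bullet> (nat_into c Y \<cdot> q)) (u \<bullet> k))
        in transport (\<lambda>q. G (along_decode Y q))
          (symm (tree_pi Y) (tree_out b Y \<cdot> x) (out_into \<cdot> tree_pi Y \<cdot> tree_fibrant b Y \<cdot> L))
          (transport G (symm (nat_pi Y) K (exo_funext K (restrict u) (lam Nx (\<lambda>n.
              transp_apply \<cdot> Nx \<cdot> nat_family Y \<cdot> restrict u \<cdot> (encode \<cdot> (decode \<cdot> n)) \<cdot> n \<cdot> (encode_decode \<cdot> n)))))
            (extend_restrict \<cdot> c \<cdot> k \<bullet> Y \<bullet> u)))))))) s"

text \<open>The annotation lets a split infer the type of this tuple. It is erased by
  \<open>tm_of\<close>, which leaves \<open>type_fibrant\<close>.\<close>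

definition "self_fibrant D =
  ann (fibrant D) (pair D (pair (idx D) (pair (idx D) (pair (rfl (idx D)) (rfl (idx D))))))"

definition "fibrant_equivalence A B v w f = equivalence (match_of v) (match_of w)
  (ilam (match_of v) (\<lambda>x. into_match B w \<cdot> (f \<cdot> (out_of_match A v \<cdot> x))))"

definition "restriction_equivalence A c R r Y = (let D = ipi R (\<lambda>x. Y \<bullet> x) in
  fibrant_equivalence D (pi A (\<lambda>a. Y \<bullet> (r \<cdot> a))) (self_fibrant D) (pi_fibrant A c (lam A (\<lambda>a. Y \<bullet> (r \<cdot> a))))
    (lam D (\<lambda>u. lam A (\<lambda>a. u \<bullet> (r \<cdot> a)))))"

definition "sharp A = sig (cofibrant A) (\<lambda>c. sig Ui (\<lambda>R. sig (fun_type A R) (\<lambda>r.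
  pi (ifun_type R Ui) (\<lambda>Y. restriction_equivalence A c R r Y))))"

definition tree_restrict_equiv_entry :: entry where "tree_restrict_equiv_entry s =
  (given ua_type (\<lambda>ua. given_family (\<lambda>c b Y.
    claim (restriction_equivalence Tx b Ni tree_to_inner Y) (let e = tree_extend \<cdot> c \<cdot> b \<cdot> Y in
      ipair (ipair e (ilam (tree_match b Y) (\<lambda>x. tree_restrict_extend \<cdot> c \<cdot> b \<cdot> Y \<cdot> x)))
        (ipair e (ilam (inner_pi Y) (\<lambda>u. tree_extend_restrict \<cdot> ua \<cdot> c \<cdot> b \<cdot> Y \<cdot> u))))))) s"

definition main_entry :: entry where "main_entry s =
  (given ua_type (\<lambda>ua. claim (fun_type (cofibrant Nx) (exo_prod (cofibrant Tx) (sharp Tx)))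
    (lam (cofibrant Nx) (\<lambda>c. let b = tree_cofibrant \<cdot> c in
      pair b (pair b (pair Ni (pair tree_to_inner (lam Fam (\<lambda>Y. tree_restrict_equiv \<cdot> ua \<cdot> c \<cdot> b \<cdot> Y))))))))) s"
section \<open>The signature\<close>

definition entries :: "entry list" where
  "entries = [add_entry, tri_entry, next_prev_entry, next_tree_entry, prev_tree_entry, nonleaf_entry,
    encode_entry, decode_entry, add_zero_entry, add_suc_entry, next_node_entry,
    prev_node_leaf_entry, prev_node_entry, prev_next_entry, cantor_suc_entry, cantor_zero_entry,
    encode_next_entry, encode_decode_entry, decode_cantor_entry, decode_diagonal_entry,
    decode_encode_entry, transp_coherence_entry, transp_apply_entry, into_out_entry,
    out_into_entry, singleton_contr_entry, contr_path_entry, match_ext_entry,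
    tree_cofibrant_entry, singleton_path_entry, sections_id_entry, sections_equiv_entry,
    inner_funext_entry, nat_to_inner_entry, tree_to_inner_entry, extend_entry,
    extend_restrict_entry, restrict_extend_entry, tree_extend_entry, tree_restrict_extend_entry,
    tree_extend_restrict_entry, tree_restrict_equiv_entry, main_entry]"

text \<open>Only the constants that are data are unfolded, never those that are proofs of equations.\<close>

definition transparent :: "nat list" where
  "transparent = [0, 1, 2, 3, 4, 5, 6, 7, 33, 34, 35, 38]"

definition type_of :: "nat \<Rightarrow> ptm" where "type_of i = (entries ! i) True 0"
definition body_of :: "nat \<Rightarrow> ptm" where "body_of i = (entries ! i) False 0"

definition signature_below :: "nat \<Rightarrow> signature" where
  "signature_below n i = (if i < n
    then Some (type_of i, if i \<in> set transparent then Some (body_of i) else None) else None)"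


text \<open>The arguments of \<open>check_entry\<close> are evaluated only once.\<close>

definition check_entry :: "nat \<Rightarrow> signature \<Rightarrow> ptm \<Rightarrow> ptm \<Rightarrow> bool" where
  "check_entry n S A t \<longleftrightarrow> consts_below n A \<and> consts_below n t \<and>
    is_some (level_of 100 S (typecheck 100 S) [] Exo A) \<and> is_some (typecheck 100 S [] t (Some A))"

text \<open>Each entry sees only the earlier ones, which excludes circular proofs. The number 100 in
  \<open>check_entry\<close> is the recursion depth granted to the checker.\<close>

definition entry_ok :: "nat \<Rightarrow> bool" where
  "entry_ok n \<longleftrightarrow> check_entry n (signature_below n) (type_of n) (body_of n)"

lemma entries_ok_0: "list_all entry_ok [0..<27]"
  by code_simp

lemma entries_ok_27: "list_all entry_ok [27..<28]"
  by code_simp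

lemma entries_ok_28: "list_all entry_ok [28..<31]"
  by code_simp

lemma entries_ok_31: "list_all entry_ok [31..<32]"
  by code_simp

lemma entries_ok_32: "list_all entry_ok [32..<36]"
  by code_simp

lemma entries_ok_36: "list_all entry_ok [36..<37]"
  by code_simp

lemma entries_ok_37: "list_all entry_ok [37..<39]"
  by code_simp

lemma entries_ok_39: "list_all entry_ok [39..<40]"
  by code_simp

lemma entries_ok_40: "list_all entry_ok [40..<41]"
  by code_simp

lemma entries_ok_41: "list_all entry_ok [41..<42]"
  by code_simp

lemma entries_ok_42: "list_all entry_ok [42..<43]"
  by code_simp

lemma entries_ok: "i < 43 \<Longrightarrow> entry_ok i"
  using entries_ok_0 entries_ok_27 entries_ok_28 entries_ok_31 entries_ok_32 entries_ok_36 entries_ok_37 entries_ok_39 entries_ok_40 entries_ok_41 entries_ok_42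
  unfolding list_all_iff set_upt Ball_def atLeastLessThan_iff
  by (metis le0 not_less)


section \<open>Interpretation of the signature\<close>

lemma tm_of_cong:
  "consts_below n t \<Longrightarrow> (\<And>i. i < n \<Longrightarrow> \<rho> i = \<rho>' i) \<Longrightarrow> tm_of l \<rho> t = tm_of l \<rho>' t"
  by (induction t) auto

text \<open>A new constant is valued by its body, interpreted under the values chosen so far.
  Soundness of the checker types this value in the empty context, so it is closed.\<close>

lemma signature_has_model:
  assumes "\<And>i. i < n \<Longrightarrow> entry_ok i"
  shows "\<exists>\<rho>. (\<forall>i \<sigma>. subst \<sigma> (\<rho> i) = \<rho> i) \<and>
    (\<forall>i < n. typed [] (\<rho> i) (tm_of l \<rho> (type_of i)) \<and> \<rho> i = tm_of l \<rho> (body_of i))"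
  using assms
proof (induction n)
  case 0
  \<comment> \<open>Before any entry is treated, every constant has a closed default value.\<close>
  show ?case by (rule exI [of _ "\<lambda>_. Star Exo"]) simp
next
  case (Suc n)
  then obtain \<rho> where closed: "\<And>i \<sigma>. subst \<sigma> (\<rho> i) = \<rho> i"
    and model: "\<And>i. i < n \<Longrightarrow> typed [] (\<rho> i) (tm_of l \<rho> (type_of i))"
      "\<And>i. i < n \<Longrightarrow> \<rho> i = tm_of l \<rho> (body_of i)"
    by (metis less_Suc_eq)
  interpret signature_model l \<rho> "signature_below n"
    by unfold_locales (auto simp: closed signature_below_def intro: model split: if_splits)
  have ok: "entry_ok n"
    using Suc.prems by simp
  have "\<exists>i. [] \<turnstile> tm_of l \<rho> (type_of n) \<Colon> Uni Exo i"
    using ok is_level_sound [OF typecheck_sound, of _ _ "[]"] wf_Nil by (auto simp: entry_ok_def check_entry_def)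
  moreover from this have "[] \<turnstile> tm_of l \<rho> (body_of n) \<Colon> tm_of l \<rho> (type_of n)"
    using ok check_sound [OF typecheck_sound, of _ "[]"] by (auto simp: entry_ok_def check_entry_def)
  ultimately have n: "typed [] (tm_of l \<rho> (body_of n)) (tm_of l \<rho> (type_of n))"
    by (simp add: typed_def)
  let ?\<rho> = "\<rho>(n := tm_of l \<rho> (body_of n))"
  \<comment> \<open>By \<open>consts_below\<close>, these types and bodies do not mention constant
    \<open>n\<close>, so the update leaves their interpretations unchanged.\<close>
  have below: "tm_of l ?\<rho> (type_of i) = tm_of l \<rho> (type_of i)" "tm_of l ?\<rho> (body_of i) = tm_of l \<rho> (body_of i)" if "i < Suc n" for i
    using Suc.prems [OF that] that by (auto simp: entry_ok_def check_entry_def intro!: tm_of_cong)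
  have "subst \<sigma> (?\<rho> i) = ?\<rho> i" for i \<sigma>
    using closed closed_subst n by (auto simp: typed_def)
  moreover have "typed [] (?\<rho> i) (tm_of l ?\<rho> (type_of i)) \<and> ?\<rho> i = tm_of l ?\<rho> (body_of i)" if "i < Suc n" for i
    using that n model by (cases "i = n") (simp_all add: below)
  ultimately show ?case by blast
qed


section \<open>The theorem\<close>

definition univalence_type :: "nat \<Rightarrow> tm" where
  "univalence_type l = PiT Exo (Uni Inner l) (PiT Exo (Uni Inner l)
    (is_equiv (IdT Inner (Uni Inner l) (Var 1) (Var 0)) (equiv (Var 1) (Var 0)) (id_to_equiv l (Var 1) (Var 0))))"

text \<open>The formation of the type is a hypothesis because it is obtained later, by inversion,
  from the type of the checked constant \<open>main\<close>.\<close>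

lemma univalence_inhabited:
  assumes "[] \<turnstile> univalence_type l \<Colon> Uni Exo i"
  shows "[] \<turnstile> Lam Exo (Uni Inner l) (Lam Exo (Uni Inner l) (UA l (Var 1) (Var 0))) \<Colon> univalence_type l"
proof -
  let ?U = "Uni Inner l"
  let ?E = "is_equiv (IdT Inner ?U (Var 1) (Var 0)) (equiv (Var 1) (Var 0)) (id_to_equiv l (Var 1) (Var 0))"
  obtain j where P: "[?U] \<turnstile> PiT Exo ?U ?E \<Colon> Uni Exo j"
    using Pi_inversion assms unfolding univalence_type_def by blast
  then have wf: "wf [?U, ?U]"
    using Pi_inversion typed_wf by blast
  have "[?U, ?U] \<turnstile> Var 1 \<Colon> ?U" "[?U, ?U] \<turnstile> Var 0 \<Colon> ?U"
    using variable [OF wf, of 1] variable [OF wf, of 0] by simp_all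
  then have "[?U, ?U] \<turnstile> UA l (Var 1) (Var 0) \<Colon> ?E"
    by (rule univalence)
  then show ?thesis
    using Pi_intro P assms unfolding univalence_type_def by blast
qed

lemmas term_defs =
  bvar_def lam_def ilam_def pi_def ipi_def sig_def isig_def app_def iapp_def pair_def ipair_def eq_def ieq_def
  rfl_def irfl_def sig_rec_def isig_rec_def path_rec_def ipath_rec_def ann_def
  Nx_def Ni_def Tx_def Ui_def fun_type_def ifun_type_def exo_prod_def inner_prod_def
  idx_def idi_def compose_def contractible_def exo_isos_def fibrant_def match_of_def into_match_def out_of_match_def
  family_pi_def contractible_pi_def cofibrant_def pi_fibrant_def equivalence_def equivalences_def id_equivalence_def
  path_to_equivalence_def ua_type_def self_fibrant_def fibrant_equivalence_def restriction_equivalence_def sharp_def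
  given_def claim_def

lemmas theory_defs =
  arr_def prodT_def idfun_def is_contr_def is_equiv_def equiv_def id_equiv_def id_to_equiv_def exo_comp_def
  exo_iso_def is_fibrant_def fibrant_match_def to_match_def from_match_def type_fibrant_def is_fibrant_equiv_def
  is_cofibrant_def cofibrant_fibrant_def is_sharp_def

text \<open>No constant occurs in the type of the last entry, so its interpretation is independent
  of \<open>\<rho>\<close>: it is the goal with univalence as an additional premise.\<close>

lemma main_type:
  "tm_of l \<rho> (type_of 42) = arr Exo (univalence_type l) (arr Exo (is_cofibrant l (NatT Exo))
      (prodT Exo (is_cofibrant l UnLBinTree) (is_sharp l UnLBinTree)))"
  by (simp add: type_of_def entries_def main_entry_def term_defs univalence_type_def theory_defs
    inst_def up_def Let_def rename_eq_subst numeral_eq_Suc)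

theorem corollary3p9:
  fixes l :: nat
  shows "derivable
    (arr Exo (is_cofibrant l (NatT Exo))
      (prodT Exo (is_cofibrant l UnLBinTree) (is_sharp l UnLBinTree)))"
    (is "derivable ?G")
proof -
  obtain \<rho> where "\<And>i. i < 43 \<Longrightarrow> typed [] (\<rho> i) (tm_of l \<rho> (type_of i))"
    using signature_has_model [of 43 l, OF entries_ok] by blast
  from this [of 42] have "typed [] (\<rho> 42) (tm_of l \<rho> (type_of 42))"
    by simp
  then have main: "typed [] (\<rho> 42) (PiT Exo (univalence_type l) (lift 1 ?G))"
    unfolding main_type arr_def [of Exo "univalence_type l"] .
  then obtain i where "[] \<turnstile> univalence_type l \<Colon> Uni Exo i"
    using Pi_inversion unfolding typed_def by blast
  from App_typed [OF main univalence_inhabited [OF this]] show ?thesis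
    by (auto simp: derivable_def typed_def)
qed

end
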